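(* For every $n\in\mathbb{N}$, the topos $\mathcal{T}_\mu$ validates $$\forall\phi\in\Omega_{\neg\neg}^{I^n}\ \forall f\in (I^n)^{\{x\in I^n\mid\phi(x)\}}\ \exists y\in I^n\ \big(\phi(y)\Rightarrow f(y)=y\big),$$ where $I=[0,1]\subseteq\mathbb{R}_d$ and $\Omega_{\neg\neg}=\{p\in\Omega\mid\neg\neg p\Rightarrow p\}$ is the set of $\neg\neg$-stable truth values.
   Context: Oracle computability. For $\alpha\in2^{\mathbb{N}}$ let $\varphi^\alpha_m$ enumerate the partial $\alpha$-computable functions $\mathbb{N}\rightharpoonup\mathbb{N}$, with indices independent of $\alpha$. Fix computable bijections $\langle\cdot,\cdot\rangle:\mathbb{N}^2\to\mathbb{N}$ and $n\mapsto q_n:\mathbb{N}\to\mathbb{Q}$. A function $g$ represents $x$ if $|x-q_{g(n)}|<2^{-n}$ for all $n$. Let $r(\alpha)=\sum_i\alpha(i)2^{-i-1}$ and $s(\alpha)(n)=r(m\mapsto\alpha(\langle n,m\rangle))$. For $a:\mathbb{N}\to[0,1]$, $n$ is an $a$-index if a single real is represented by a total $\varphi^\alpha_n$ for every $\alpha\in s^{-1}(a)$. Fix a Miller sequence $\mu:\mathbb{N}\to[0,1]$ (every $\mu$-index $n$ represents $\mu(n)$) and put $M_\mu=s^{-1}(\mu)$. A ppca $(A,P)$ is a set $A$, a nonempty set $P$, and partial applications $a\cdot_pb$ such that some $k,s\in A$ satisfy, for all $p,q,a,b,c$: - $k\cdot_pa=k\cdot_qa$; - $(k\cdot_pa)\cdot_pb=a$;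 - $s\cdot_pa=s\cdot_qa$; - $(s\cdot_pa)\cdot_pb=(s\cdot_qa)\cdot_qb$ (all these defined); - $((s\cdot_pa)\cdot_pb)\cdot_pc\simeq(a\cdot_pc)\cdot_p(b\cdot_pc)$. Its tripos sends $X$ to $\mathcal{P}(A)^X$, with $\phi\le\psi$ iff some $a$ satisfies $a\cdot_pb\in\psi(x)$ for all $x$, $b\in\phi(x)$ and $p$. The logical operations are: - $\top=A$ and $\bot=\emptyset$; - conjunction and disjunction use pairs (disjunction tagged with booleans), uniformly in $p$; - $(\phi\to\psi)(x)=\{a\mid\forall p\,\forall b\in\phi(x):a\cdot_pb\in\psi(x)\}$; - $(\exists_r\phi)(x)=\bigcup_{r(y)=x}\phi(y)$; - $(\forall_r\phi)(x)=\{a\mid\forall y(r(y)=x\Rightarrow\forall b\,\forall q:a\cdot_qb\in\phi(y))\}$. $\mathrm{RT}(A,P)$ is the topos obtained from this tripos by the tripos-to-topos construction. $\mathcal{T}_\mu=\mathrm{RT}(\mathbb{N},M_\mu)$ with $m\cdot_\alpha n=\varphi^\alpha_m(n)$. $\Omega$ is its subobject classifier and $\mathbb{R}_d$ its Dedekind reals. *)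

theory Defs
  imports "HOL-Analysis.Analysis" "HOL-Library.Nat_Bijection"
begin

section \<open>Oracle computability\<close>

text \<open>
  Programs for the unary partial recursive functions relative to an oracle. Pairs, triples etc. are
  coded by the library's \<^const>\<open>prod_encode\<close>.
\<close>

datatype code =
    Zero | Successor | First | Second | Query
  | Pairing code code | Compose code code | Recurse code code | Minimize code

primrec run :: "(nat \<Rightarrow> bool) \<Rightarrow> code \<Rightarrow> nat \<Rightarrow> nat option" where
  "run \<alpha> Zero = (\<lambda>n. Some 0)"
| "run \<alpha> Successor = (\<lambda>n. Some (Suc n))"
| "run \<alpha> First = (\<lambda>n. Some (fst (prod_decode n)))"
| "run \<alpha> Second = (\<lambda>n. Some (snd (prod_decode n)))"
| "run \<alpha> Query = (\<lambda>n. Some (of_bool (\<alpha> n)))"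
| "run \<alpha> (Pairing f g) = (\<lambda>n. Option.bind (run \<alpha> f n) (\<lambda>a.
      Option.bind (run \<alpha> g n) (\<lambda>b. Some (prod_encode (a, b)))))"
| "run \<alpha> (Compose f g) = (\<lambda>n. Option.bind (run \<alpha> g n) (run \<alpha> f))"
| "run \<alpha> (Recurse f g) = (\<lambda>n. rec_nat (run \<alpha> f (fst (prod_decode n)))
      (\<lambda>i v. Option.bind v (\<lambda>b. run \<alpha> g (prod_encode (fst (prod_decode n), prod_encode (i, b)))))
      (snd (prod_decode n)))"
| "run \<alpha> (Minimize f) = (\<lambda>n.
      let is_zero = (\<lambda>k. run \<alpha> f (prod_encode (n, k)) = Some 0 \<and>
                        (\<forall>j<k. run \<alpha> f (prod_encode (n, j)) \<noteq> None))
      in if \<exists>k. is_zero k then Some (LEAST k. is_zero k) else None)"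

primrec encode :: "code \<Rightarrow> nat" where
  "encode Zero = 0"
| "encode Successor = 1"
| "encode First = 2"
| "encode Second = 3"
| "encode Query = 4"
| "encode (Pairing f g) = 5 + 4 * prod_encode (encode f, encode g)"
| "encode (Compose f g) = 6 + 4 * prod_encode (encode f, encode g)"
| "encode (Recurse f g) = 7 + 4 * prod_encode (encode f, encode g)"
| "encode (Minimize f) = 8 + 4 * encode f"

lemma encode_surj: "\<exists>c. encode c = n"
proof (induction n rule: less_induct)
  case (less n)
  show ?case
  proof (cases "n < 5")
    case True
    then consider "n = 0" | "n = 1" | "n = 2" | "n = 3" | "n = 4" by linarith
    then show ?thesis
      by cases (metis encode.simps(1), metis encode.simps(2), metis encode.simps(3),
        metis encode.simps(4), metis encode.simps(5))
  next
    case False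
    define m where "m = (n - 5) div 4"
    obtain a b where ab: "prod_decode m = (a, b)" by fastforce
    then have m: "m = prod_encode (a, b)" by (metis prod_decode_inverse)
    have "m < n" using False unfolding m_def by linarith
    moreover have "a \<le> m" "b \<le> m" unfolding m by (rule le_prod_encode_1, rule le_prod_encode_2)
    ultimately obtain f g h where c: "encode f = a" "encode g = b" "encode h = m"
      using less.IH[of a] less.IH[of b] less.IH[of m] by (metis le_less_trans)
    have "n = 5 + 4 * m \<or> n = 6 + 4 * m \<or> n = 7 + 4 * m \<or> n = 8 + 4 * m"
      using False unfolding m_def by presburger
    then consider "n = encode (Pairing f g)" | "n = encode (Compose f g)"
      | "n = encode (Recurse f g)" | "n = encode (Minimize h)"
      using c m by auto
    then show ?thesis by cases blast+
  qed
qed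

lemma encode_inj: "encode c = encode d \<Longrightarrow> c = d"
proof (induction c arbitrary: d)
  case (Pairing f g) then show ?case by (cases d) (auto, presburger+)
next
  case (Compose f g) then show ?case by (cases d) (auto, presburger+)
next
  case (Recurse f g) then show ?case by (cases d) (auto, presburger+)
next
  case (Minimize f) then show ?case by (cases d) (auto, presburger+)
qed (case_tac d; simp)+

lemma bij_encode: "bij encode"
  unfolding bij_def inj_def surj_def using encode_inj encode_surj by metis

definition phi :: "(nat \<Rightarrow> bool) \<Rightarrow> nat \<Rightarrow> nat \<Rightarrow> nat option" where
  "phi \<alpha> m = run \<alpha> (inv encode m)"

definition computable :: "(nat \<Rightarrow> nat) \<Rightarrow> bool" where
  "computable f \<longleftrightarrow> (\<exists>m. \<forall>n. phi (\<lambda>_. False) m n = Some (f n))"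

definition computable_pairing :: "(nat \<Rightarrow> nat \<Rightarrow> nat) \<Rightarrow> bool" where
  "computable_pairing pr \<longleftrightarrow>
     bij (\<lambda>(a, b). pr a b) \<and> computable (\<lambda>n. case prod_decode n of (a, b) \<Rightarrow> pr a b)"

definition computable_rat_enum :: "(nat \<Rightarrow> rat) \<Rightarrow> bool" where
  "computable_rat_enum q \<longleftrightarrow> bij q \<and>
     (\<exists>a b c. computable a \<and> computable b \<and> computable c \<and>
        (\<forall>n. q n = (of_nat (a n) - of_nat (b n)) / of_nat (Suc (c n))))"


section \<open>Miller sequences\<close>

definition represents :: "(nat \<Rightarrow> rat) \<Rightarrow> (nat \<Rightarrow> nat) \<Rightarrow> real \<Rightarrow> bool" where
  "represents q g x \<longleftrightarrow> (\<forall>n. \<bar>x - of_rat (q (g n))\<bar> < (1 / 2) ^ n)"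

definition real_of_seq :: "(nat \<Rightarrow> bool) \<Rightarrow> real" where
  "real_of_seq \<alpha> = (\<Sum>i. of_bool (\<alpha> i) * (1 / 2) ^ (i + 1))"

definition reals_of_oracle :: "(nat \<Rightarrow> nat \<Rightarrow> nat) \<Rightarrow> (nat \<Rightarrow> bool) \<Rightarrow> nat \<Rightarrow> real" where
  "reals_of_oracle pr \<alpha> n = real_of_seq (\<lambda>m. \<alpha> (pr n m))"

definition oracles :: "(nat \<Rightarrow> nat \<Rightarrow> nat) \<Rightarrow> (nat \<Rightarrow> real) \<Rightarrow> (nat \<Rightarrow> bool) set" where
  "oracles pr a = {\<alpha>. reals_of_oracle pr \<alpha> = a}"

text \<open>
  The number \<open>n\<close> is an \<open>a\<close>-index, and the single real it represents is \<open>x\<close>. The real is required to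
  lie in \<open>[0,1]\<close>: a program that computes, say, the constant \<open>2\<close> would otherwise be an \<open>a\<close>-index
  for every \<open>a\<close>, and no Miller sequence with values in \<open>[0,1]\<close> could exist.
\<close>

definition index_of ::
    "(nat \<Rightarrow> nat \<Rightarrow> nat) \<Rightarrow> (nat \<Rightarrow> rat) \<Rightarrow> (nat \<Rightarrow> real) \<Rightarrow> nat \<Rightarrow> real \<Rightarrow> bool" where
  "index_of pr q a n x \<longleftrightarrow> x \<in> {0..1} \<and>
     (\<forall>\<alpha>\<in>oracles pr a. \<exists>g. (\<forall>k. phi \<alpha> n k = Some (g k)) \<and> represents q g x)"

definition miller_sequence ::
    "(nat \<Rightarrow> nat \<Rightarrow> nat) \<Rightarrow> (nat \<Rightarrow> rat) \<Rightarrow> (nat \<Rightarrow> real) \<Rightarrow> bool" where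
  "miller_sequence pr q \<mu> \<longleftrightarrow> range \<mu> \<subseteq> {0..1} \<and>
     (\<forall>n. (\<exists>x. index_of pr q \<mu> n x) \<longrightarrow> index_of pr q \<mu> n (\<mu> n))"


section \<open>Parameterized partial combinatory algebras\<close>

record ('p, 'a) param_app =
  Param :: "'p set"
  App :: "'p \<Rightarrow> 'a \<Rightarrow> 'a \<Rightarrow> 'a option"

definition ppca_combinators :: "('p, 'a) param_app \<Rightarrow> 'a \<Rightarrow> 'a \<Rightarrow> bool" where
  "ppca_combinators T k s \<longleftrightarrow>
     (let ap = (\<lambda>p x y. Option.bind x (\<lambda>u. Option.bind y (App T p u))) in
      \<forall>p\<in>Param T. \<forall>q\<in>Param T. \<forall>a b c.
        App T p k a = App T q k a \<and>
        ap p (App T p k a) (Some b) = Some a \<and>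
        App T p s a \<noteq> None \<and> App T p s a = App T q s a \<and>
        ap p (App T p s a) (Some b) \<noteq> None \<and>
        ap p (App T p s a) (Some b) = ap q (App T q s a) (Some b) \<and>
        ap p (ap p (App T p s a) (Some b)) (Some c) = ap p (App T p a c) (App T p b c))"

definition ppca :: "('p, 'a) param_app \<Rightarrow> bool" where
  "ppca T \<longleftrightarrow> Param T \<noteq> {} \<and> (\<exists>k s. ppca_combinators T k s)"

definition comb_k :: "('p, 'a) param_app \<Rightarrow> 'a" where
  "comb_k T = (SOME k. \<exists>s. ppca_combinators T k s)"

definition comb_s :: "('p, 'a) param_app \<Rightarrow> 'a" where
  "comb_s T = (SOME s. ppca_combinators T (comb_k T) s)"

text \<open>
  The applications \<open>k a\<close>, \<open>s a\<close> and \<open>s a b\<close> are defined and do not depend on the parameter. The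
  following elements are built from such applications only, so the choice of parameter in
  \<open>app_any\<close> does not matter. For every parameter, \<open>pair a b\<close> applied to \<open>z\<close> is \<open>z a b\<close>; hence
  \<open>pair a b\<close> applied to \<open>bool_true\<close> and \<open>bool_false\<close> gives \<open>a\<close> and \<open>b\<close>.
\<close>

definition app_any :: "('p, 'a) param_app \<Rightarrow> 'a \<Rightarrow> 'a \<Rightarrow> 'a" where
  "app_any T a b = the (App T (SOME p. p \<in> Param T) a b)"

definition comb_i :: "('p, 'a) param_app \<Rightarrow> 'a" where
  "comb_i T = app_any T (app_any T (comb_s T) (comb_k T)) (comb_k T)"

definition bool_true :: "('p, 'a) param_app \<Rightarrow> 'a" where
  "bool_true T = comb_k T"

definition bool_false :: "('p, 'a) param_app \<Rightarrow> 'a" where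
  "bool_false T = app_any T (comb_k T) (comb_i T)"

definition pair :: "('p, 'a) param_app \<Rightarrow> 'a \<Rightarrow> 'a \<Rightarrow> 'a" where
  "pair T a b =
     app_any T (app_any T (comb_s T)
         (app_any T (app_any T (comb_s T) (comb_i T)) (app_any T (comb_k T) a)))
       (app_any T (comb_k T) b)"


section \<open>The tripos\<close>

text \<open>
  The fibre over a type \<open>'x\<close> consists of the predicates \<open>'x \<Rightarrow> 'a set\<close>. The connectives act
  pointwise, so they are given on \<open>'a set\<close>.
\<close>

definition app_in :: "('p, 'a) param_app \<Rightarrow> 'p \<Rightarrow> 'a \<Rightarrow> 'a \<Rightarrow> 'a set \<Rightarrow> bool" where
  "app_in T p a b S \<longleftrightarrow> (\<exists>c\<in>S. App T p a b = Some c)"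

definition tripos_le :: "('p, 'a) param_app \<Rightarrow> ('x \<Rightarrow> 'a set) \<Rightarrow> ('x \<Rightarrow> 'a set) \<Rightarrow> bool" where
  "tripos_le T \<phi> \<psi> \<longleftrightarrow> (\<exists>a. \<forall>x. \<forall>b\<in>\<phi> x. \<forall>p\<in>Param T. app_in T p a b (\<psi> x))"

definition tv_top :: "('p, 'a) param_app \<Rightarrow> 'a set" where
  "tv_top T = UNIV"

definition tv_bot :: "('p, 'a) param_app \<Rightarrow> 'a set" where
  "tv_bot T = {}"

definition tv_and :: "('p, 'a) param_app \<Rightarrow> 'a set \<Rightarrow> 'a set \<Rightarrow> 'a set" where
  "tv_and T P Q = {pair T a b | a b. a \<in> P \<and> b \<in> Q}"

definition tv_or :: "('p, 'a) param_app \<Rightarrow> 'a set \<Rightarrow> 'a set \<Rightarrow> 'a set" where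
  "tv_or T P Q = {pair T (bool_true T) a | a. a \<in> P} \<union> {pair T (bool_false T) b | b. b \<in> Q}"

definition tv_imp :: "('p, 'a) param_app \<Rightarrow> 'a set \<Rightarrow> 'a set \<Rightarrow> 'a set" where
  "tv_imp T P Q = {a. \<forall>p\<in>Param T. \<forall>b\<in>P. app_in T p a b Q}"

definition exists_along ::
    "('p, 'a) param_app \<Rightarrow> ('y \<Rightarrow> 'x) \<Rightarrow> ('y \<Rightarrow> 'a set) \<Rightarrow> 'x \<Rightarrow> 'a set" where
  "exists_along T r \<phi> x = (\<Union>y\<in>{y. r y = x}. \<phi> y)"

definition forall_along ::
    "('p, 'a) param_app \<Rightarrow> ('y \<Rightarrow> 'x) \<Rightarrow> ('y \<Rightarrow> 'a set) \<Rightarrow> 'x \<Rightarrow> 'a set" where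
  "forall_along T r \<phi> x = {a. \<forall>y. r y = x \<longrightarrow> (\<forall>b. \<forall>q\<in>Param T. app_in T q a b (\<phi> y))}"

definition validates :: "('p, 'a) param_app \<Rightarrow> 'a set \<Rightarrow> bool" where
  "validates T P \<longleftrightarrow> tripos_le T (\<lambda>_::unit. tv_top T) (\<lambda>_. P)"


section \<open>The topos and its internal language\<close>

text \<open>
  An object of the topos is a type with a predicate \<open>X x x'\<close> (the truth value of \<open>x \<approx> x'\<close>) that is
  symmetric and transitive in the tripos. An element \<open>x\<close> exists to the extent \<open>X x x\<close>, and the
  quantifiers of the internal language are the tripos quantifiers relativized to existence. All
  definitions are uniform in their free variables, so they also cover objects that depend on a
  variable, such as \<open>{x \<in> X | \<phi> x}\<close> with \<open>\<phi>\<close> variable; quantification over such an object is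
  quantification along a map into a slice of the topos.
\<close>

type_synonym ('a, 'x) obj = "'x \<Rightarrow> 'x \<Rightarrow> 'a set"

context
  fixes T :: "('p, 'a) param_app"
begin

abbreviation conj (infixr "\<^bold>\<and>" 35) where "P \<^bold>\<and> Q \<equiv> tv_and T P Q"
abbreviation disj (infixr "\<^bold>\<or>" 30) where "P \<^bold>\<or> Q \<equiv> tv_or T P Q"
abbreviation impl (infixr "\<^bold>\<longrightarrow>" 25) where "P \<^bold>\<longrightarrow> Q \<equiv> tv_imp T P Q"
abbreviation equi (infixr "\<^bold>\<longleftrightarrow>" 25) where "P \<^bold>\<longleftrightarrow> Q \<equiv> (P \<^bold>\<longrightarrow> Q) \<^bold>\<and> (Q \<^bold>\<longrightarrow> P)"
abbreviation neg ("\<^bold>\<not> _" [40] 40) where "\<^bold>\<not> P \<equiv> P \<^bold>\<longrightarrow> tv_bot T"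

definition tv_all :: "('x \<Rightarrow> 'a set) \<Rightarrow> 'a set" (binder "\<^bold>\<forall>" 10) where
  "tv_all \<phi> = forall_along T (\<lambda>_. ()) \<phi> ()"

definition tv_ex :: "('x \<Rightarrow> 'a set) \<Rightarrow> 'a set" (binder "\<^bold>\<exists>" 10) where
  "tv_ex \<phi> = exists_along T (\<lambda>_. ()) \<phi> ()"

definition forall_in :: "('a, 'x) obj \<Rightarrow> ('x \<Rightarrow> 'a set) \<Rightarrow> 'a set" where
  "forall_in X \<phi> = (\<^bold>\<forall>x. X x x \<^bold>\<longrightarrow> \<phi> x)"

definition exists_in :: "('a, 'x) obj \<Rightarrow> ('x \<Rightarrow> 'a set) \<Rightarrow> 'a set" where
  "exists_in X \<phi> = (\<^bold>\<exists>x. X x x \<^bold>\<and> \<phi> x)"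

definition subobj :: "('a, 'x) obj \<Rightarrow> ('x \<Rightarrow> 'a set) \<Rightarrow> ('a, 'x) obj" where
  "subobj X \<phi> = (\<lambda>x x'. X x x' \<^bold>\<and> \<phi> x)"

definition prod_obj :: "('a, 'x) obj \<Rightarrow> ('a, 'y) obj \<Rightarrow> ('a, 'x \<times> 'y) obj" where
  "prod_obj X Y = (\<lambda>(x, y) (x', y'). X x x' \<^bold>\<and> Y y y')"

text \<open>The \<open>n\<close>-fold product \<open>X \<times> (X \<times> \<dots> \<times> 1)\<close>, carried by the lists of length \<open>n\<close>.\<close>

fun power_obj :: "('a, 'x) obj \<Rightarrow> nat \<Rightarrow> ('a, 'x list) obj" where
  "power_obj X 0 [] [] = tv_top T"
| "power_obj X (Suc n) (x # xs) (x' # xs') = (X x x' \<^bold>\<and> power_obj X n xs xs')"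
| "power_obj X _ _ _ = tv_bot T"

definition Omega :: "('a, 'a set) obj" where
  "Omega = (\<lambda>P Q. P \<^bold>\<longleftrightarrow> Q)"

definition Omega_nn :: "('a, 'a set) obj" where
  "Omega_nn = subobj Omega (\<lambda>P. (\<^bold>\<not> \<^bold>\<not> P) \<^bold>\<longrightarrow> P)"

text \<open>
  The power object \<open>\<Omega>\<^sup>X\<close>: its elements are the strict extensional predicates on \<open>X\<close>.
\<close>

definition pow_obj :: "('a, 'x) obj \<Rightarrow> ('a, 'x \<Rightarrow> 'a set) obj" where
  "pow_obj X = (\<lambda>\<phi> \<psi>.
     (\<^bold>\<forall>x. \<phi> x \<^bold>\<longrightarrow> X x x) \<^bold>\<and>
     (\<^bold>\<forall>x x'. \<phi> x \<^bold>\<and> X x x' \<^bold>\<longrightarrow> \<phi> x') \<^bold>\<and>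
     (\<^bold>\<forall>x. \<phi> x \<^bold>\<longleftrightarrow> \<psi> x))"

text \<open>
  The exponential \<open>Y\<^sup>X\<close>: its elements are the functional relations from \<open>X\<close> to \<open>Y\<close>, which
  are what represents morphisms in the tripos-to-topos construction. The conjuncts say that \<open>F\<close> is
  strict, extensional, single-valued and total, and that \<open>F\<close> and \<open>G\<close> agree.
\<close>

definition exp_obj :: "('a, 'x) obj \<Rightarrow> ('a, 'y) obj \<Rightarrow> ('a, 'x \<Rightarrow> 'y \<Rightarrow> 'a set) obj" where
  "exp_obj X Y = (\<lambda>F G.
     (\<^bold>\<forall>x y. F x y \<^bold>\<longrightarrow> X x x \<^bold>\<and> Y y y) \<^bold>\<and>
     (\<^bold>\<forall>x x' y y'. F x y \<^bold>\<and> X x x' \<^bold>\<and> Y y y' \<^bold>\<longrightarrow> F x' y') \<^bold>\<and>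
     (\<^bold>\<forall>x y y'. F x y \<^bold>\<and> F x y' \<^bold>\<longrightarrow> Y y y') \<^bold>\<and>
     (\<^bold>\<forall>x. X x x \<^bold>\<longrightarrow> (\<^bold>\<exists>y. F x y)) \<^bold>\<and>
     (\<^bold>\<forall>x y. F x y \<^bold>\<longleftrightarrow> G x y))"

text \<open>
  \<open>value_sat F x \<psi>\<close> is the formula \<open>\<psi>(F(x))\<close>, where \<open>F(x)\<close> is the unique \<open>y\<close> related to \<open>x\<close> by the
  functional relation \<open>F\<close>.
\<close>

definition value_sat :: "('x \<Rightarrow> 'y \<Rightarrow> 'a set) \<Rightarrow> 'x \<Rightarrow> ('y \<Rightarrow> 'a set) \<Rightarrow> 'a set" where
  "value_sat F x \<psi> = (\<^bold>\<exists>y. F x y \<^bold>\<and> \<psi> y)"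

text \<open>The truth value of a decidable proposition.\<close>

definition tv_of :: "bool \<Rightarrow> 'a set" where
  "tv_of b = (if b then tv_top T else tv_bot T)"

text \<open>
  The Dedekind reals are the pairs of a lower and an upper cut in \<open>Q\<close>, the object of rational
  numbers.
\<close>

definition is_cut :: "('a, rat) obj \<Rightarrow> (rat \<Rightarrow> 'a set) \<times> (rat \<Rightarrow> 'a set) \<Rightarrow> 'a set" where
  "is_cut Q = (\<lambda>(L, U).
     exists_in Q (\<lambda>r. L r) \<^bold>\<and> exists_in Q (\<lambda>r. U r) \<^bold>\<and>
     forall_in Q (\<lambda>r. L r \<^bold>\<longleftrightarrow> exists_in Q (\<lambda>s. tv_of (r < s) \<^bold>\<and> L s)) \<^bold>\<and>
     forall_in Q (\<lambda>r. U r \<^bold>\<longleftrightarrow> exists_in Q (\<lambda>s. tv_of (s < r) \<^bold>\<and> U s)) \<^bold>\<and>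
     forall_in Q (\<lambda>r. \<^bold>\<not> (L r \<^bold>\<and> U r)) \<^bold>\<and>
     forall_in Q (\<lambda>r. forall_in Q (\<lambda>s. tv_of (r < s) \<^bold>\<longrightarrow> L r \<^bold>\<or> U s)))"

definition dedekind_reals ::
    "('a, rat) obj \<Rightarrow> ('a, (rat \<Rightarrow> 'a set) \<times> (rat \<Rightarrow> 'a set)) obj" where
  "dedekind_reals Q = subobj (prod_obj (pow_obj Q) (pow_obj Q)) (is_cut Q)"

definition rational_real ::
    "('a, rat) obj \<Rightarrow> rat \<Rightarrow> (rat \<Rightarrow> 'a set) \<times> (rat \<Rightarrow> 'a set)" where
  "rational_real Q r = (\<lambda>s. Q s s \<^bold>\<and> tv_of (s < r), \<lambda>s. Q s s \<^bold>\<and> tv_of (r < s))"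

definition real_le :: "('a, rat) obj \<Rightarrow> (rat \<Rightarrow> 'a set) \<times> (rat \<Rightarrow> 'a set) \<Rightarrow>
    (rat \<Rightarrow> 'a set) \<times> (rat \<Rightarrow> 'a set) \<Rightarrow> 'a set" where
  "real_le Q x y = forall_in Q (\<lambda>r. fst x r \<^bold>\<longrightarrow> fst y r)"

definition unit_interval ::
    "('a, rat) obj \<Rightarrow> ('a, (rat \<Rightarrow> 'a set) \<times> (rat \<Rightarrow> 'a set)) obj" where
  "unit_interval Q = subobj (dedekind_reals Q)
     (\<lambda>x. real_le Q (rational_real Q 0) x \<^bold>\<and> real_le Q x (rational_real Q 1))"

end


section \<open>The topos of a Miller sequence\<close>

definition miller_topos ::
    "(nat \<Rightarrow> nat \<Rightarrow> nat) \<Rightarrow> (nat \<Rightarrow> real) \<Rightarrow> (nat \<Rightarrow> bool, nat) param_app" where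
  "miller_topos pr \<mu> = \<lparr>Param = oracles pr \<mu>, App = phi\<rparr>"

text \<open>
  The natural numbers object has carrier \<open>nat\<close>, with each number realized by itself; \<open>q\<close> transports
  it to the object of rational numbers.
\<close>

definition rat_obj :: "(nat \<Rightarrow> rat) \<Rightarrow> (nat, rat) obj" where
  "rat_obj q = (\<lambda>r s. {n. q n = r \<and> r = s})"

end

theory Submission
  imports Defs "HOL-Library.Monad_Syntax"
begin

text \<open>
  The fixed point \<open>y\<close> is sought among the points all of whose coordinates are terms \<open>\<mu> m\<^sub>i\<close> of the
  Miller sequence: every oracle computes a realizer of such a point from the indices alone. By the
  recursion theorem the \<open>m\<^sub>i\<close> can be chosen such that the program \<open>m\<^sub>i\<close> computes rational approximations
  of the \<open>i\<close>-th coordinate of \<open>f y\<close>; the realizer of \<open>\<phi> y\<close> that \<open>f\<close> requires is supplied by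
  \<open>\<not>\<not>\<close>-stability, and if \<open>\<phi> y\<close> fails then the program may diverge. If \<open>\<phi> y\<close> holds, then \<open>f y\<close> does
  not depend on the oracle because \<open>f\<close> is single-valued, so \<open>m\<^sub>i\<close> is a \<open>\<mu>\<close>-index of the \<open>i\<close>-th
  coordinate of \<open>f y\<close>. The property of Miller sequences says that this coordinate is \<open>\<mu> m\<^sub>i\<close>, that is,
  \<open>f y = y\<close>.
\<close>

section \<open>Functions computable uniformly in a set of oracles\<close>

text \<open>The sets that interpret formulas do not depend on the oracle, so a realizer of
  \<open>y\<close> has to describe one and the same point under every oracle. An approximation of
  \<open>f y\<close> found by a single run would not do, because the element that \<open>f\<close>
  returns may change with the oracle. An index of a term of \<mu> is free of this dependence. It
  must also be produced before anything is known about \<open>\<phi> y\<close>; a divergent program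
  does no harm then, because every number names a term of \<mu>. The coordinates refer to each
  other. Instead of a simultaneous fixed point, the recursion theorem is applied once, to a program
  that receives the coordinate and the realizers of \<phi> and \<open>f\<close> as input; the s-m-n
  function then yields the single indices. Equality of reals is not yet a realizer of
  \<open>f y = y\<close>: the cuts of \<open>f y\<close> and of \<open>y\<close> carry different
  realizers, which must be converted into each other uniformly. Oracle searches and the locatedness
  of \<open>f y\<close> achieve this.\<close>

abbreviation pfst :: "nat \<Rightarrow> nat" where "pfst n \<equiv> fst (prod_decode n)"
abbreviation psnd :: "nat \<Rightarrow> nat" where "psnd n \<equiv> snd (prod_decode n)"
abbreviation pp :: "nat \<Rightarrow> nat \<Rightarrow> nat" where "pp a b \<equiv> prod_encode (a, b)"

text \<open>The program is chosen before the oracle. This uniformity is what turns a program into a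
  realizer, since realizers have to work for every parameter in \<open>A\<close>.\<close>

definition pcomp :: "(nat \<Rightarrow> bool) set \<Rightarrow> ((nat \<Rightarrow> bool) \<Rightarrow> nat \<Rightarrow> nat option) \<Rightarrow> bool" where
  "pcomp A F \<longleftrightarrow> (\<exists>c. \<forall>\<alpha>\<in>A. \<forall>n. run \<alpha> c n = F \<alpha> n)"

definition tcomp :: "(nat \<Rightarrow> bool) set \<Rightarrow> ((nat \<Rightarrow> bool) \<Rightarrow> nat \<Rightarrow> nat) \<Rightarrow> bool" where
  "tcomp A f \<longleftrightarrow> pcomp A (\<lambda>\<alpha> x. Some (f \<alpha> x))"

definition dcomp :: "(nat \<Rightarrow> bool) set \<Rightarrow> ((nat \<Rightarrow> bool) \<Rightarrow> nat \<Rightarrow> bool) \<Rightarrow> bool" where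
  "dcomp A P \<longleftrightarrow> tcomp A (\<lambda>\<alpha> x. of_bool (P \<alpha> x))"

lemma pcompI: "(\<And>\<alpha> n. \<alpha> \<in> A \<Longrightarrow> run \<alpha> c n = F \<alpha> n) \<Longrightarrow> pcomp A F"
  unfolding pcomp_def by blast

lemma tcompI: "(\<And>\<alpha> n. \<alpha> \<in> A \<Longrightarrow> run \<alpha> c n = Some (f \<alpha> n)) \<Longrightarrow> tcomp A f"
  unfolding tcomp_def by (rule pcompI)

lemma tcompE:
  assumes "tcomp A f"
  obtains c where "\<And>\<alpha> n. \<alpha> \<in> A \<Longrightarrow> run \<alpha> c n = Some (f \<alpha> n)"
  using assms unfolding tcomp_def pcomp_def by blast

lemma pcompE:
  assumes "pcomp A F"
  obtains c where "\<And>\<alpha> n. \<alpha> \<in> A \<Longrightarrow> run \<alpha> c n = F \<alpha> n"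
  using assms unfolding pcomp_def by blast

lemma pcomp_cong:
  assumes "pcomp A F" "\<And>\<alpha> n. \<alpha> \<in> A \<Longrightarrow> F \<alpha> n = G \<alpha> n"
  shows "pcomp A G"
  using assms unfolding pcomp_def by auto

lemma tcomp_cong:
  assumes "tcomp A f" "\<And>\<alpha> n. \<alpha> \<in> A \<Longrightarrow> f \<alpha> n = g \<alpha> n"
  shows "tcomp A g"
  using assms unfolding tcomp_def pcomp_def by auto

definition code_id :: code where "code_id = Pairing First Second"

lemma run_code_id [simp]: "run \<alpha> code_id n = Some n"
  by (simp add: code_id_def)

primrec code_const :: "nat \<Rightarrow> code" where
  "code_const 0 = Zero"
| "code_const (Suc n) = Compose Successor (code_const n)"

lemma run_code_const [simp]: "run \<alpha> (code_const k) n = Some k"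
  by (induction k) auto

named_theorems comp_intros

lemma pcomp_Some [comp_intros]: "tcomp A f \<Longrightarrow> pcomp A (\<lambda>\<alpha> x. Some (f \<alpha> x))"
  unfolding tcomp_def .

lemma tcomp_id [comp_intros]: "tcomp A (\<lambda>\<alpha> x. x)"
  by (rule tcompI[of _ code_id]) simp

lemma tcomp_const [comp_intros]: "tcomp A (\<lambda>\<alpha> x. k)"
  by (rule tcompI[of _ "code_const k"]) simp

text \<open>The second premise packs the old argument and the new value into one number
  \<open>z\<close>. Every rule that goes under a binder extends the environment in this way, so
  computability can be derived along the shape of a term.\<close>

lemma pcomp_bind [comp_intros]:
  assumes "pcomp A F" "pcomp A (\<lambda>\<alpha> z. G \<alpha> (pfst z) (psnd z))"
  shows "pcomp A (\<lambda>\<alpha> x. Option.bind (F \<alpha> x) (G \<alpha> x))"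
proof -
  obtain c where c: "\<And>\<alpha> n. \<alpha> \<in> A \<Longrightarrow> run \<alpha> c n = F \<alpha> n" using pcompE[OF assms(1)] by blast
  obtain d where d: "\<And>\<alpha> n. \<alpha> \<in> A \<Longrightarrow> run \<alpha> d n = G \<alpha> (pfst n) (psnd n)"
    using pcompE[OF assms(2)] by blast
  show ?thesis
  proof (rule pcompI[of _ "Compose d (Pairing code_id c)"])
    fix \<alpha> n assume "\<alpha> \<in> A"
    then show "run \<alpha> (Compose d (Pairing code_id c)) n = F \<alpha> n \<bind> G \<alpha> n"
      by (cases "F \<alpha> n") (auto simp: c d)
  qed
qed

lemma pcomp_subst:
  assumes "pcomp A F" "tcomp A f"
  shows "pcomp A (\<lambda>\<alpha> x. F \<alpha> (f \<alpha> x))"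
proof -
  obtain c where c: "\<And>\<alpha> n. \<alpha> \<in> A \<Longrightarrow> run \<alpha> c n = F \<alpha> n" using pcompE[OF assms(1)] by blast
  obtain d where d: "\<And>\<alpha> n. \<alpha> \<in> A \<Longrightarrow> run \<alpha> d n = Some (f \<alpha> n)"
    using tcompE[OF assms(2)] by blast
  show ?thesis by (rule pcompI[of _ "Compose c d"]) (simp add: c d)
qed

text \<open>Below a binder the argument \<open>x\<close> has become a projection of
  \<open>z\<close>, and a given function \<open>f\<close> occurs as \<open>f\<close> of that
  projection. Instances of this rule at \<open>f\<close> close such goals.\<close>

lemma tcomp_subst: "tcomp A f \<Longrightarrow> tcomp A g \<Longrightarrow> tcomp A (\<lambda>\<alpha> x. f \<alpha> (g \<alpha> x))"
  unfolding tcomp_def by (rule pcomp_subst[of A "\<lambda>\<alpha> x. Some (f \<alpha> x)" g, unfolded tcomp_def])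

lemma tcomp_Suc [comp_intros]: "tcomp A f \<Longrightarrow> tcomp A (\<lambda>\<alpha> x. Suc (f \<alpha> x))"
  by (rule tcomp_subst[of A "\<lambda>_. Suc"], rule tcompI[of _ Successor]) auto

lemma tcomp_pfst [comp_intros]: "tcomp A f \<Longrightarrow> tcomp A (\<lambda>\<alpha> x. pfst (f \<alpha> x))"
  by (rule tcomp_subst[of A "\<lambda>_. pfst"], rule tcompI[of _ First]) auto

lemma tcomp_psnd [comp_intros]: "tcomp A f \<Longrightarrow> tcomp A (\<lambda>\<alpha> x. psnd (f \<alpha> x))"
  by (rule tcomp_subst[of A "\<lambda>_. psnd"], rule tcompI[of _ Second]) auto

lemma tcomp_query [comp_intros]: "tcomp A f \<Longrightarrow> tcomp A (\<lambda>\<alpha> x. of_bool (\<alpha> (f \<alpha> x)))"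
  by (rule tcomp_subst[of A "\<lambda>\<alpha> x. of_bool (\<alpha> x)"], rule tcompI[of _ Query]) auto

lemma tcomp_pp [comp_intros]:
  assumes "tcomp A f" "tcomp A g" shows "tcomp A (\<lambda>\<alpha> x. pp (f \<alpha> x) (g \<alpha> x))"
proof -
  obtain c where c: "\<And>\<alpha> n. \<alpha> \<in> A \<Longrightarrow> run \<alpha> c n = Some (f \<alpha> n)" using tcompE[OF assms(1)] by blast
  obtain d where d: "\<And>\<alpha> n. \<alpha> \<in> A \<Longrightarrow> run \<alpha> d n = Some (g \<alpha> n)" using tcompE[OF assms(2)] by blast
  show ?thesis by (rule tcompI[of _ "Pairing c d"]) (simp add: c d)
qed

lemma pcomp_rec [comp_intros]:
  assumes "pcomp A F" "pcomp A (\<lambda>\<alpha> z. G \<alpha> (pfst z) (pfst (psnd z)) (psnd (psnd z)))" "tcomp A h"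
  shows "pcomp A (\<lambda>\<alpha> x. rec_nat (F \<alpha> x) (\<lambda>i v. Option.bind v (G \<alpha> x i)) (h \<alpha> x))"
proof -
  obtain c where c: "\<And>\<alpha> n. \<alpha> \<in> A \<Longrightarrow> run \<alpha> c n = F \<alpha> n" using pcompE[OF assms(1)] by blast
  obtain d where d: "\<And>\<alpha> n. \<alpha> \<in> A \<Longrightarrow> run \<alpha> d n = G \<alpha> (pfst n) (pfst (psnd n)) (psnd (psnd n))"
    using pcompE[OF assms(2)] by blast
  obtain e where e: "\<And>\<alpha> n. \<alpha> \<in> A \<Longrightarrow> run \<alpha> e n = Some (h \<alpha> n)" using tcompE[OF assms(3)] by blast
  show ?thesis
    by (rule pcompI[of _ "Compose (Recurse c d) (Pairing code_id e)"]) (simp add: c d e)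
qed

lemma tcomp_rec:
  assumes "tcomp A f" "tcomp A (\<lambda>\<alpha> z. g \<alpha> (pfst z) (pfst (psnd z)) (psnd (psnd z)))" "tcomp A h"
  shows "tcomp A (\<lambda>\<alpha> x. rec_nat (f \<alpha> x) (g \<alpha> x) (h \<alpha> x))"
proof -
  have "pcomp A (\<lambda>\<alpha> x. rec_nat (Some (f \<alpha> x)) (\<lambda>i v. Option.bind v (\<lambda>b. Some (g \<alpha> x i b))) (h \<alpha> x))"
    by (intro comp_intros assms)
  moreover have "rec_nat (Some a) (\<lambda>i v. Option.bind v (\<lambda>b. Some (g i b))) n = Some (rec_nat a g n)"
    for a n :: nat and g by (induction n) auto
  ultimately show ?thesis unfolding tcomp_def by simp
qed

section \<open>Arithmetic, conditionals and decidable predicates\<close>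

lemma tcomp_pred: "tcomp A f \<Longrightarrow> tcomp A (\<lambda>\<alpha> x. f \<alpha> x - 1)"
proof -
  assume "tcomp A f"
  then have "tcomp A (\<lambda>\<alpha> x. rec_nat 0 (\<lambda>i _. i) (f \<alpha> x))" by (intro tcomp_rec comp_intros)
  moreover have "rec_nat 0 (\<lambda>i _. i) n = n - 1" for n by (cases n) auto
  ultimately show ?thesis by simp
qed

lemma tcomp_add [comp_intros]:
  assumes "tcomp A f" "tcomp A g" shows "tcomp A (\<lambda>\<alpha> x. f \<alpha> x + g \<alpha> x)"
proof -
  have "tcomp A (\<lambda>\<alpha> x. rec_nat (f \<alpha> x) (\<lambda>_ v. Suc v) (g \<alpha> x))"
    by (intro tcomp_rec comp_intros assms)
  moreover have "rec_nat a (\<lambda>_ v. Suc v) b = a + b" for a b by (induction b) auto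
  ultimately show ?thesis by simp
qed

lemma tcomp_diff [comp_intros]:
  assumes "tcomp A f" "tcomp A g" shows "tcomp A (\<lambda>\<alpha> x. f \<alpha> x - g \<alpha> x)"
proof -
  have "tcomp A (\<lambda>\<alpha> x. rec_nat (f \<alpha> x) (\<lambda>_ v. v - 1) (g \<alpha> x))"
    by (intro tcomp_rec tcomp_pred comp_intros assms)
  moreover have "rec_nat a (\<lambda>_ v. v - 1) b = a - b" for a b :: nat by (induction b) auto
  ultimately show ?thesis by simp
qed

lemma tcomp_mult [comp_intros]:
  assumes "tcomp A f" "tcomp A g" shows "tcomp A (\<lambda>\<alpha> x. f \<alpha> x * g \<alpha> x)"
proof -
  have "tcomp A (\<lambda>\<alpha> x. rec_nat 0 (\<lambda>_ v. v + f \<alpha> x) (g \<alpha> x))"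
    by (intro tcomp_rec comp_intros tcomp_subst[OF assms(1)] assms)
  moreover have "rec_nat 0 (\<lambda>_ v. v + a) b = a * b" for a b :: nat by (induction b) auto
  ultimately show ?thesis by simp
qed

lemma tcomp_power [comp_intros]:
  assumes "tcomp A f" "tcomp A g" shows "tcomp A (\<lambda>\<alpha> x. f \<alpha> x ^ g \<alpha> x)"
proof -
  have "tcomp A (\<lambda>\<alpha> x. rec_nat 1 (\<lambda>_ v. v * f \<alpha> x) (g \<alpha> x))"
    by (intro tcomp_rec comp_intros tcomp_subst[OF assms(1)] assms)
  moreover have "rec_nat 1 (\<lambda>_ v. v * a) b = a ^ b" for a b :: nat by (induction b) auto
  ultimately show ?thesis by simp
qed

lemma tcomp_if [comp_intros]:
  assumes "dcomp A P" "tcomp A f" "tcomp A g"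
  shows "tcomp A (\<lambda>\<alpha> x. if P \<alpha> x then f \<alpha> x else g \<alpha> x)"
proof -
  \<comment> \<open>A conditional is a primitive recursion of length 0 or 1.\<close>
  have "tcomp A (\<lambda>\<alpha> x. rec_nat (g \<alpha> x) (\<lambda>_ _. f \<alpha> x) (of_bool (P \<alpha> x)))"
    by (intro tcomp_rec comp_intros tcomp_subst[OF assms(2)] assms(1)[unfolded dcomp_def] assms)
  then show ?thesis by (rule tcomp_cong) auto
qed

lemma tcomp_of_bool [comp_intros]: "dcomp A P \<Longrightarrow> tcomp A (\<lambda>\<alpha> x. of_bool (P \<alpha> x))"
  unfolding dcomp_def .

lemma dcomp_less [comp_intros]:
  assumes "tcomp A f" "tcomp A g" shows "dcomp A (\<lambda>\<alpha> x. f \<alpha> x < g \<alpha> x)"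
proof -
  have "tcomp A (\<lambda>\<alpha> x. 1 - (Suc (f \<alpha> x) - g \<alpha> x))" by (intro comp_intros assms)
  then show ?thesis unfolding dcomp_def by (rule tcomp_cong) auto
qed

lemma dcomp_not [comp_intros]:
  assumes "dcomp A P" shows "dcomp A (\<lambda>\<alpha> x. \<not> P \<alpha> x)"
proof -
  have "tcomp A (\<lambda>\<alpha> x. 1 - of_bool (P \<alpha> x))" by (intro comp_intros assms)
  then show ?thesis unfolding dcomp_def by (rule tcomp_cong) auto
qed

lemma dcomp_conj [comp_intros]:
  assumes "dcomp A P" "dcomp A Q" shows "dcomp A (\<lambda>\<alpha> x. P \<alpha> x \<and> Q \<alpha> x)"
proof -
  have "tcomp A (\<lambda>\<alpha> x. of_bool (P \<alpha> x) * of_bool (Q \<alpha> x))" by (intro comp_intros assms)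
  then show ?thesis unfolding dcomp_def by (rule tcomp_cong) auto
qed

lemma dcomp_eq [comp_intros]:
  assumes "tcomp A f" "tcomp A g" shows "dcomp A (\<lambda>\<alpha> x. f \<alpha> x = g \<alpha> x)"
proof -
  have "dcomp A (\<lambda>\<alpha> x. \<not> f \<alpha> x < g \<alpha> x \<and> \<not> g \<alpha> x < f \<alpha> x)" by (intro comp_intros assms)
  moreover have "(\<not> a < b \<and> \<not> b < a) = (a = b)" for a b :: nat by auto
  ultimately show ?thesis by simp
qed

text \<open>The code numbers of the four composite constructors are told apart by a residue modulo
  4, so this modulus is enough for decoding.\<close>

lemma tcomp_mod4 [comp_intros]:
  assumes "tcomp A f" shows "tcomp A (\<lambda>\<alpha> x. f \<alpha> x mod 4)"
proof -
  have "tcomp A (\<lambda>\<alpha> x. rec_nat 0 (\<lambda>_ v. if v = 3 then 0 else Suc v) (f \<alpha> x))"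
    by (intro tcomp_rec comp_intros assms)
  moreover have "rec_nat 0 (\<lambda>_ v. if v = 3 then 0 else Suc v) n = n mod 4" for n
    by (induction n) (auto simp: mod_Suc)
  ultimately show ?thesis by simp
qed

lemma tcomp_div4 [comp_intros]:
  assumes "tcomp A f" shows "tcomp A (\<lambda>\<alpha> x. f \<alpha> x div 4)"
proof -
  have "tcomp A (\<lambda>\<alpha> x. rec_nat 0 (\<lambda>i v. if i mod 4 = 3 then Suc v else v) (f \<alpha> x))"
    by (intro tcomp_rec comp_intros assms)
  moreover have "rec_nat 0 (\<lambda>i v. if i mod 4 = 3 then Suc v else v) n = n div 4" for n :: nat
    by (induction n) (auto simp: div_Suc mod_Suc)
  ultimately show ?thesis by simp
qed

section \<open>Unbounded search\<close>

definition mu_opt :: "(nat \<Rightarrow> nat option) \<Rightarrow> nat option" where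
  "mu_opt F = (let is_zero = (\<lambda>k. F k = Some 0 \<and> (\<forall>j<k. F j \<noteq> None))
     in if \<exists>k. is_zero k then Some (LEAST k. is_zero k) else None)"

lemma pcomp_mu [comp_intros]:
  assumes "pcomp A (\<lambda>\<alpha> z. F \<alpha> (pfst z) (psnd z))"
  shows "pcomp A (\<lambda>\<alpha> x. mu_opt (F \<alpha> x))"
proof -
  obtain c where c: "\<And>\<alpha> n. \<alpha> \<in> A \<Longrightarrow> run \<alpha> c n = F \<alpha> (pfst n) (psnd n)"
    using pcompE[OF assms] by blast
  show ?thesis by (rule pcompI[of _ "Minimize c"]) (simp add: c mu_opt_def)
qed

text \<open>The search stops no later than at \<open>k\<close>, so the test has to be defined only
  up to there.\<close>

lemma mu_opt_eq_LeastI: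
  assumes "P k" "\<And>j. j \<le> k \<Longrightarrow> \<exists>v. F j = Some v \<and> (v = 0 \<longleftrightarrow> P j)"
  shows "mu_opt F = Some (LEAST j. P j)"
proof -
  let ?m = "LEAST j. P j"
  have m: "P ?m" "?m \<le> k" using assms(1) by (auto intro: LeastI Least_le)
  have z: "F ?m = Some 0 \<and> (\<forall>j<?m. F j \<noteq> None)"
    using assms(2)[of ?m] assms(2) m by (metis less_imp_le not_None_eq option.distinct(1) order_trans)
  have "(LEAST j. F j = Some 0 \<and> (\<forall>i<j. F i \<noteq> None)) = ?m"
  proof (rule Least_equality)
    show "F ?m = Some 0 \<and> (\<forall>j<?m. F j \<noteq> None)" by (rule z)
  next
    fix j assume j: "F j = Some 0 \<and> (\<forall>i<j. F i \<noteq> None)"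
    show "?m \<le> j"
    proof (rule ccontr)
      assume "\<not> ?m \<le> j"
      then have "j < ?m" "j \<le> k" using m by auto
      then show False using assms(2)[of j] j not_less_Least by auto
    qed
  qed
  then show ?thesis unfolding mu_opt_def Let_def using z by auto
qed

lemma tcomp_Least:
  assumes "dcomp A (\<lambda>\<alpha> z. P \<alpha> (pfst z) (psnd z))" "\<And>\<alpha> x. \<alpha> \<in> A \<Longrightarrow> \<exists>k. P \<alpha> x k"
  shows "tcomp A (\<lambda>\<alpha> x. LEAST k. P \<alpha> x k)"
proof -
  have "pcomp A (\<lambda>\<alpha> x. mu_opt (\<lambda>k. Some (of_bool (\<not> P \<alpha> x k))))"
    by (intro comp_intros assms)
  then show ?thesis unfolding tcomp_def
  proof (rule pcomp_cong)
    fix \<alpha> x assume "\<alpha> \<in> A"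
    then obtain k where "P \<alpha> x k" using assms(2) by blast
    then show "mu_opt (\<lambda>k. Some (of_bool (\<not> P \<alpha> x k))) = Some (LEAST k. P \<alpha> x k)"
      by (rule mu_opt_eq_LeastI) auto
  qed
qed

section \<open>A universal program\<close>

text \<open>
  An abstract machine. Its states are \<open>evs c n K\<close> (run the program with code \<open>c\<close> on \<open>n\<close>) and
  \<open>ret v K\<close> (return \<open>v\<close>), where the stack \<open>K\<close> is \<open>0\<close> or \<open>push t d K'\<close>. The frame tags \<open>t\<close> are:
  0 for a pairing that waits for its first component, 4 for one that waits for its second component,
  1 for a composition, 2 for a recursion, 3 for a minimization.
\<close>

definition evs :: "nat \<Rightarrow> nat \<Rightarrow> nat \<Rightarrow> nat" where "evs c n K = pp 0 (pp c (pp n K))"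
text \<open>The dummy 0 puts the value and the stack where an evaluation state keeps its argument
  and its stack, so both kinds of state are read with the same projections.\<close>

definition ret :: "nat \<Rightarrow> nat \<Rightarrow> nat" where "ret v K = pp 1 (pp 0 (pp v K))"
definition push :: "nat \<Rightarrow> nat \<Rightarrow> nat \<Rightarrow> nat" where "push t d K = Suc (pp (pp t d) K)"

definition eval_step :: "(nat \<Rightarrow> bool) \<Rightarrow> nat \<Rightarrow> nat \<Rightarrow> nat \<Rightarrow> nat" where
  "eval_step \<alpha> c n K =
    (if c = 0 then ret 0 K else if c = 1 then ret (Suc n) K
     else if c = 2 then ret (pfst n) K else if c = 3 then ret (psnd n) K
     else if c = 4 then ret (of_bool (\<alpha> n)) K
     else if (c - 5) mod 4 = 0 then
       evs (pfst ((c - 5) div 4)) n (push 0 (pp (psnd ((c - 5) div 4)) n) K)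
     else if (c - 5) mod 4 = 1 then
       evs (psnd ((c - 5) div 4)) n (push 1 (pfst ((c - 5) div 4)) K)
     else if (c - 5) mod 4 = 2 then
       evs (pfst ((c - 5) div 4)) (pfst n)
         (push 2 (pp (psnd ((c - 5) div 4)) (pp (pfst n) (pp 0 (psnd n)))) K)
     else evs ((c - 5) div 4) (pp n 0) (push 3 (pp ((c - 5) div 4) (pp n 0)) K))"

text \<open>The data of a recursion frame are the code of the step, the parameter, the index of the
  value that is awaited, and the bound; the frame is removed when index and bound agree. The data of
  a minimization frame are the code, the argument and the candidate being tested.\<close>

definition return_step :: "nat \<Rightarrow> nat \<Rightarrow> nat \<Rightarrow> nat \<Rightarrow> nat" where
  "return_step t d v K =
    (if t = 0 then evs (pfst d) (psnd d) (push 4 v K)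
     else if t = 1 then evs d v K
     else if t = 2 then
       if pfst (psnd (psnd d)) = psnd (psnd (psnd d)) then ret v K
       else evs (pfst d) (pp (pfst (psnd d)) (pp (pfst (psnd (psnd d))) v))
         (push 2 (pp (pfst d) (pp (pfst (psnd d))
            (pp (Suc (pfst (psnd (psnd d)))) (psnd (psnd (psnd d)))))) K)
     else if t = 3 then
       if v = 0 then ret (psnd (psnd d)) K
       else evs (pfst d) (pp (pfst (psnd d)) (Suc (psnd (psnd d))))
         (push 3 (pp (pfst d) (pp (pfst (psnd d)) (Suc (psnd (psnd d))))) K)
     else ret (pp d v) K)"

definition step :: "(nat \<Rightarrow> bool) \<Rightarrow> nat \<Rightarrow> nat" where
  "step \<alpha> s =
    (if pfst s = 0 then eval_step \<alpha> (pfst (psnd s)) (pfst (psnd (psnd s))) (psnd (psnd (psnd s)))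
     else if psnd (psnd (psnd s)) = 0 then s
     else return_step (pfst (pfst (psnd (psnd (psnd s)) - 1))) (psnd (pfst (psnd (psnd (psnd s)) - 1)))
       (pfst (psnd (psnd s))) (psnd (psnd (psnd (psnd s)) - 1)))"

definition halted :: "nat \<Rightarrow> bool" where
  "halted s \<longleftrightarrow> \<not> pfst s = 0 \<and> psnd (psnd (psnd s)) = 0"

lemma tcomp_step: "tcomp A step"
  unfolding step_def eval_step_def return_step_def evs_def ret_def push_def
  by (intro comp_intros)

lemma step_halted: "halted s \<Longrightarrow> step \<alpha> s = s"
  unfolding step_def halted_def by auto

lemma step_evs: "step \<alpha> (evs c n K) = eval_step \<alpha> c n K"
  by (simp add: step_def evs_def)

lemma step_ret: "step \<alpha> (ret v (push t d K)) = return_step t d v K"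
  by (simp add: step_def ret_def push_def)

lemma step_eval:
  "step \<alpha> (evs (encode Zero) n K) = ret 0 K"
  "step \<alpha> (evs (encode Successor) n K) = ret (Suc n) K"
  "step \<alpha> (evs (encode First) n K) = ret (pfst n) K"
  "step \<alpha> (evs (encode Second) n K) = ret (psnd n) K"
  "step \<alpha> (evs (encode Query) n K) = ret (of_bool (\<alpha> n)) K"
  "step \<alpha> (evs (encode (Pairing f g)) n K) = evs (encode f) n (push 0 (pp (encode g) n) K)"
  "step \<alpha> (evs (encode (Compose f g)) n K) = evs (encode g) n (push 1 (encode f) K)"
  "step \<alpha> (evs (encode (Recurse f g)) n K) =
     evs (encode f) (pfst n) (push 2 (pp (encode g) (pp (pfst n) (pp 0 (psnd n)))) K)"
  "step \<alpha> (evs (encode (Minimize f)) n K) =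
     evs (encode f) (pp n 0) (push 3 (pp (encode f) (pp n 0)) K)"
proof -
  have "(4 * w + 1) mod 4 = 1" "(4 * w + 2) mod 4 = 2" "(4 * w + 3) mod 4 = 3"
    "(4 * w + 1) div 4 = w" "(4 * w + 2) div 4 = w" "(4 * w + 3) div 4 = w" for w :: nat
    by presburger+
  note [simp] = this[simplified]
  show
    "step \<alpha> (evs (encode Zero) n K) = ret 0 K"
    "step \<alpha> (evs (encode Successor) n K) = ret (Suc n) K"
    "step \<alpha> (evs (encode First) n K) = ret (pfst n) K"
    "step \<alpha> (evs (encode Second) n K) = ret (psnd n) K"
    "step \<alpha> (evs (encode Query) n K) = ret (of_bool (\<alpha> n)) K"
    "step \<alpha> (evs (encode (Pairing f g)) n K) = evs (encode f) n (push 0 (pp (encode g) n) K)"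
    "step \<alpha> (evs (encode (Compose f g)) n K) = evs (encode g) n (push 1 (encode f) K)"
    "step \<alpha> (evs (encode (Recurse f g)) n K) =
       evs (encode f) (pfst n) (push 2 (pp (encode g) (pp (pfst n) (pp 0 (psnd n)))) K)"
    "step \<alpha> (evs (encode (Minimize f)) n K) =
       evs (encode f) (pp n 0) (push 3 (pp (encode f) (pp n 0)) K)"
    by (simp_all add: step_evs eval_step_def)
qed

lemma step_return [simp]:
  "step \<alpha> (ret v (push 0 (pp c n) K)) = evs c n (push 4 v K)"
  "step \<alpha> (ret v (push 4 a K)) = ret (pp a v) K"
  "step \<alpha> (ret v (push (Suc 0) c K)) = evs c v K"
  "step \<alpha> (ret v (push 2 (pp c (pp x (pp i i))) K)) = ret v K"
  "i < y \<Longrightarrow> step \<alpha> (ret v (push 2 (pp c (pp x (pp i y))) K)) =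
     evs c (pp x (pp i v)) (push 2 (pp c (pp x (pp (Suc i) y))) K)"
  "step \<alpha> (ret 0 (push 3 (pp c (pp n k)) K)) = ret k K"
  "v > 0 \<Longrightarrow> step \<alpha> (ret v (push 3 (pp c (pp n k)) K)) =
     evs c (pp n (Suc k)) (push 3 (pp c (pp n (Suc k))) K)"
  by (simp_all add: step_ret return_step_def)

definition steps :: "(nat \<Rightarrow> bool) \<Rightarrow> nat \<Rightarrow> nat \<Rightarrow> nat \<Rightarrow> bool" where
  "steps \<alpha> t s s' \<longleftrightarrow> (step \<alpha> ^^ t) s = s'"

definition reach :: "(nat \<Rightarrow> bool) \<Rightarrow> nat \<Rightarrow> nat \<Rightarrow> bool" where
  "reach \<alpha> s s' \<longleftrightarrow> (\<exists>t. steps \<alpha> t s s')"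

definition halts :: "(nat \<Rightarrow> bool) \<Rightarrow> nat \<Rightarrow> bool" where
  "halts \<alpha> s \<longleftrightarrow> (\<exists>s'. reach \<alpha> s s' \<and> halted s')"

lemma steps_trans: "steps \<alpha> t s s' \<Longrightarrow> steps \<alpha> t' s' s'' \<Longrightarrow> steps \<alpha> (t' + t) s s''"
  unfolding steps_def by (simp add: funpow_add)

lemma reach_refl: "reach \<alpha> s s"
  unfolding reach_def steps_def by (rule exI[of _ 0]) simp

lemma steps_one: "steps \<alpha> 1 s (step \<alpha> s)"
  unfolding steps_def by simp

lemma reach_trans: "reach \<alpha> s s' \<Longrightarrow> reach \<alpha> s' s'' \<Longrightarrow> reach \<alpha> s s''"
  unfolding reach_def using steps_trans by blast

lemma reach_step: "step \<alpha> s = s1 \<Longrightarrow> reach \<alpha> s1 s' \<Longrightarrow> reach \<alpha> s s'"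
  unfolding reach_def using steps_one steps_trans by blast

lemma funpow_fixed: "f x = x \<Longrightarrow> (f ^^ n) x = x"
  by (induction n) auto

lemma steps_halted: "halted s \<Longrightarrow> steps \<alpha> t s s' \<Longrightarrow> s' = s"
  unfolding steps_def by (simp add: funpow_fixed step_halted)

text \<open>Halted states are fixed points of \<open>step\<close>, so a run may safely be observed
  too late.\<close>

lemma steps_halted_mono:
  assumes "steps \<alpha> t s s'" "halted s'" "t \<le> t'" "steps \<alpha> t' s s''" shows "s'' = s'"
proof -
  obtain d where "t' = d + t" using assms(3) by (metis add.commute le_Suc_ex)
  then have "steps \<alpha> d s' s''" using assms(1,4) unfolding steps_def by (simp add: funpow_add)
  then show ?thesis by (rule steps_halted[OF assms(2)])
qed

text \<open>By determinism the halting run passes through \<open>s'\<close> or has already stopped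
  when \<open>s'\<close> is reached; in the latter case \<open>s'\<close> is the halted state
  itself.\<close>

lemma halts_reach:
  assumes "halts \<alpha> s" "reach \<alpha> s s'" shows "halts \<alpha> s'"
proof -
  obtain t u where t: "steps \<alpha> t s u" "halted u" using assms unfolding halts_def reach_def by blast
  obtain t' where t': "steps \<alpha> t' s s'" using assms unfolding reach_def by blast
  show ?thesis
  proof (cases "t \<le> t'")
    case True
    then show ?thesis using steps_halted_mono[OF t True t'] t(2) reach_refl unfolding halts_def by metis
  next
    case False
    then obtain d where "t = d + t'" by (metis add.commute le_Suc_ex nat_le_linear)
    then have "steps \<alpha> d s' u" using t(1) t' unfolding steps_def by (simp add: funpow_add)
    then show ?thesis using t unfolding halts_def reach_def by blast
  qed
qed

lemma halts_step: "halts \<alpha> s \<Longrightarrow> step \<alpha> s = s' \<Longrightarrow> halts \<alpha> s'"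
  using halts_reach reach_step reach_refl by blast

lemma not_halted_evs: "\<not> halted (evs c n K)"
  unfolding halted_def evs_def by simp

text \<open>The stack is arbitrary because the induction hypotheses are used below the frames pushed
  for subprograms.\<close>

lemma reach_run: "run \<alpha> c n = Some v \<Longrightarrow> reach \<alpha> (evs (encode c) n K) (ret v K)"
proof (induction c arbitrary: n v K)
  case (Pairing f g)
  obtain a b where ab: "run \<alpha> f n = Some a" "run \<alpha> g n = Some b" "v = pp a b"
    using Pairing.prems by (auto simp: bind_eq_Some_conv)
  show ?case unfolding ab(3)
    by (rule reach_step[OF step_eval(6)] reach_trans[OF Pairing.IH(1)[OF ab(1)]]
        reach_step[OF step_return(1)] reach_trans[OF Pairing.IH(2)[OF ab(2)]]
        reach_step[OF step_return(2)] reach_refl)+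
next
  case (Compose f g)
  obtain a where a: "run \<alpha> g n = Some a" "run \<alpha> f a = Some v"
    using Compose.prems by (auto simp: bind_eq_Some_conv)
  show ?case
    by (rule reach_step[OF step_eval(7)] reach_trans[OF Compose.IH(2)[OF a(1)]]
        reach_step[OF step_return(3)[folded One_nat_def]] Compose.IH(1)[OF a(2)])+
next
  case (Recurse f g)
  define x y where "x = pfst n" and "y = psnd n"
  let ?R = "rec_nat (run \<alpha> f x) (\<lambda>i v. Option.bind v (\<lambda>b. run \<alpha> g (pp x (pp i b))))"
  let ?K = "\<lambda>i. push 2 (pp (encode g) (pp x (pp i y))) K"
  have *: "reach \<alpha> (evs (encode f) x (?K 0)) (ret w (?K i))" if "i \<le> y" "?R i = Some w" for i w
    using that
  proof (induction i arbitrary: w)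
    case 0
    then show ?case using Recurse.IH(1) by simp
  next
    case (Suc i)
    then obtain b where b: "?R i = Some b" "run \<alpha> g (pp x (pp i b)) = Some w"
      by (auto simp: bind_eq_Some_conv)
    have "reach \<alpha> (evs (encode f) x (?K 0)) (ret b (?K i))" using Suc b by simp
    moreover have "step \<alpha> (ret b (?K i)) = evs (encode g) (pp x (pp i b)) (?K (Suc i))"
      using Suc.prems by simp
    moreover have "reach \<alpha> (evs (encode g) (pp x (pp i b)) (?K (Suc i))) (ret w (?K (Suc i)))"
      using Recurse.IH(2) b by blast
    ultimately show ?case using reach_step reach_trans by blast
  qed
  have "?R y = Some v" using Recurse.prems by (simp add: x_def y_def)
  then have "reach \<alpha> (evs (encode f) x (?K 0)) (ret v (?K y))" using * by blast
  then have "reach \<alpha> (evs (encode f) x (?K 0)) (ret v K)"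
    by (rule reach_trans[OF _ reach_step[OF step_return(4) reach_refl]])
  then show ?case unfolding x_def y_def by (rule reach_step[OF step_eval(8)])
next
  case (Minimize f)
  let ?Z = "\<lambda>k. run \<alpha> f (pp n k) = Some 0 \<and> (\<forall>j<k. run \<alpha> f (pp n j) \<noteq> None)"
  let ?K = "\<lambda>k. push 3 (pp (encode f) (pp n k)) K"
  have ex: "\<exists>k. ?Z k" and v: "v = (LEAST k. ?Z k)"
    using Minimize.prems by (auto simp: Let_def split: if_splits)
  have Z: "?Z v" unfolding v using ex by (rule LeastI_ex)
  have nz: "\<exists>w. run \<alpha> f (pp n j) = Some w \<and> w > 0" if "j < v" for j
  proof -
    have "run \<alpha> f (pp n j) \<noteq> None" using Z that by simp
    then obtain w where w: "run \<alpha> f (pp n j) = Some w" by auto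
    have "\<not> ?Z j" using that unfolding v by (rule not_less_Least)
    moreover have "\<forall>i<j. run \<alpha> f (pp n i) \<noteq> None" using Z that by simp
    ultimately have "w \<noteq> 0" using w by metis
    then show ?thesis using w by blast
  qed
  have *: "reach \<alpha> (evs (encode f) (pp n 0) (?K 0)) (evs (encode f) (pp n k) (?K k))" if "k \<le> v" for k
    using that
  proof (induction k)
    case 0
    then show ?case using reach_refl by blast
  next
    case (Suc k)
    obtain w where w: "run \<alpha> f (pp n k) = Some w" "w > 0" using nz[of k] Suc.prems by auto
    have "reach \<alpha> (evs (encode f) (pp n k) (?K k)) (ret w (?K k))" using Minimize.IH w by blast
    moreover have "step \<alpha> (ret w (?K k)) = evs (encode f) (pp n (Suc k)) (?K (Suc k))"
      using w by simp
    ultimately have "reach \<alpha> (evs (encode f) (pp n k) (?K k)) (evs (encode f) (pp n (Suc k)) (?K (Suc k)))"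
      using reach_step reach_trans reach_refl by blast
    then show ?case using Suc reach_trans Suc_leD by blast
  qed
  have "reach \<alpha> (evs (encode f) (pp n v) (?K v)) (ret 0 (?K v))" using Minimize.IH Z by blast
  then have "reach \<alpha> (evs (encode f) (pp n 0) (?K 0)) (ret 0 (?K v))"
    using * reach_trans by blast
  then have "reach \<alpha> (evs (encode f) (pp n 0) (?K 0)) (ret v K)"
    by (rule reach_trans[OF _ reach_step[OF step_return(6) reach_refl]])
  then show ?case by (rule reach_step[OF step_eval(9)])
qed (simp only: run.simps option.inject, rule reach_step[OF step_eval(1)] reach_step[OF step_eval(2)]
    reach_step[OF step_eval(3)] reach_step[OF step_eval(4)] reach_step[OF step_eval(5)],
    hypsubst, rule reach_refl)+

text \<open>A halting run of the machine contains halting runs of the subprograms;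
  \<open>reach_run\<close> identifies the values that these return.\<close>

lemma run_halts: "halts \<alpha> (evs (encode c) n K) \<Longrightarrow> \<exists>v. run \<alpha> c n = Some v"
proof (induction c arbitrary: n K)
  case (Pairing f g)
  have "halts \<alpha> (evs (encode f) n (push 0 (pp (encode g) n) K))"
    by (rule halts_step[OF Pairing.prems step_eval(6)])
  then obtain a where a: "run \<alpha> f n = Some a"
    and h: "halts \<alpha> (ret a (push 0 (pp (encode g) n) K))"
    using Pairing.IH(1) reach_run halts_reach by meson
  have "halts \<alpha> (evs (encode g) n (push 4 a K))" by (rule halts_step[OF h]) simp
  then show ?case using a Pairing.IH(2) by fastforce
next
  case (Compose f g)
  have "halts \<alpha> (evs (encode g) n (push 1 (encode f) K))"
    by (rule halts_step[OF Compose.prems step_eval(7)])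
  then obtain a where a: "run \<alpha> g n = Some a" and h: "halts \<alpha> (ret a (push 1 (encode f) K))"
    using Compose.IH(2) reach_run halts_reach by meson
  have "halts \<alpha> (evs (encode f) a K)" by (rule halts_step[OF h]) simp
  then show ?case using a Compose.IH(1) by fastforce
next
  case (Recurse f g)
  define x y where "x = pfst n" and "y = psnd n"
  let ?R = "rec_nat (run \<alpha> f x) (\<lambda>i v. Option.bind v (\<lambda>b. run \<alpha> g (pp x (pp i b))))"
  let ?K = "\<lambda>i. push 2 (pp (encode g) (pp x (pp i y))) K"
  have "\<exists>w. ?R i = Some w \<and> halts \<alpha> (ret w (?K i))" if "i \<le> y" for i
    using that
  proof (induction i)
    case 0
    have h: "halts \<alpha> (evs (encode f) x (?K 0))"
      unfolding x_def y_def by (rule halts_step[OF Recurse.prems step_eval(8)])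
    then obtain w where "run \<alpha> f x = Some w" using Recurse.IH(1) by blast
    then show ?case using h reach_run halts_reach by auto
  next
    case (Suc i)
    then obtain b where b: "?R i = Some b" "halts \<alpha> (ret b (?K i))" by auto
    have h: "halts \<alpha> (evs (encode g) (pp x (pp i b)) (?K (Suc i)))"
      by (rule halts_step[OF b(2)]) (use Suc.prems in simp)
    then obtain w where "run \<alpha> g (pp x (pp i b)) = Some w" using Recurse.IH(2) by blast
    then show ?case using b(1) h reach_run halts_reach by auto
  qed
  then show ?case by (auto simp: x_def y_def)
next
  case (Minimize f)
  let ?Z = "\<lambda>k. run \<alpha> f (pp n k) = Some 0 \<and> (\<forall>j<k. run \<alpha> f (pp n j) \<noteq> None)"
  let ?K = "\<lambda>k. push 3 (pp (encode f) (pp n k)) K"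
  let ?s = "evs (encode f) (pp n 0) (?K 0)"
  have h: "halts \<alpha> ?s" by (rule halts_step[OF Minimize.prems step_eval(9)])
  have "\<exists>k. ?Z k"
  proof (rule ccontr)
    assume nZ: "\<nexists>k. ?Z k"
    \<comment> \<open>Without a zero the machine starts on candidate \<open>k\<close> after at least
      \<open>k\<close> steps. Taking the halting time for \<open>k\<close> finds it running after it
      has halted.\<close>
    have *: "(\<forall>j<k. run \<alpha> f (pp n j) \<noteq> None) \<and>
      (\<exists>t\<ge>k. steps \<alpha> t ?s (evs (encode f) (pp n k) (?K k)))" for k
    proof (induction k)
      case 0
      have "steps \<alpha> 0 ?s ?s" unfolding steps_def by simp
      then show ?case by blast
    next
      case (Suc k)
      then obtain t where t: "t \<ge> k" "steps \<alpha> t ?s (evs (encode f) (pp n k) (?K k))" by blast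
      then have "halts \<alpha> (evs (encode f) (pp n k) (?K k))" using h halts_reach reach_def by blast
      then obtain w where w: "run \<alpha> f (pp n k) = Some w" using Minimize.IH by blast
      have "w \<noteq> 0" using nZ conjunct1[OF Suc] w by metis
      then have st: "step \<alpha> (ret w (?K k)) = evs (encode f) (pp n (Suc k)) (?K (Suc k))" by simp
      obtain t' where t': "steps \<alpha> t' (evs (encode f) (pp n k) (?K k)) (ret w (?K k))"
        using reach_run[OF w] unfolding reach_def by blast
      have "steps \<alpha> (1 + (t' + t)) ?s (evs (encode f) (pp n (Suc k)) (?K (Suc k)))"
        using steps_trans[OF steps_trans[OF t(2) t'] steps_one] unfolding st .
      moreover have "1 + (t' + t) \<ge> Suc k" using t by simp
      moreover have "\<forall>j<Suc k. run \<alpha> f (pp n j) \<noteq> None" using Suc w less_Suc_eq by auto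
      ultimately show ?case by blast
    qed
    obtain t s' where ts: "steps \<alpha> t ?s s'" "halted s'" using h unfolding halts_def reach_def by blast
    obtain t' where t': "t' \<ge> t" "steps \<alpha> t' ?s (evs (encode f) (pp n t) (?K t))" using *[of t] by blast
    show False using steps_halted_mono[OF ts t'] ts(2) not_halted_evs by metis
  qed
  then show ?case by (simp add: Let_def)
qed simp_all

lemma phi_encode: "phi \<alpha> (encode c) = run \<alpha> c"
  unfolding phi_def by (simp add: inv_f_f bij_encode bij_is_inj)

lemma halted_ret [simp]: "halted (ret v K) \<longleftrightarrow> K = 0"
  unfolding halted_def ret_def by simp

text \<open>Iterating \<open>step\<close> is a primitive recursion in the number of steps, so a
  single minimization, over the halting time, suffices. The result is then read off the final
  state.\<close>

lemma pcomp_universal: "pcomp A (\<lambda>\<alpha> z. phi \<alpha> (pfst z) (psnd z))"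
proof -
  let ?S = "\<lambda>\<alpha> z t. rec_nat (evs (pfst z) (psnd z) 0) (\<lambda>_ s. step \<alpha> s) t"
  have S: "?S \<alpha> z t = (step \<alpha> ^^ t) (evs (pfst z) (psnd z) 0)" for \<alpha> z t
    by (induction t) auto
  have cs: "tcomp A (\<lambda>\<alpha> w. ?S \<alpha> (f \<alpha> w) (g \<alpha> w))" if "tcomp A f" "tcomp A g" for f g
    unfolding evs_def by (intro tcomp_rec tcomp_subst[OF tcomp_step] comp_intros that)
  have "pcomp A (\<lambda>\<alpha> z. mu_opt (\<lambda>t. Some (of_bool (\<not> halted (?S \<alpha> z t)))) \<bind>
          (\<lambda>t. Some (pfst (psnd (psnd (?S \<alpha> z t))))))"
    unfolding halted_def by (intro comp_intros cs)
  then show ?thesis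
  proof (rule pcomp_cong)
    fix \<alpha> z
    obtain c where c: "pfst z = encode c" using bij_encode by (metis bij_pointE)
    let ?s = "evs (encode c) (psnd z) 0"
    have S': "?S \<alpha> z t = (step \<alpha> ^^ t) ?s" for t using S[where z = z] unfolding c .
    show "mu_opt (\<lambda>t. Some (of_bool (\<not> halted (?S \<alpha> z t)))) \<bind>
          (\<lambda>t. Some (pfst (psnd (psnd (?S \<alpha> z t))))) = phi \<alpha> (pfst z) (psnd z)"
    proof (cases "run \<alpha> c (psnd z)")
      case None
      then have "\<not> halts \<alpha> ?s" using run_halts by (metis option.distinct(1))
      then have "\<not> halted (?S \<alpha> z t)" for t
        unfolding S' steps_def halts_def reach_def by auto
      then have "mu_opt (\<lambda>t. Some (of_bool (\<not> halted (?S \<alpha> z t)))) = None"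
        unfolding mu_opt_def by (auto simp: Let_def)
      then show ?thesis using None by (simp add: c phi_encode)
    next
      case (Some v)
      then obtain t where t: "?S \<alpha> z t = ret v 0" unfolding S'
        using reach_run[OF Some] unfolding steps_def reach_def by blast
      let ?m = "LEAST t. halted (?S \<alpha> z t)"
      have h: "halted (?S \<alpha> z t)" by (simp add: t)
      have m: "halted (?S \<alpha> z ?m)" "?m \<le> t" 
        using LeastI[where P = "\<lambda>t. halted (?S \<alpha> z t)", OF h]
          Least_le[where P = "\<lambda>t. halted (?S \<alpha> z t)", OF h] by blast+
      have "mu_opt (\<lambda>t. Some (of_bool (\<not> halted (?S \<alpha> z t)))) = Some ?m"
        by (rule mu_opt_eq_LeastI[of _ t]) (auto simp: t)
      \<comment> \<open>The least halting time is at most \<open>t\<close>, and from then on the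
        state no longer changes.\<close>
      moreover have "?S \<alpha> z ?m = ret v 0"
        using steps_halted_mono[of \<alpha> ?m ?s "?S \<alpha> z ?m" t "ret v 0"] m t
        unfolding steps_def S' by simp
      ultimately show ?thesis using Some by (simp add: c phi_encode ret_def)
    qed
  qed
qed

lemma pcomp_phi [comp_intros]:
  assumes "tcomp A f" "tcomp A g" shows "pcomp A (\<lambda>\<alpha> x. phi \<alpha> (f \<alpha> x) (g \<alpha> x))"
  using pcomp_subst[OF pcomp_universal tcomp_pp[OF assms]] by simp

definition code_of :: "(nat \<Rightarrow> bool) set \<Rightarrow> ((nat \<Rightarrow> bool) \<Rightarrow> nat \<Rightarrow> nat option) \<Rightarrow> code" where
  "code_of A F = (SOME c. \<forall>\<alpha>\<in>A. \<forall>n. run \<alpha> c n = F \<alpha> n)"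

lemma run_code_of: "pcomp A F \<Longrightarrow> \<alpha> \<in> A \<Longrightarrow> run \<alpha> (code_of A F) n = F \<alpha> n"
  unfolding pcomp_def code_of_def by (rule someI2_ex) auto

text \<open>The s-m-n function; the index \<open>clos A F x\<close> works for all oracles in \<open>A\<close> at once.\<close>

definition clos ::
    "(nat \<Rightarrow> bool) set \<Rightarrow> ((nat \<Rightarrow> bool) \<Rightarrow> nat \<Rightarrow> nat \<Rightarrow> nat option) \<Rightarrow> nat \<Rightarrow> nat" where
  "clos A F x = encode (Compose (code_of A (\<lambda>\<alpha> z. F \<alpha> (pfst z) (psnd z)))
     (Pairing (code_const x) code_id))"

lemma phi_clos:
  assumes "pcomp A (\<lambda>\<alpha> z. F \<alpha> (pfst z) (psnd z))" "\<alpha> \<in> A"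
  shows "phi \<alpha> (clos A F x) y = F \<alpha> x y"
  unfolding clos_def phi_encode by (simp add: run_code_of[OF assms])

lemma tcomp_clos [comp_intros]:
  assumes "tcomp A f" shows "tcomp A (\<lambda>\<alpha> x. clos B F (f \<alpha> x))"
proof -
  \<comment> \<open>In this recursion 0 and 1 are the codes of \<open>Zero\<close> and
    \<open>Successor\<close>, and 6 is the offset of \<open>Compose\<close>.\<close>
  have rec: "rec_nat 0 (\<lambda>_ v. 6 + 4 * pp 1 v) n = encode (code_const n)" for n
    by (induction n) auto
  have "tcomp A (\<lambda>\<alpha> x. rec_nat 0 (\<lambda>_ v. 6 + 4 * pp 1 v) (f \<alpha> x))"
    by (intro tcomp_rec comp_intros assms)
  then have "tcomp A (\<lambda>\<alpha> x. encode (code_const (f \<alpha> x)))" unfolding rec .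
  then show ?thesis unfolding clos_def encode.simps by (intro comp_intros)
qed

text \<open>\<^const>\<open>computable\<close> refers to the empty oracle, whose queries \<^const>\<open>Zero\<close> answers.\<close>

primrec erase_query :: "code \<Rightarrow> code" where
  "erase_query Zero = Zero"
| "erase_query Successor = Successor"
| "erase_query First = First"
| "erase_query Second = Second"
| "erase_query Query = Zero"
| "erase_query (Pairing f g) = Pairing (erase_query f) (erase_query g)"
| "erase_query (Compose f g) = Compose (erase_query f) (erase_query g)"
| "erase_query (Recurse f g) = Recurse (erase_query f) (erase_query g)"
| "erase_query (Minimize f) = Minimize (erase_query f)"

lemma run_erase_query: "run \<alpha> (erase_query c) = run (\<lambda>_. False) c"
  by (induction c) auto

lemma tcomp_computable:
  assumes "computable f" "tcomp A g" shows "tcomp A (\<lambda>\<alpha> x. f (g \<alpha> x))"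
proof (rule tcomp_subst[OF _ assms(2)])
  obtain m where "\<And>n. phi (\<lambda>_. False) m n = Some (f n)" using assms(1) unfolding computable_def by blast
  then show "tcomp A (\<lambda>_. f)"
    by (intro tcompI[of _ "erase_query (inv encode m)"]) (simp add: run_erase_query phi_def)
qed

section \<open>Realizers\<close>

locale oracle_pca =
  fixes A :: "(nat \<Rightarrow> bool) set"
begin

definition T :: "(nat \<Rightarrow> bool, nat) param_app" where
  "T = \<lparr>Param = A, App = phi\<rparr>"

lemma T_simps [simp]: "Param T = A" "App T = phi"
  by (simp_all add: T_def)

text \<open>Nested s-m-n indices do what is required. They are numbers that do not mention the
  oracle, whence the independence of the parameter.\<close>

lemma ppca_combinators_exist: "\<exists>k s. ppca_combinators T k s"
proof -
  let ?K = "clos A (\<lambda>\<alpha> a b. Some a)"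
  let ?k = "clos A (\<lambda>\<alpha> _ a. Some (?K a)) 0"
  let ?S = "\<lambda>\<alpha> w c. Option.bind (phi \<alpha> (pfst w) c) (\<lambda>u. Option.bind (phi \<alpha> (psnd w) c) (phi \<alpha> u))"
  let ?s2 = "clos A (\<lambda>\<alpha> a b. Some (clos A ?S (pp a b)))"
  let ?s = "clos A (\<lambda>\<alpha> _ a. Some (?s2 a)) 0"
  have K: "phi \<alpha> (?K a) b = Some a" if "\<alpha> \<in> A" for \<alpha> a b
    by (rule phi_clos[OF _ that]) (intro comp_intros)
  have k: "phi \<alpha> ?k a = Some (?K a)" if "\<alpha> \<in> A" for \<alpha> a
    by (rule phi_clos[OF _ that]) (intro comp_intros)
  have s: "phi \<alpha> ?s a = Some (?s2 a)" if "\<alpha> \<in> A" for \<alpha> a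
    by (rule phi_clos[OF _ that]) (intro comp_intros)
  have s2: "phi \<alpha> (?s2 a) b = Some (clos A ?S (pp a b))" if "\<alpha> \<in> A" for \<alpha> a b
    by (rule phi_clos[OF _ that]) (intro comp_intros)
  have S: "phi \<alpha> (clos A ?S w) c = ?S \<alpha> w c" if "\<alpha> \<in> A" for \<alpha> w c
    by (rule phi_clos[OF _ that]) (intro comp_intros)
  have "ppca_combinators T ?k ?s"
    unfolding ppca_combinators_def Let_def by (auto simp: K k s s2 S)
  then show ?thesis by blast
qed

lemma combinators: "ppca_combinators T (comb_k T) (comb_s T)"
proof -
  have "\<exists>s. ppca_combinators T (comb_k T) s"
    unfolding comb_k_def using ppca_combinators_exist by (rule someI_ex)
  then show ?thesis unfolding comb_s_def by (rule someI_ex)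
qed

abbreviation kap :: "nat \<Rightarrow> nat" where "kap a \<equiv> app_any T (comb_k T) a"
abbreviation sap :: "nat \<Rightarrow> nat" where "sap a \<equiv> app_any T (comb_s T) a"
abbreviation sap2 :: "nat \<Rightarrow> nat \<Rightarrow> nat" where "sap2 a b \<equiv> app_any T (sap a) b"

lemma app_any_eqI:
  assumes "\<alpha> \<in> A" "phi \<alpha> a b \<noteq> None" "\<And>\<alpha> \<beta>. \<alpha> \<in> A \<Longrightarrow> \<beta> \<in> A \<Longrightarrow> phi \<alpha> a b = phi \<beta> a b"
  shows "phi \<alpha> a b = Some (app_any T a b)"
proof -
  have "(SOME \<beta>. \<beta> \<in> A) \<in> A" using someI[where P = "\<lambda>\<beta>. \<beta> \<in> A", OF assms(1)] .
  then have "phi (SOME \<beta>. \<beta> \<in> A) a b = phi \<alpha> a b" using assms by blast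
  then show ?thesis using assms(2) unfolding app_any_def T_simps by auto
qed

lemma comb_props:
  assumes "\<alpha> \<in> A" "\<beta> \<in> A"
  shows "phi \<alpha> (comb_k T) a = phi \<beta> (comb_k T) a"
    "Option.bind (phi \<alpha> (comb_k T) a) (\<lambda>u. phi \<alpha> u b) = Some a"
    "phi \<alpha> (comb_s T) a \<noteq> None" "phi \<alpha> (comb_s T) a = phi \<beta> (comb_s T) a"
    "Option.bind (phi \<alpha> (comb_s T) a) (\<lambda>u. phi \<alpha> u b) \<noteq> None"
    "Option.bind (phi \<alpha> (comb_s T) a) (\<lambda>u. phi \<alpha> u b) =
     Option.bind (phi \<beta> (comb_s T) a) (\<lambda>u. phi \<beta> u b)"
    "Option.bind (Option.bind (phi \<alpha> (comb_s T) a) (\<lambda>u. phi \<alpha> u b)) (\<lambda>u. phi \<alpha> u c) =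
     Option.bind (phi \<alpha> a c) (\<lambda>u. Option.bind (phi \<alpha> b c) (phi \<alpha> u))"
  using combinators assms unfolding ppca_combinators_def Let_def T_simps bind.simps by blast+

lemma phi_k: assumes "\<alpha> \<in> A" shows "phi \<alpha> (comb_k T) a = Some (kap a)"
proof (rule app_any_eqI[OF assms])
  show "phi \<alpha> (comb_k T) a \<noteq> None" using comb_props(2)[OF assms assms, of a 0] by (metis bind.simps(1) option.distinct(1))
  show "phi \<alpha> (comb_k T) a = phi \<beta> (comb_k T) a" if "\<alpha> \<in> A" "\<beta> \<in> A" for \<alpha> \<beta>
    using that by (rule comb_props(1))
qed

lemma phi_kap: "\<alpha> \<in> A \<Longrightarrow> phi \<alpha> (kap a) b = Some a"
  using comb_props(2)[of \<alpha> \<alpha> a b] phi_k[of \<alpha> a] by simp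

lemma phi_s: assumes "\<alpha> \<in> A" shows "phi \<alpha> (comb_s T) a = Some (sap a)"
proof (rule app_any_eqI[OF assms])
  show "phi \<alpha> (comb_s T) a \<noteq> None" using assms assms by (rule comb_props(3))
  show "phi \<alpha> (comb_s T) a = phi \<beta> (comb_s T) a" if "\<alpha> \<in> A" "\<beta> \<in> A" for \<alpha> \<beta>
    using that by (rule comb_props(4))
qed

lemma phi_sap: assumes "\<alpha> \<in> A" shows "phi \<alpha> (sap a) b = Some (sap2 a b)"
proof (rule app_any_eqI[OF assms])
  show "phi \<alpha> (sap a) b \<noteq> None" using comb_props(5)[OF assms assms, of a b] phi_s[OF assms, of a] by simp
  show "phi \<alpha> (sap a) b = phi \<beta> (sap a) b" if "\<alpha> \<in> A" "\<beta> \<in> A" for \<alpha> \<beta>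
    using comb_props(6)[OF that, of a b] phi_s[OF that(1), of a] phi_s[OF that(2), of a] by auto
qed

lemma phi_sap2: "\<alpha> \<in> A \<Longrightarrow> phi \<alpha> (sap2 a b) c =
    Option.bind (phi \<alpha> a c) (\<lambda>u. Option.bind (phi \<alpha> b c) (phi \<alpha> u))"
  using comb_props(7)[of \<alpha> \<alpha> a b c] phi_s[of \<alpha> a] phi_sap[of \<alpha> a b] by simp

lemma phi_i: "\<alpha> \<in> A \<Longrightarrow> phi \<alpha> (comb_i T) a = Some a"
  unfolding comb_i_def by (simp add: phi_sap2 phi_k phi_kap)

text \<open>The combinators are known only up to their equations, since they come from a choice
  operator. Pairing is therefore computed not from their codes but by actually running the
  applications that define it.\<close>

lemma tcomp_app_any:
  assumes "tcomp A f" "tcomp A g"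
    and "\<And>\<alpha> x. \<alpha> \<in> A \<Longrightarrow> phi \<alpha> (f \<alpha> x) (g \<alpha> x) = Some (app_any T (f \<alpha> x) (g \<alpha> x))"
  shows "tcomp A (\<lambda>\<alpha> x. app_any T (f \<alpha> x) (g \<alpha> x))"
  unfolding tcomp_def by (rule pcomp_cong[OF pcomp_phi[OF assms(1,2)] assms(3)])

lemma tcomp_kap: "tcomp A f \<Longrightarrow> tcomp A (\<lambda>\<alpha> x. kap (f \<alpha> x))"
  by (rule tcomp_app_any[OF tcomp_const _ phi_k])

lemma tcomp_sap2:
  assumes "tcomp A f" "tcomp A g" shows "tcomp A (\<lambda>\<alpha> x. sap2 (f \<alpha> x) (g \<alpha> x))"
proof -
  have "tcomp A (\<lambda>\<alpha> x. sap (f \<alpha> x))"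
    by (rule tcomp_app_any[OF tcomp_const assms(1) phi_s])
  then show ?thesis by (rule tcomp_app_any[OF _ assms(2) phi_sap])
qed

lemma tcomp_pair [comp_intros]:
  "tcomp A f \<Longrightarrow> tcomp A g \<Longrightarrow> tcomp A (\<lambda>\<alpha> x. pair T (f \<alpha> x) (g \<alpha> x))"
  unfolding pair_def by (intro tcomp_sap2 tcomp_kap comp_intros)

definition prj1 :: "(nat \<Rightarrow> bool) \<Rightarrow> nat \<Rightarrow> nat option" where
  "prj1 \<alpha> a = phi \<alpha> a (bool_true T)"

definition prj2 :: "(nat \<Rightarrow> bool) \<Rightarrow> nat \<Rightarrow> nat option" where
  "prj2 \<alpha> a = phi \<alpha> a (bool_false T)"

lemma prj_pair [simp]:
  assumes "\<alpha> \<in> A" shows "prj1 \<alpha> (pair T a b) = Some a" "prj2 \<alpha> (pair T a b) = Some b"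
  unfolding prj1_def prj2_def pair_def bool_true_def bool_false_def
  by (simp_all add: phi_sap2[OF assms] phi_i[OF assms] phi_kap[OF assms] phi_k[OF assms])

lemma pcomp_prj [comp_intros]:
  assumes "tcomp A f"
  shows "pcomp A (\<lambda>\<alpha> x. prj1 \<alpha> (f \<alpha> x))" "pcomp A (\<lambda>\<alpha> x. prj2 \<alpha> (f \<alpha> x))"
  unfolding prj1_def prj2_def by (intro comp_intros assms)+

lemma bool_true_neq_false: assumes "\<alpha> \<in> A" shows "bool_true T \<noteq> bool_false T"
proof
  assume "bool_true T = bool_false T"
  then have "prj1 \<alpha> (pair T 0 1) = prj2 \<alpha> (pair T 0 1)" unfolding prj1_def prj2_def by simp
  then show False using assms by simp
qed

section \<open>Introduction and elimination of realizers\<close>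

lemma tv_andI: "a \<in> P \<Longrightarrow> b \<in> Q \<Longrightarrow> pair T a b \<in> tv_and T P Q"
  unfolding tv_and_def by blast

lemma tv_andE:
  assumes "c \<in> tv_and T P Q" obtains a b where "c = pair T a b" "a \<in> P" "b \<in> Q"
  using assms unfolding tv_and_def by blast

text \<open>The number \<open>x\<close> carries the data on which the realizer depends, so that the
  realizer is itself computable from these data by \<open>tcomp_clos\<close>.\<close>

lemma tv_impI:
  assumes "pcomp A (\<lambda>\<alpha> z. F \<alpha> (pfst z) (psnd z))"
    and "\<And>\<alpha> b. \<alpha> \<in> A \<Longrightarrow> b \<in> P \<Longrightarrow> \<exists>c\<in>Q. F \<alpha> x b = Some c"
  shows "clos A F x \<in> tv_imp T P Q"
  unfolding tv_imp_def app_in_def using assms(2) by (simp add: phi_clos[OF assms(1)])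

lemma tv_impD:
  assumes "a \<in> tv_imp T P Q" "b \<in> P" "\<alpha> \<in> A"
  shows "\<exists>c\<in>Q. phi \<alpha> a b = Some c"
  using assms unfolding tv_imp_def app_in_def by auto

text \<open>A realizer of a universal quantification is first applied to an arbitrary argument that
  carries no information. Constant functions absorb it; eliminations supply 0.\<close>

definition const_rz :: "nat \<Rightarrow> nat" where "const_rz = clos A (\<lambda>\<alpha> a _. Some a)"

lemma phi_const_rz: "\<alpha> \<in> A \<Longrightarrow> phi \<alpha> (const_rz a) b = Some a"
  unfolding const_rz_def by (rule phi_clos) (intro comp_intros)

lemma tcomp_const_rz [comp_intros]: "tcomp B f \<Longrightarrow> tcomp B (\<lambda>\<alpha> x. const_rz (f \<alpha> x))"
  unfolding const_rz_def by (rule tcomp_clos)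

lemma tv_allI: "(\<And>y. a \<in> \<phi> y) \<Longrightarrow> const_rz a \<in> tv_all T \<phi>"
  unfolding tv_all_def forall_along_def app_in_def by (simp add: phi_const_rz)

lemma tv_allD: "a \<in> tv_all T \<phi> \<Longrightarrow> \<alpha> \<in> A \<Longrightarrow> \<exists>c\<in>\<phi> y. phi \<alpha> a b = Some c"
  unfolding tv_all_def forall_along_def app_in_def by simp

lemma tv_ex_iff: "a \<in> tv_ex T \<phi> \<longleftrightarrow> (\<exists>x. a \<in> \<phi> x)"
  unfolding tv_ex_def exists_along_def by simp

lemma forall_inI:
  assumes "pcomp A (\<lambda>\<alpha> z. F \<alpha> (pfst z) (psnd z))"
    and "\<And>y \<alpha> b. \<alpha> \<in> A \<Longrightarrow> b \<in> X y y \<Longrightarrow> \<exists>c\<in>\<phi> y. F \<alpha> x b = Some c"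
  shows "const_rz (clos A F x) \<in> forall_in T X \<phi>"
  unfolding forall_in_def using assms by (intro tv_allI tv_impI)

lemma all_impD:
  assumes "a \<in> tv_all T (\<lambda>x. tv_imp T (P x) (Q x))" "b \<in> P x" "\<alpha> \<in> A"
  shows "\<exists>c\<in>Q x. Option.bind (phi \<alpha> a 0) (\<lambda>a. phi \<alpha> a b) = Some c"
proof -
  obtain a' where "a' \<in> tv_imp T (P x) (Q x)" "phi \<alpha> a 0 = Some a'"
    using tv_allD[OF assms(1,3)] by blast
  then show ?thesis using tv_impD[OF _ assms(2,3)] by simp
qed

lemma all2_impD:
  assumes "a \<in> tv_all T (\<lambda>x. tv_all T (\<lambda>y. tv_imp T (P x y) (Q x y)))" "b \<in> P x y" "\<alpha> \<in> A"
  shows "\<exists>c\<in>Q x y. Option.bind (phi \<alpha> a 0) (\<lambda>a. Option.bind (phi \<alpha> a 0) (\<lambda>a. phi \<alpha> a b)) = Some c"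
proof -
  obtain a' where "a' \<in> tv_all T (\<lambda>y. tv_imp T (P x y) (Q x y))" "phi \<alpha> a 0 = Some a'"
    using tv_allD[OF assms(1,3), where y = x and b = 0] by blast
  then show ?thesis using all_impD[where P = "P x" and Q = "Q x", OF _ assms(2,3)] by simp
qed

lemma forall_inD:
  assumes "a \<in> forall_in T X \<phi>" "b \<in> X y y" "\<alpha> \<in> A"
  shows "\<exists>c\<in>\<phi> y. Option.bind (phi \<alpha> a 0) (\<lambda>a. phi \<alpha> a b) = Some c"
  using all_impD[OF assms(1)[unfolded forall_in_def] assms(2,3)] .

lemma exists_inI: "a \<in> X y y \<Longrightarrow> b \<in> \<phi> y \<Longrightarrow> pair T a b \<in> exists_in T X \<phi>"
  unfolding exists_in_def tv_ex_iff using tv_andI by blast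

lemma exists_inE:
  assumes "c \<in> exists_in T X \<phi>" obtains y a b where "c = pair T a b" "a \<in> X y y" "b \<in> \<phi> y"
  using assms unfolding exists_in_def tv_ex_iff by (blast elim: tv_andE)

lemma tv_imp_nonempty: "A \<noteq> {} \<Longrightarrow> tv_imp T P Q \<noteq> {} \<Longrightarrow> P \<noteq> {} \<Longrightarrow> Q \<noteq> {}"
  using tv_impD by blast

text \<open>Kleene's diagonal argument: \<open>D w\<close> is an index of \<open>w\<close> applied
  to itself, \<open>c\<close> computes \<open>G\<close> after \<open>D\<close>, and
  \<open>D c\<close> is the fixed point. One \<open>e\<close> serves all oracles in
  \<open>A\<close>, because \<open>D\<close> is an s-m-n function.\<close>

lemma recursion_theorem:
  assumes "pcomp A (\<lambda>\<alpha> z. G \<alpha> (pfst z) (psnd z))"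
  obtains e where "\<And>\<alpha> x. \<alpha> \<in> A \<Longrightarrow> phi \<alpha> e x = G \<alpha> e x"
proof -
  define D where "D = clos A (\<lambda>\<alpha> w x. phi \<alpha> w (pp w x))"
  have D: "phi \<alpha> (D w) x = phi \<alpha> w (pp w x)" if "\<alpha> \<in> A" for \<alpha> w x
    unfolding D_def by (rule phi_clos[OF _ that]) (intro comp_intros)
  have cD: "tcomp A (\<lambda>\<alpha> x. D (f \<alpha> x))" if "tcomp A f" for f
    unfolding D_def by (intro comp_intros that)
  define c where "c = clos A (\<lambda>\<alpha> _ z. G \<alpha> (D (pfst z)) (psnd z)) 0"
  have "phi \<alpha> c z = G \<alpha> (D (pfst z)) (psnd z)" if "\<alpha> \<in> A" for \<alpha> z
  proof -
    have "pcomp A (\<lambda>\<alpha> z. G \<alpha> (D (pfst (psnd z))) (psnd (psnd z)))"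
      using pcomp_subst[OF assms, of "\<lambda>\<alpha> z. pp (D (pfst (psnd z))) (psnd (psnd z))"]
      by (simp add: cD comp_intros)
    then show ?thesis unfolding c_def by (rule phi_clos[OF _ that])
  qed
  then have "phi \<alpha> (D c) x = G \<alpha> (D c) x" if "\<alpha> \<in> A" for \<alpha> x
    using that by (simp add: D)
  then show thesis using that by blast
qed

end

section \<open>Computing with rational numbers\<close>

lemma dcomp_cong: "dcomp A P \<Longrightarrow> (\<And>\<alpha> x. \<alpha> \<in> A \<Longrightarrow> P \<alpha> x = Q \<alpha> x) \<Longrightarrow> dcomp A Q"
  unfolding dcomp_def by (erule tcomp_cong) simp

lemma dcomp_disj [comp_intros]:
  assumes "dcomp A P" "dcomp A Q" shows "dcomp A (\<lambda>\<alpha> x. P \<alpha> x \<or> Q \<alpha> x)"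
proof -
  have "dcomp A (\<lambda>\<alpha> x. \<not> (\<not> P \<alpha> x \<and> \<not> Q \<alpha> x))" by (intro comp_intros assms)
  then show ?thesis by simp
qed

definition rcomp :: "(nat \<Rightarrow> bool) set \<Rightarrow> ((nat \<Rightarrow> bool) \<Rightarrow> nat \<Rightarrow> rat) \<Rightarrow> bool" where
  "rcomp A r \<longleftrightarrow> (\<exists>a b c. tcomp A a \<and> tcomp A b \<and> tcomp A c \<and>
     (\<forall>\<alpha>\<in>A. \<forall>x. r \<alpha> x = (of_nat (a \<alpha> x) - of_nat (b \<alpha> x)) / of_nat (Suc (c \<alpha> x))))"

text \<open>Cross-multiplication by positive denominators; moving the subtracted terms to the other
  side leaves a comparison of natural numbers.\<close>

lemma rat_less_iff:
  fixes a b c a' b' c' :: nat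
  shows "(of_nat a - of_nat b) / of_nat (Suc c) < ((of_nat a' - of_nat b') / of_nat (Suc c') :: rat) \<longleftrightarrow>
    a * Suc c' + b' * Suc c < a' * Suc c + b * Suc c'"
proof -
  have "(of_nat a - of_nat b) / of_nat (Suc c) < ((of_nat a' - of_nat b') / of_nat (Suc c') :: rat) \<longleftrightarrow>
    (of_nat a - of_nat b) * of_nat (Suc c') < ((of_nat a' - of_nat b') * of_nat (Suc c) :: rat)"
    by (simp add: divide_simps del: of_nat_Suc)
  also have "\<dots> \<longleftrightarrow> (of_nat (a * Suc c' + b' * Suc c) :: rat) < of_nat (a' * Suc c + b * Suc c')"
    unfolding of_nat_add of_nat_mult by (simp add: algebra_simps del: of_nat_Suc)
  finally show ?thesis unfolding of_nat_less_iff .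
qed

lemma dcomp_rat_less [comp_intros]:
  assumes "rcomp A r" "rcomp A s" shows "dcomp A (\<lambda>\<alpha> x. r \<alpha> x < s \<alpha> x)"
proof -
  obtain a b c where r: "tcomp A a" "tcomp A b" "tcomp A c"
    "\<forall>\<alpha>\<in>A. \<forall>x. r \<alpha> x = (of_nat (a \<alpha> x) - of_nat (b \<alpha> x)) / of_nat (Suc (c \<alpha> x))"
    using assms(1) unfolding rcomp_def by blast
  obtain a' b' c' where s: "tcomp A a'" "tcomp A b'" "tcomp A c'"
    "\<forall>\<alpha>\<in>A. \<forall>x. s \<alpha> x = (of_nat (a' \<alpha> x) - of_nat (b' \<alpha> x)) / of_nat (Suc (c' \<alpha> x))"
    using assms(2) unfolding rcomp_def by blast
  have "dcomp A (\<lambda>\<alpha> x. a \<alpha> x * Suc (c' \<alpha> x) + b' \<alpha> x * Suc (c \<alpha> x)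
      < a' \<alpha> x * Suc (c \<alpha> x) + b \<alpha> x * Suc (c' \<alpha> x))"
    by (intro comp_intros r(1-3) s(1-3))
  then show ?thesis
    by (rule dcomp_cong) (use r(4) s(4) in \<open>simp add: rat_less_iff del: of_nat_Suc mult_Suc_right\<close>)
qed

lemma dcomp_rat_eq [comp_intros]:
  fixes r s :: "(nat \<Rightarrow> bool) \<Rightarrow> nat \<Rightarrow> rat"
  assumes "rcomp A r" "rcomp A s" shows "dcomp A (\<lambda>\<alpha> x. r \<alpha> x = s \<alpha> x)"
proof -
  have "dcomp A (\<lambda>\<alpha> x. \<not> r \<alpha> x < s \<alpha> x \<and> \<not> s \<alpha> x < r \<alpha> x)" by (intro comp_intros assms)
  then show ?thesis by (rule dcomp_cong) auto
qed

lemma rcomp_dyadic [comp_intros]: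
  assumes "tcomp A f" "tcomp A g" shows "rcomp A (\<lambda>\<alpha> x. of_nat (f \<alpha> x) / 2 ^ g \<alpha> x)"
proof -
  have "\<forall>\<alpha>\<in>A. \<forall>x. (of_nat (f \<alpha> x) / 2 ^ g \<alpha> x :: rat) =
      (of_nat (f \<alpha> x) - of_nat 0) / of_nat (Suc (2 ^ g \<alpha> x - 1))"
    by simp
  moreover have "tcomp A (\<lambda>\<alpha> x. 2 ^ g \<alpha> x - 1)" "tcomp A (\<lambda>\<alpha> x. 0)"
    by (intro comp_intros assms)+
  ultimately show ?thesis unfolding rcomp_def using assms(1) by blast
qed

lemma rcomp_enum:
  assumes "computable_rat_enum q" "tcomp A f" shows "rcomp A (\<lambda>\<alpha> x. q (f \<alpha> x))"
proof -
  obtain a b c where abc: "computable a" "computable b" "computable c"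
    "\<forall>n. q n = (of_nat (a n) - of_nat (b n)) / of_nat (Suc (c n))"
    using assms(1) unfolding computable_rat_enum_def by blast
  have "tcomp A (\<lambda>\<alpha> x. a (f \<alpha> x))" "tcomp A (\<lambda>\<alpha> x. b (f \<alpha> x))" "tcomp A (\<lambda>\<alpha> x. c (f \<alpha> x))"
    by (rule abc(1-3)[THEN tcomp_computable, OF assms(2)])+
  then show ?thesis unfolding rcomp_def using abc(4) by blast
qed

text \<open>The tail is dominated by a geometric series. The upper bound is not strict, since all
  further digits may be 1.\<close>

lemma real_of_seq_bounds:
  fixes \<beta> :: "nat \<Rightarrow> bool"
  defines "s \<equiv> \<lambda>k. \<Sum>i<k. of_bool (\<beta> i) * (1 / 2 :: real) ^ (i + 1)"
  shows "s k \<le> real_of_seq \<beta>" "real_of_seq \<beta> \<le> s k + (1 / 2) ^ k"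
proof -
  let ?f = "\<lambda>i. of_bool (\<beta> i) * (1 / 2 :: real) ^ (i + 1)"
  have sg: "(\<lambda>i. (1 / 2) ^ k * (1 / 2 :: real) ^ Suc i) sums ((1 / 2) ^ k * 1)" for k
    by (rule sums_mult[OF power_half_series])
  have sf: "summable ?f"
    by (rule summable_comparison_test'[OF sums_summable[OF sg[of 0]], of 0]) auto
  show "s k \<le> real_of_seq \<beta>" unfolding s_def real_of_seq_def
    by (rule sum_le_suminf[OF sf]) auto
  have "real_of_seq \<beta> = (\<Sum>i. ?f (i + k)) + s k"
    unfolding s_def real_of_seq_def by (rule suminf_split_initial_segment[OF sf])
  also have "(\<Sum>i. ?f (i + k)) \<le> (\<Sum>i. (1 / 2) ^ k * (1 / 2) ^ Suc i)"
    by (rule suminf_le[OF _ summable_ignore_initial_segment[OF sf] sums_summable[OF sg]])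
      (simp add: power_add)
  also have "\<dots> = (1 / 2) ^ k" using sums_unique[OF sg[of k]] by simp
  finally show "real_of_seq \<beta> \<le> s k + (1 / 2) ^ k" by simp
qed

text \<open>The real is the supremum of \<open>L\<close>. That \<open>U\<close> contains all
  rationals above it follows from locatedness at a rational in between, which cannot belong to
  \<open>L\<close>.\<close>

lemma cut_real:
  fixes L U :: "rat set"
  assumes "\<exists>r. r \<in> L" "\<exists>r. r \<in> U"
    and L: "\<And>r. r \<in> L \<longleftrightarrow> (\<exists>s>r. s \<in> L)" and U: "\<And>r. r \<in> U \<longleftrightarrow> (\<exists>s<r. s \<in> U)"
    and disj: "\<And>r. \<not> (r \<in> L \<and> r \<in> U)" and loc: "\<And>r s. r < s \<Longrightarrow> r \<in> L \<or> s \<in> U"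
  obtains x :: real where "\<And>r. r \<in> L \<longleftrightarrow> of_rat r < x" "\<And>r. r \<in> U \<longleftrightarrow> x < of_rat r"
proof -
  let ?S = "of_rat ` L :: real set"
  define x where "x = Sup ?S"
  have lt: "r < s" if "r \<in> L" "s \<in> U" for r s
    using that disj[of s] L[of s] by (cases r s rule: linorder_cases) auto
  obtain u where u: "u \<in> U" using assms by blast
  have bdd: "bdd_above ?S"
    by (rule bdd_aboveI[of _ "of_rat u"]) (auto simp: of_rat_less_eq dest: lt[OF _ u])
  have ne: "?S \<noteq> {}" using assms by blast
  have L_less: "of_rat r < x" if r: "r \<in> L" for r
  proof -
    obtain s where "s > r" "s \<in> L" using r L[of r] by blast
    then have "of_rat s \<le> x" unfolding x_def by (intro cSup_upper bdd) auto
    then show ?thesis using \<open>s > r\<close> by (metis less_le_trans of_rat_less)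
  qed
  have U_greater: "x < of_rat r" if r: "r \<in> U" for r
  proof -
    obtain s where s: "s < r" "s \<in> U" using r U[of r] by blast
    have "x \<le> of_rat s" unfolding x_def
      by (rule cSup_least[OF ne]) (auto simp: of_rat_less_eq dest: lt[OF _ s(2)])
    then show ?thesis using s by (metis le_less_trans of_rat_less)
  qed
  show thesis
  proof
    fix r
    show "r \<in> L \<longleftrightarrow> of_rat r < x"
    proof
      assume "of_rat r < x"
      then obtain s where "s \<in> L" "(of_rat r :: real) < of_rat s"
        unfolding x_def using less_cSup_iff[OF ne bdd] by auto
      then show "r \<in> L" using L[of r] unfolding of_rat_less by blast
    qed (rule L_less)
    show "r \<in> U \<longleftrightarrow> x < of_rat r"
    proof
      assume "x < of_rat r"
      then obtain s where s: "x < of_rat s" "s < r" using of_rat_dense by (metis of_rat_less)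
      then have "s \<notin> L" using L_less by force
      then show "r \<in> U" using loc s by blast
    qed (rule U_greater)
  qed
qed

section \<open>Dedekind reals over a Miller sequence\<close>

text \<open>Facts are read off a realized formula by applying its realizer at some oracle, hence
  \<open>A_nonempty\<close>. The final theorem treats the empty case directly.\<close>

locale miller = oracle_pca A for A :: "(nat \<Rightarrow> bool) set" +
  fixes pr :: "nat \<Rightarrow> nat \<Rightarrow> nat" and q :: "nat \<Rightarrow> rat" and \<mu> :: "nat \<Rightarrow> real"
  assumes A_eq: "A = oracles pr \<mu>" and A_nonempty: "A \<noteq> {}"
    and pairing: "computable_pairing pr" and enum: "computable_rat_enum q"
    and miller: "miller_sequence pr q \<mu>"
begin

abbreviation Q :: "(nat, rat) obj" where "Q \<equiv> rat_obj q"
abbreviation UI :: "(nat, (rat \<Rightarrow> nat set) \<times> (rat \<Rightarrow> nat set)) obj" where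
  "UI \<equiv> unit_interval T Q"

lemma mu_range: "0 \<le> \<mu> m" "\<mu> m \<le> 1"
  using miller unfolding miller_sequence_def by (auto dest!: subsetD[OF _ rangeI[of \<mu> m]])

lemma surj_q: "\<exists>n. q n = r"
  using enum unfolding computable_rat_enum_def by (metis bij_pointE)

lemma mem_Q: "n \<in> Q r s \<longleftrightarrow> q n = r \<and> r = s"
  unfolding rat_obj_def by simp

lemmas rcomp_q [comp_intros] = rcomp_enum[OF enum]

lemma tcomp_pr [comp_intros]:
  assumes "tcomp B f" "tcomp B g" shows "tcomp B (\<lambda>\<alpha> x. pr (f \<alpha> x) (g \<alpha> x))"
proof -
  have "computable (\<lambda>n. case prod_decode n of (a, b) \<Rightarrow> pr a b)"
    using pairing unfolding computable_pairing_def by blast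
  from tcomp_computable[OF this tcomp_pp[OF assms]] show ?thesis by simp
qed

text \<open>The first \<open>k\<close> bits of column \<open>m\<close> of the oracle, read as a
  binary numeral. It can depend on the oracle even for oracles of the same \<mu>, because a dyadic
  rational has two expansions.\<close>

primrec approx :: "(nat \<Rightarrow> bool) \<Rightarrow> nat \<Rightarrow> nat \<Rightarrow> nat" where
  "approx \<alpha> m 0 = 0"
| "approx \<alpha> m (Suc k) = 2 * approx \<alpha> m k + of_bool (\<alpha> (pr m k))"

lemma tcomp_approx [comp_intros]:
  assumes "tcomp B f" "tcomp B g" shows "tcomp B (\<lambda>\<alpha> x. approx \<alpha> (f \<alpha> x) (g \<alpha> x))"
proof -
  have "tcomp B (\<lambda>\<alpha> x. rec_nat 0 (\<lambda>i v. 2 * v + of_bool (\<alpha> (pr (f \<alpha> x) i))) (g \<alpha> x))"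
    by (intro tcomp_rec comp_intros tcomp_subst[OF assms(1)] assms)
  moreover have "rec_nat 0 (\<lambda>i v. 2 * v + of_bool (\<alpha> (pr m i))) k = approx \<alpha> m k" for \<alpha> m k
    by (induction k) auto
  ultimately show ?thesis by simp
qed

definition low :: "(nat \<Rightarrow> bool) \<Rightarrow> nat \<Rightarrow> nat \<Rightarrow> rat" where
  "low \<alpha> m k = of_nat (approx \<alpha> m k) / 2 ^ k"

definition up :: "(nat \<Rightarrow> bool) \<Rightarrow> nat \<Rightarrow> nat \<Rightarrow> rat" where
  "up \<alpha> m k = of_nat (Suc (approx \<alpha> m k)) / 2 ^ k"

lemma rcomp_low_up [comp_intros]:
  assumes "tcomp B f" "tcomp B g"
  shows "rcomp B (\<lambda>\<alpha> x. low \<alpha> (f \<alpha> x) (g \<alpha> x))" "rcomp B (\<lambda>\<alpha> x. up \<alpha> (f \<alpha> x) (g \<alpha> x))"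
  unfolding low_def up_def by (intro comp_intros assms)+

lemma up_eq: "up \<alpha> m k = low \<alpha> m k + (1 / 2) ^ k"
  unfolding up_def low_def by (simp add: field_simps)

lemma low_up_bounds:
  assumes "\<alpha> \<in> A" shows "of_rat (low \<alpha> m k) \<le> \<mu> m" "\<mu> m \<le> of_rat (up \<alpha> m k)"
proof -
  let ?\<beta> = "\<lambda>i. \<alpha> (pr m i)"
  have mu: "real_of_seq ?\<beta> = \<mu> m"
    using assms unfolding A_eq oracles_def reals_of_oracle_def by auto
  have low: "of_rat (low \<alpha> m k) = (\<Sum>i<k. of_bool (?\<beta> i) * (1 / 2 :: real) ^ (i + 1))"
  proof (induction k)
    case (Suc k)
    have "low \<alpha> m (Suc k) = low \<alpha> m k + of_bool (?\<beta> k) * (1 / 2) ^ (k + 1)"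
      by (simp add: low_def field_simps)
    then show ?case using Suc by (simp add: of_rat_add of_rat_mult of_rat_power of_rat_divide)
  qed (simp add: low_def)
  show "of_rat (low \<alpha> m k) \<le> \<mu> m" "\<mu> m \<le> of_rat (up \<alpha> m k)"
    using real_of_seq_bounds[where k = k and \<beta> = ?\<beta>] unfolding mu up_eq low[symmetric]
    by (simp_all add: of_rat_add of_rat_power of_rat_divide)
qed

lemma half_power_small: assumes "(0::real) < e" shows "\<exists>k. (1 / 2) ^ k < e"
  using real_arch_pow_inv[OF assms, of "1/2"] by simp

lemma low_limit:
  assumes "\<alpha> \<in> A" "of_rat r < \<mu> m" shows "\<exists>k. r < low \<alpha> m k"
proof -
  obtain k where k: "(1 / 2) ^ k < \<mu> m - of_rat r" using half_power_small assms(2) by (metis diff_gt_0_iff_gt)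
  have "of_rat (up \<alpha> m k) = of_rat (low \<alpha> m k) + (1 / 2 :: real) ^ k"
    by (simp add: up_eq of_rat_add of_rat_power of_rat_divide)
  then have "(of_rat r :: real) < of_rat (low \<alpha> m k)"
    using low_up_bounds(2)[OF assms(1), of m k] k by linarith
  then show ?thesis unfolding of_rat_less by blast
qed

lemma up_limit:
  assumes "\<alpha> \<in> A" "\<mu> m < of_rat r" shows "\<exists>k. up \<alpha> m k < r"
proof -
  obtain k where k: "(1 / 2) ^ k < of_rat r - \<mu> m" using half_power_small assms(2) by (metis diff_gt_0_iff_gt)
  have "of_rat (up \<alpha> m k) = of_rat (low \<alpha> m k) + (1 / 2 :: real) ^ k"
    by (simp add: up_eq of_rat_add of_rat_power of_rat_divide)
  then have "of_rat (up \<alpha> m k) < (of_rat r :: real)"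
    using low_up_bounds(1)[OF assms(1), of m k] k by linarith
  then show ?thesis unfolding of_rat_less by blast
qed

lemma mu_opt_dec:
  assumes "P k"
  shows "\<exists>j. mu_opt (\<lambda>k. Some (of_bool (\<not> P k))) = Some j \<and> P j"
proof -
  have "mu_opt (\<lambda>k. Some (of_bool (\<not> P k))) = Some (LEAST k. P k)"
    using assms by (rule mu_opt_eq_LeastI) auto
  then show ?thesis using LeastI[of P, OF assms] by blast
qed

text \<open>Here \<open>t\<close> codes a candidate and a precision at which the digits certify it:
  a strict inequality with \<open>\<mu> m\<close> can be confirmed, though not decided, from the
  oracle.\<close>

definition search_low :: "(nat \<Rightarrow> bool) \<Rightarrow> nat \<Rightarrow> nat \<Rightarrow> nat option" where
  "search_low \<alpha> m n = do {
     t \<leftarrow> mu_opt (\<lambda>t. Some (of_bool (\<not> (q n < q (pfst t) \<and> q (pfst t) < low \<alpha> m (psnd t)))));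
     Some (pfst t) }"

definition search_up :: "(nat \<Rightarrow> bool) \<Rightarrow> nat \<Rightarrow> nat \<Rightarrow> nat option" where
  "search_up \<alpha> m n = do {
     t \<leftarrow> mu_opt (\<lambda>t. Some (of_bool (\<not> (q (pfst t) < q n \<and> up \<alpha> m (psnd t) < q (pfst t)))));
     Some (pfst t) }"

lemma pcomp_search [comp_intros]:
  assumes "tcomp B f" "tcomp B g"
  shows "pcomp B (\<lambda>\<alpha> x. search_low \<alpha> (f \<alpha> x) (g \<alpha> x))"
    "pcomp B (\<lambda>\<alpha> x. search_up \<alpha> (f \<alpha> x) (g \<alpha> x))"
  unfolding search_low_def search_up_def
  by (intro comp_intros tcomp_subst[OF assms(1)] tcomp_subst[OF assms(2)] assms)+

lemma search_low:
  assumes "\<alpha> \<in> A" "of_rat (q n) < \<mu> m"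
  shows "\<exists>s. search_low \<alpha> m n = Some s \<and> q n < q s \<and> of_rat (q s) < \<mu> m"
proof -
  let ?P = "\<lambda>t. q n < q (pfst t) \<and> q (pfst t) < low \<alpha> m (psnd t)"
  obtain k where "q n < low \<alpha> m k" using low_limit[OF assms] by blast
  then obtain r where "q n < r" "r < low \<alpha> m k" using dense by blast
  moreover obtain s where "q s = r" using surj_q by blast
  ultimately have "?P (pp s k)" by simp
  from mu_opt_dec[of ?P, OF this] obtain t where
    t: "mu_opt (\<lambda>t. Some (of_bool (\<not> ?P t))) = Some t" "?P t" by blast
  have "(of_rat (q (pfst t)) :: real) < of_rat (low \<alpha> m (psnd t))" using t(2) unfolding of_rat_less by blast
  then have "of_rat (q (pfst t)) < \<mu> m" using low_up_bounds(1)[OF assms(1)] less_le_trans by blast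
  then show ?thesis using t unfolding search_low_def by simp
qed

lemma search_up:
  assumes "\<alpha> \<in> A" "\<mu> m < of_rat (q n)"
  shows "\<exists>s. search_up \<alpha> m n = Some s \<and> q s < q n \<and> \<mu> m < of_rat (q s)"
proof -
  let ?P = "\<lambda>t. q (pfst t) < q n \<and> up \<alpha> m (psnd t) < q (pfst t)"
  obtain k where "up \<alpha> m k < q n" using up_limit[OF assms] by blast
  then obtain r where "r < q n" "up \<alpha> m k < r" using dense by blast
  moreover obtain s where "q s = r" using surj_q by blast
  ultimately have "?P (pp s k)" by simp
  from mu_opt_dec[of ?P, OF this] obtain t where
    t: "mu_opt (\<lambda>t. Some (of_bool (\<not> ?P t))) = Some t" "?P t" by blast
  have "(of_rat (up \<alpha> m (psnd t)) :: real) < of_rat (q (pfst t))" using t(2) unfolding of_rat_less by blast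
  then have "\<mu> m < of_rat (q (pfst t))" using low_up_bounds(2)[OF assms(1)] le_less_trans by blast
  then show ?thesis using t unfolding search_up_def by simp
qed

definition decide :: "(nat \<Rightarrow> bool) \<Rightarrow> nat \<Rightarrow> nat \<Rightarrow> nat \<Rightarrow> nat option" where
  "decide \<alpha> m i j = do {
     k \<leftarrow> mu_opt (\<lambda>k. Some (of_bool (\<not> (q i < low \<alpha> m k \<or> up \<alpha> m k < q j))));
     Some (if q i < low \<alpha> m k then pair T (bool_true T) i else pair T (bool_false T) j) }"

lemma pcomp_decide [comp_intros]:
  assumes "tcomp A f" "tcomp A g" "tcomp A h"
  shows "pcomp A (\<lambda>\<alpha> x. decide \<alpha> (f \<alpha> x) (g \<alpha> x) (h \<alpha> x))"
  unfolding decide_def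
  by (intro comp_intros tcomp_subst[OF assms(1)] tcomp_subst[OF assms(2)] tcomp_subst[OF assms(3)] assms)

text \<open>
  The cuts of \<open>\<mu> m\<close> carry no information in their realizers. All that is needed to realize that they
  form a Dedekind cut is found by querying the oracle.
\<close>

definition mu_cut :: "nat \<Rightarrow> (rat \<Rightarrow> nat set) \<times> (rat \<Rightarrow> nat set)" where
  "mu_cut m = (\<lambda>r. {n. q n = r \<and> of_rat r < \<mu> m}, \<lambda>r. {n. q n = r \<and> \<mu> m < of_rat r})"

text \<open>Once \<open>2 ^ k\<close> exceeds the inverse of \<open>q j - q i\<close>, the interval
  from \<open>low\<close> to \<open>up\<close> is too short to reach from \<open>q i\<close> to
  \<open>q j\<close>. Which side is chosen may depend on the oracle; a disjunction allows
  this.\<close>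

lemma decide:
  assumes "\<alpha> \<in> A" "q i < q j"
  shows "\<exists>c\<in>tv_or T (fst (mu_cut m) (q i)) (snd (mu_cut m) (q j)). decide \<alpha> m i j = Some c"
proof -
  let ?P = "\<lambda>k. q i < low \<alpha> m k \<or> up \<alpha> m k < q j"
  have "(0::real) < of_rat (q j - q i)" using assms(2) by simp
  then obtain k where "(1 / 2 :: real) ^ k < of_rat (q j - q i)" using half_power_small by blast
  also have "(1 / 2 :: real) ^ k = of_rat ((1 / 2) ^ k)" by (simp add: of_rat_power of_rat_divide)
  finally have k: "(1 / 2) ^ k < q j - q i" unfolding of_rat_less .
  then have "?P k" unfolding up_eq by linarith
  from mu_opt_dec[of ?P, OF this] obtain t where
    t: "mu_opt (\<lambda>t. Some (of_bool (\<not> ?P t))) = Some t" "?P t" by blast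
  have "(of_rat (low \<alpha> m t) :: real) \<le> \<mu> m" "\<mu> m \<le> (of_rat (up \<alpha> m t) :: real)"
    using low_up_bounds[OF assms(1)] by auto
  moreover have "of_rat (q i) < (of_rat (low \<alpha> m t) :: real) \<or> of_rat (up \<alpha> m t) < (of_rat (q j) :: real)"
    using t(2) unfolding of_rat_less .
  ultimately have "q i < low \<alpha> m t \<and> of_rat (q i) < \<mu> m \<or> \<not> q i < low \<alpha> m t \<and> \<mu> m < of_rat (q j)"
    unfolding of_rat_less using less_le_trans le_less_trans t(2) of_rat_less by meson
  then show ?thesis using t unfolding decide_def tv_or_def mu_cut_def by auto
qed

end

section \<open>Classical content of realized formulas\<close>

context oracle_pca
begin

lemma tv_and_nonempty: "tv_and T P Q \<noteq> {} \<longleftrightarrow> P \<noteq> {} \<and> Q \<noteq> {}"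
  unfolding tv_and_def by auto

lemma tv_or_nonempty: "tv_or T P Q \<noteq> {} \<longleftrightarrow> P \<noteq> {} \<or> Q \<noteq> {}"
  unfolding tv_or_def by auto

lemma tv_all_nonempty: "A \<noteq> {} \<Longrightarrow> tv_all T \<phi> \<noteq> {} \<Longrightarrow> \<phi> y \<noteq> {}"
  using tv_allD by fast

lemma forall_in_nonempty: "A \<noteq> {} \<Longrightarrow> forall_in T X \<phi> \<noteq> {} \<Longrightarrow> X y y \<noteq> {} \<Longrightarrow> \<phi> y \<noteq> {}"
  unfolding forall_in_def
  by (rule tv_imp_nonempty, assumption, rule tv_all_nonempty[where \<phi> = "\<lambda>x. tv_imp T (X x x) (\<phi> x)"])

lemma exists_in_nonempty: "exists_in T X \<phi> \<noteq> {} \<longleftrightarrow> (\<exists>y. X y y \<noteq> {} \<and> \<phi> y \<noteq> {})"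
  unfolding exists_in_def tv_ex_def exists_along_def by (auto simp: tv_and_nonempty)

lemma tv_iff_nonempty:
  assumes "A \<noteq> {}" "tv_and T (tv_imp T P Q) (tv_imp T Q P) \<noteq> {}"
  shows "P \<noteq> {} \<longleftrightarrow> Q \<noteq> {}"
  using assms(2) tv_imp_nonempty[OF assms(1)] unfolding tv_and_nonempty by blast

lemma tv_of_nonempty: "tv_of T b \<noteq> {} \<longleftrightarrow> b"
  unfolding tv_of_def tv_top_def tv_bot_def by simp

lemma Some_bexI: "c \<in> S \<Longrightarrow> \<exists>c'\<in>S. Some c = Some c'"
  by blast

definition id_rz :: nat where "id_rz = clos A (\<lambda>\<alpha> _ a. Some a) 0"

lemma id_rz: "P \<subseteq> Q \<Longrightarrow> id_rz \<in> tv_imp T P Q"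
  unfolding id_rz_def by (rule tv_impI, (intro comp_intros)[1]) auto

definition fst_rz :: nat where "fst_rz = clos A (\<lambda>\<alpha> _ a. prj1 \<alpha> a) 0"

text \<open>The inclusion is conditional for the sake of extensionality: there the second conjunct
  is \<open>Q x x'\<close>, which is inhabited only if \<open>x = x'\<close>.\<close>

lemma fst_rz: "(Q \<noteq> {} \<Longrightarrow> P \<subseteq> P') \<Longrightarrow> fst_rz \<in> tv_imp T (tv_and T P Q) P'"
  unfolding fst_rz_def
proof (rule tv_impI, (intro comp_intros)[1])
  fix \<alpha> c assume PQ: "Q \<noteq> {} \<Longrightarrow> P \<subseteq> P'" and "\<alpha> \<in> A" "c \<in> tv_and T P Q"
  moreover from this obtain a b where "c = pair T a b" "a \<in> P" "b \<in> Q" by (blast elim: tv_andE)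
  moreover from this have "a \<in> P'" using PQ by blast
  ultimately show "\<exists>a\<in>P'. prj1 \<alpha> c = Some a" by simp
qed

end

context miller
begin

lemma pow_refl:
  assumes "\<And>r. L r \<subseteq> Q r r"
  shows "pair T (const_rz id_rz) (pair T (const_rz (const_rz fst_rz)) (const_rz (pair T id_rz id_rz)))
    \<in> pow_obj T Q L L"
  unfolding pow_obj_def using assms
  by (intro tv_andI tv_allI id_rz fst_rz) (auto simp: mem_Q)

lemma UI_eq: "UI z z' = tv_and T
    (tv_and T (tv_and T (pow_obj T Q (fst z) (fst z')) (pow_obj T Q (snd z) (snd z'))) (is_cut T Q z))
    (tv_and T (real_le T Q (rational_real T Q 0) z) (real_le T Q z (rational_real T Q 1)))"
  unfolding unit_interval_def dedekind_reals_def subobj_def prod_obj_def by (simp add: case_prod_unfold)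

lemma tv_of_iff: "n \<in> tv_of T b \<longleftrightarrow> b"
  unfolding tv_of_def tv_top_def tv_bot_def by simp

section \<open>Elements of the unit interval named by indices\<close>

definition low_rz :: "nat \<Rightarrow> nat" where
  "low_rz m = const_rz (clos A (\<lambda>\<alpha> m n. Some (pair T
     (clos A (\<lambda>\<alpha> w _. do { s \<leftarrow> search_low \<alpha> (pfst w) (psnd w); Some (pair T s (pair T 0 s)) }) (pp m n))
     (clos A (\<lambda>\<alpha> n _. Some n) n))) m)"

definition up_rz :: "nat \<Rightarrow> nat" where
  "up_rz m = const_rz (clos A (\<lambda>\<alpha> m n. Some (pair T
     (clos A (\<lambda>\<alpha> w _. do { s \<leftarrow> search_up \<alpha> (pfst w) (psnd w); Some (pair T s (pair T 0 s)) }) (pp m n))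
     (clos A (\<lambda>\<alpha> n _. Some n) n))) m)"

lemma low_rz:
  "low_rz m \<in> forall_in T Q (\<lambda>r. tv_and T
     (tv_imp T (fst (mu_cut m) r) (exists_in T Q (\<lambda>s. tv_and T (tv_of T (r < s)) (fst (mu_cut m) s))))
     (tv_imp T (exists_in T Q (\<lambda>s. tv_and T (tv_of T (r < s)) (fst (mu_cut m) s))) (fst (mu_cut m) r)))"
  (is "_ \<in> forall_in T Q (\<lambda>r. tv_and T (tv_imp T (?L r) (?E r)) _)")
  unfolding low_rz_def
proof (rule forall_inI, (intro comp_intros)[1])
  fix r \<alpha> n assume "n \<in> Q r r"
  then have n: "q n = r" by (simp add: mem_Q)
  have "clos A (\<lambda>\<alpha> w _. do { s \<leftarrow> search_low \<alpha> (pfst w) (psnd w); Some (pair T s (pair T 0 s)) }) (pp m n)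
    \<in> tv_imp T (?L r) (?E r)"
  proof (rule tv_impI, (intro comp_intros)[1])
    fix \<alpha> b assume \<alpha>: "\<alpha> \<in> A" and "b \<in> ?L r"
    then have "of_rat (q n) < \<mu> m" using n unfolding mu_cut_def by simp
    from search_low[OF \<alpha> this] obtain s where
      s: "search_low \<alpha> m n = Some s" "q n < q s" "of_rat (q s) < \<mu> m" by blast
    \<comment> \<open>The index \<open>s\<close> realizes both the rational and its membership in
      the cut; 0 realizes the true inequality.\<close>
    have "pair T s (pair T 0 s) \<in> ?E r"
      by (rule exists_inI[where y = "q s"], simp add: mem_Q, rule tv_andI)
        (use s n in \<open>simp_all add: tv_of_iff mu_cut_def\<close>)
    then show "\<exists>c\<in>?E r. (do { s \<leftarrow> search_low \<alpha> (pfst (pp m n)) (psnd (pp m n)); Some (pair T s (pair T 0 s)) }) = Some c"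
      using s by simp
  qed
  moreover have "clos A (\<lambda>\<alpha> n _. Some n) n \<in> tv_imp T (?E r) (?L r)"
  proof (rule tv_impI, (intro comp_intros)[1])
    fix b assume "b \<in> ?E r"
    then obtain s where "r < s" "of_rat s < \<mu> m"
      by (auto elim!: exists_inE tv_andE simp: tv_of_iff mu_cut_def)
    then have "n \<in> ?L r" using n unfolding mu_cut_def by simp (metis less_trans of_rat_less)
    then show "\<exists>c\<in>?L r. Some n = Some c" by blast
  qed
  ultimately show "\<exists>c\<in>tv_and T (tv_imp T (?L r) (?E r)) (tv_imp T (?E r) (?L r)).
     Some (pair T
     (clos A (\<lambda>\<alpha> w _. do { s \<leftarrow> search_low \<alpha> (pfst w) (psnd w); Some (pair T s (pair T 0 s)) }) (pp m n))
     (clos A (\<lambda>\<alpha> n _. Some n) n)) = Some c" using tv_andI by blast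
qed

lemma up_rz:
  "up_rz m \<in> forall_in T Q (\<lambda>r. tv_and T
     (tv_imp T (snd (mu_cut m) r) (exists_in T Q (\<lambda>s. tv_and T (tv_of T (s < r)) (snd (mu_cut m) s))))
     (tv_imp T (exists_in T Q (\<lambda>s. tv_and T (tv_of T (s < r)) (snd (mu_cut m) s))) (snd (mu_cut m) r)))"
  (is "_ \<in> forall_in T Q (\<lambda>r. tv_and T (tv_imp T (?U r) (?E r)) _)")
  unfolding up_rz_def
proof (rule forall_inI, (intro comp_intros)[1])
  fix r \<alpha> n assume "n \<in> Q r r"
  then have n: "q n = r" by (simp add: mem_Q)
  have "clos A (\<lambda>\<alpha> w _. do { s \<leftarrow> search_up \<alpha> (pfst w) (psnd w); Some (pair T s (pair T 0 s)) }) (pp m n)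
    \<in> tv_imp T (?U r) (?E r)"
  proof (rule tv_impI, (intro comp_intros)[1])
    fix \<alpha> b assume \<alpha>: "\<alpha> \<in> A" and "b \<in> ?U r"
    then have "\<mu> m < of_rat (q n)" using n unfolding mu_cut_def by simp
    from search_up[OF \<alpha> this] obtain s where
      s: "search_up \<alpha> m n = Some s" "q s < q n" "\<mu> m < of_rat (q s)" by blast
    have "pair T s (pair T 0 s) \<in> ?E r"
      by (rule exists_inI[where y = "q s"], simp add: mem_Q, rule tv_andI)
        (use s n in \<open>simp_all add: tv_of_iff mu_cut_def\<close>)
    then show "\<exists>c\<in>?E r. (do { s \<leftarrow> search_up \<alpha> (pfst (pp m n)) (psnd (pp m n)); Some (pair T s (pair T 0 s)) }) = Some c"
      using s by simp
  qed
  moreover have "clos A (\<lambda>\<alpha> n _. Some n) n \<in> tv_imp T (?E r) (?U r)"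
  proof (rule tv_impI, (intro comp_intros)[1])
    fix b assume "b \<in> ?E r"
    then obtain s where "s < r" "\<mu> m < of_rat s"
      by (auto elim!: exists_inE tv_andE simp: tv_of_iff mu_cut_def)
    then have "n \<in> ?U r" using n unfolding mu_cut_def by simp (metis less_trans of_rat_less)
    then show "\<exists>c\<in>?U r. Some n = Some c" by blast
  qed
  ultimately show "\<exists>c\<in>tv_and T (tv_imp T (?U r) (?E r)) (tv_imp T (?E r) (?U r)).
     Some (pair T
     (clos A (\<lambda>\<alpha> w _. do { s \<leftarrow> search_up \<alpha> (pfst w) (psnd w); Some (pair T s (pair T 0 s)) }) (pp m n))
     (clos A (\<lambda>\<alpha> n _. Some n) n)) = Some c" using tv_andI by blast
qed

definition loc_rz :: "nat \<Rightarrow> nat" where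
  "loc_rz m = const_rz (clos A (\<lambda>\<alpha> m i. Some (const_rz (clos A (\<lambda>\<alpha> w j. Some
     (clos A (\<lambda>\<alpha> v _. decide \<alpha> (pfst v) (pfst (psnd v)) (psnd (psnd v))) (pp (pfst w) (pp (psnd w) j))))
     (pp m i)))) m)"

lemma loc_rz:
  "loc_rz m \<in> forall_in T Q (\<lambda>r. forall_in T Q (\<lambda>s.
     tv_imp T (tv_of T (r < s)) (tv_or T (fst (mu_cut m) r) (snd (mu_cut m) s))))"
  unfolding loc_rz_def
proof (rule forall_inI, (intro comp_intros)[1], rule Some_bexI)
  fix r \<alpha> i assume "i \<in> Q r r"
  then have i: "q i = r" by (simp add: mem_Q)
  show "const_rz (clos A (\<lambda>\<alpha> w j. Some
     (clos A (\<lambda>\<alpha> v _. decide \<alpha> (pfst v) (pfst (psnd v)) (psnd (psnd v))) (pp (pfst w) (pp (psnd w) j))))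
     (pp m i)) \<in> forall_in T Q (\<lambda>s.
     tv_imp T (tv_of T (r < s)) (tv_or T (fst (mu_cut m) r) (snd (mu_cut m) s)))"
  proof (rule forall_inI, (intro comp_intros)[1], rule Some_bexI)
    fix s \<alpha> j assume "j \<in> Q s s"
    then have j: "q j = s" by (simp add: mem_Q)
    show "clos A (\<lambda>\<alpha> v _. decide \<alpha> (pfst v) (pfst (psnd v)) (psnd (psnd v)))
        (pp (pfst (pp m i)) (pp (psnd (pp m i)) j))
      \<in> tv_imp T (tv_of T (r < s)) (tv_or T (fst (mu_cut m) r) (snd (mu_cut m) s))"
      by (rule tv_impI, (intro comp_intros)[1]) (use decide[of _ i j m] i j in \<open>simp add: tv_of_iff\<close>)
  qed
qed

definition idx :: "rat \<Rightarrow> nat" where "idx r = (LEAST n. q n = r)"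

lemma q_idx [simp]: "q (idx r) = r"
  unfolding idx_def using surj_q by (metis (mono_tags, lifting) LeastI_ex)

text \<open>The bounds -1 and 2 lie strictly outside [0,1], so they belong to the two cuts whatever
  \<open>\<mu> m\<close> is. The program for disjointness never receives an argument, so its value 0
  is arbitrary.\<close>

definition cut_rz :: "nat \<Rightarrow> nat" where
  "cut_rz m = pair T (pair T (idx (-1)) (idx (-1))) (pair T (pair T (idx 2) (idx 2))
     (pair T (low_rz m) (pair T (up_rz m) (pair T (const_rz (clos A (\<lambda>\<alpha> _ _. Some 0) 0)) (loc_rz m)))))"

lemma cut_rz: "cut_rz m \<in> is_cut T Q (mu_cut m)"
proof -
  have L: "pair T (idx (-1)) (idx (-1)) \<in> exists_in T Q (fst (mu_cut m))"
    by (rule exists_inI[where y = "-1"])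
      (use mu_range(1)[of m] in \<open>simp_all add: mem_Q mu_cut_def\<close>)
  have U: "pair T (idx 2) (idx 2) \<in> exists_in T Q (snd (mu_cut m))"
    by (rule exists_inI[where y = 2]) (use mu_range(2)[of m] in \<open>simp_all add: mem_Q mu_cut_def\<close>)
  have N: "const_rz (clos A (\<lambda>\<alpha> _ _. Some 0) 0) \<in>
      forall_in T Q (\<lambda>r. tv_imp T (tv_and T (fst (mu_cut m) r) (snd (mu_cut m) r)) (tv_bot T))"
    by (rule forall_inI, (intro comp_intros)[1]) (auto simp: tv_imp_def tv_and_def mu_cut_def)
  show ?thesis
    unfolding cut_rz_def is_cut_def case_prod_unfold
    by (intro tv_andI L U N low_rz up_rz loc_rz)
qed

definition unit_rz :: "nat \<Rightarrow> nat" where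
  "unit_rz m = (let e = pair T (const_rz id_rz) (pair T (const_rz (const_rz fst_rz)) (const_rz (pair T id_rz id_rz)))
     in pair T (pair T (pair T e e) (cut_rz m))
       (pair T (const_rz (clos A (\<lambda>\<alpha> _ n. Some (clos A (\<lambda>\<alpha> n _. Some n) n)) 0))
         (const_rz (clos A (\<lambda>\<alpha> _ n. Some (clos A (\<lambda>\<alpha> n _. Some (pair T n 0)) n)) 0))))"

lemma unit_rz: "unit_rz m \<in> UI (mu_cut m) (mu_cut m)"
proof -
  have le0: "const_rz (clos A (\<lambda>\<alpha> _ n. Some (clos A (\<lambda>\<alpha> n _. Some n) n)) 0)
      \<in> real_le T Q (rational_real T Q 0) (mu_cut m)"
    unfolding real_le_def
  proof (rule forall_inI, (intro comp_intros)[1], rule Some_bexI)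
    fix r \<alpha> n assume "n \<in> Q r r"
    then have n: "q n = r" by (simp add: mem_Q)
    show "clos A (\<lambda>\<alpha> n _. Some n) n \<in> tv_imp T (fst (rational_real T Q 0) r) (fst (mu_cut m) r)"
    proof (rule tv_impI, (intro comp_intros)[1], rule Some_bexI)
      fix b assume "b \<in> fst (rational_real T Q 0) r"
      then have "(of_rat r :: real) < 0" by (auto simp: rational_real_def tv_of_iff elim!: tv_andE)
      then have "of_rat r < \<mu> m" using mu_range(1)[of m] by linarith
      then show "n \<in> fst (mu_cut m) r" using n by (simp add: mu_cut_def)
    qed
  qed
  have le1: "const_rz (clos A (\<lambda>\<alpha> _ n. Some (clos A (\<lambda>\<alpha> n _. Some (pair T n 0)) n)) 0)
      \<in> real_le T Q (mu_cut m) (rational_real T Q 1)"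
    unfolding real_le_def
  proof (rule forall_inI, (intro comp_intros)[1], rule Some_bexI)
    fix r \<alpha> n assume "n \<in> Q r r"
    then have n: "q n = r" by (simp add: mem_Q)
    show "clos A (\<lambda>\<alpha> n _. Some (pair T n 0)) n \<in> tv_imp T (fst (mu_cut m) r) (fst (rational_real T Q 1) r)"
    proof (rule tv_impI, (intro comp_intros)[1], rule Some_bexI)
      fix b assume "b \<in> fst (mu_cut m) r"
      then have "of_rat r < \<mu> m" by (auto simp: mu_cut_def)
      then have "of_rat r < (1::real)" using mu_range(2)[of m] by linarith
      then have "r < 1" by simp
      then show "pair T n 0 \<in> fst (rational_real T Q 1) r"
        unfolding rational_real_def fst_conv by (intro tv_andI) (simp_all add: n mem_Q tv_of_iff)
    qed
  qed
  show ?thesis unfolding unit_rz_def Let_def UI_eq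
    by (intro tv_andI le0 le1 cut_rz pow_refl) (auto simp: mu_cut_def mem_Q)
qed

text \<open>Only code numbers are assembled here; the oracle is consulted later, when the realizer
  is run. Thus a point can be named as soon as its index is known.\<close>

lemma tcomp_unit_rz [comp_intros]: "tcomp A f \<Longrightarrow> tcomp A (\<lambda>\<alpha> x. unit_rz (f \<alpha> x))"
  unfolding unit_rz_def cut_rz_def low_rz_def up_rz_def loc_rz_def Let_def by (intro comp_intros)

section \<open>The classical real behind an element of the interval\<close>

definition is_real :: "(rat \<Rightarrow> nat set) \<times> (rat \<Rightarrow> nat set) \<Rightarrow> real \<Rightarrow> bool" where
  "is_real z x \<longleftrightarrow> x \<in> {0..1} \<and> (\<forall>r. fst z r \<noteq> {} \<longleftrightarrow> of_rat r < x) \<and> (\<forall>r. snd z r \<noteq> {} \<longleftrightarrow> x < of_rat r)"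

lemma Q_nonempty: "Q r s \<noteq> {} \<longleftrightarrow> r = s"
  using surj_q by (auto simp: rat_obj_def)

lemma forall_Q_nonempty: "forall_in T Q \<phi> \<noteq> {} \<Longrightarrow> \<phi> r \<noteq> {}"
  by (rule forall_in_nonempty[where X = Q, OF A_nonempty]) (simp_all add: Q_nonempty)

text \<open>If inhabited truth values are read as true, the internal conditions on a cut become the
  classical ones, and \<open>cut_real\<close> applies.\<close>

lemma UI_is_real:
  assumes "UI z z' \<noteq> {}" shows "\<exists>x. is_real z x"
proof -
  obtain L U where z: "z = (L, U)" by (cases z)
  have "is_cut T Q z \<noteq> {}" and le0: "real_le T Q (rational_real T Q 0) z \<noteq> {}"
    and le1: "real_le T Q z (rational_real T Q 1) \<noteq> {}"
    using assms unfolding UI_eq tv_and_nonempty by simp_all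
  note cut = this(1)[unfolded z is_cut_def prod.case tv_and_nonempty]
  have 1: "\<exists>r. r \<in> {r. L r \<noteq> {}}" "\<exists>r. r \<in> {r. U r \<noteq> {}}"
    using cut unfolding exists_in_nonempty by auto
  have L: "tv_and T (tv_imp T (L r) (exists_in T Q (\<lambda>s. tv_and T (tv_of T (r < s)) (L s))))
      (tv_imp T (exists_in T Q (\<lambda>s. tv_and T (tv_of T (r < s)) (L s))) (L r)) \<noteq> {}" for r
    by (rule forall_Q_nonempty) (simp only: cut simp_thms)
  have U: "tv_and T (tv_imp T (U r) (exists_in T Q (\<lambda>s. tv_and T (tv_of T (s < r)) (U s))))
      (tv_imp T (exists_in T Q (\<lambda>s. tv_and T (tv_of T (s < r)) (U s))) (U r)) \<noteq> {}" for r
    by (rule forall_Q_nonempty) (simp only: cut simp_thms)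
  have disj: "tv_imp T (tv_and T (L r) (U r)) (tv_bot T) \<noteq> {}" for r
    by (rule forall_Q_nonempty) (simp only: cut simp_thms)
  have loc: "tv_imp T (tv_of T (r < s)) (tv_or T (L r) (U s)) \<noteq> {}" for r s
    by (rule forall_Q_nonempty[where r = s], rule forall_Q_nonempty[where r = r]) (simp only: cut simp_thms)
  have 2: "r \<in> {r. L r \<noteq> {}} \<longleftrightarrow> (\<exists>s>r. s \<in> {r. L r \<noteq> {}})" for r
    using tv_iff_nonempty[OF A_nonempty L[of r]]
    unfolding exists_in_nonempty tv_and_nonempty Q_nonempty tv_of_nonempty by simp
  have 3: "r \<in> {r. U r \<noteq> {}} \<longleftrightarrow> (\<exists>s<r. s \<in> {r. U r \<noteq> {}})" for r
    using tv_iff_nonempty[OF A_nonempty U[of r]]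
    unfolding exists_in_nonempty tv_and_nonempty Q_nonempty tv_of_nonempty by simp
  have 4: "\<not> (r \<in> {r. L r \<noteq> {}} \<and> r \<in> {r. U r \<noteq> {}})" for r
    using tv_imp_nonempty[OF A_nonempty disj[of r]] unfolding tv_and_nonempty tv_bot_def by blast
  have 5: "r \<in> {r. L r \<noteq> {}} \<or> s \<in> {r. U r \<noteq> {}}" if "r < s" for r s
    using tv_imp_nonempty[OF A_nonempty loc[of r s]] that unfolding tv_of_nonempty tv_or_nonempty by simp
  obtain x :: real where x: "\<And>r. r \<in> {r. L r \<noteq> {}} \<longleftrightarrow> of_rat r < x"
    "\<And>r. r \<in> {r. U r \<noteq> {}} \<longleftrightarrow> x < of_rat r"
    using cut_real[OF 1 2 3 4 5] by blast
  \<comment> \<open>A rational strictly between \<open>x\<close> and 0 would be in the lower cut of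
    0 but not in that of \<open>z\<close>.\<close>
  have "0 \<le> x"
  proof (rule ccontr)
    assume "\<not> 0 \<le> x"
    then obtain r where r: "x < of_rat r" "of_rat r < (0::real)" using of_rat_dense[of x 0] by auto
    have "tv_imp T (fst (rational_real T Q 0) r) (L r) \<noteq> {}"
      using forall_Q_nonempty[OF le0[unfolded real_le_def], of r] z by simp
    from tv_imp_nonempty[OF A_nonempty this] have "L r \<noteq> {}"
      using r(2) unfolding rational_real_def fst_conv tv_and_nonempty Q_nonempty tv_of_nonempty by simp
    then show False using x(1)[of r] r(1) by simp
  qed
  have "x \<le> 1"
  proof (rule ccontr)
    assume "\<not> x \<le> 1"
    then obtain r where r: "(1::real) < of_rat r" "of_rat r < x" using of_rat_dense[of 1 x] by auto
    have "tv_imp T (L r) (fst (rational_real T Q 1) r) \<noteq> {}"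
      using forall_Q_nonempty[OF le1[unfolded real_le_def], of r] z by simp
    from tv_imp_nonempty[OF A_nonempty this] have "r < 1"
      using r(2) x(1)[of r] unfolding rational_real_def fst_conv tv_and_nonempty Q_nonempty tv_of_nonempty
      by simp
    then show False using r(1) by simp
  qed
  show ?thesis unfolding is_real_def z using x \<open>0 \<le> x\<close> \<open>x \<le> 1\<close> by (intro exI[of _ x]) simp
qed

lemma pow_nonempty:
  assumes "pow_obj T Q L L' \<noteq> {}" shows "L r \<noteq> {} \<longleftrightarrow> L' r \<noteq> {}"
proof (rule tv_iff_nonempty[OF A_nonempty])
  have "tv_all T (\<lambda>r. tv_and T (tv_imp T (L r) (L' r)) (tv_imp T (L' r) (L r))) \<noteq> {}"
    using assms unfolding pow_obj_def tv_and_nonempty by simp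
  from tv_all_nonempty[OF A_nonempty this]
  show "tv_and T (tv_imp T (L r) (L' r)) (tv_imp T (L' r) (L r)) \<noteq> {}" .
qed

lemma UI_real_unique:
  assumes "UI z z' \<noteq> {}" "is_real z x" "is_real z' y" shows "x = y"
proof -
  have "pow_obj T Q (fst z) (fst z') \<noteq> {}" using assms(1) unfolding UI_eq tv_and_nonempty by blast
  then have "of_rat r < x \<longleftrightarrow> of_rat r < y" for r
    using assms(2,3) pow_nonempty unfolding is_real_def by metis
  then show ?thesis by (metis linorder_neqE of_rat_dense not_less_iff_gr_or_eq)
qed

text \<open>The projections lead to the last conjunct of \<open>is_cut\<close>, which is
  locatedness. The zeros are the empty arguments of the two quantifiers and, at the end, a realizer
  of the true inequality.\<close>

definition locate :: "(nat \<Rightarrow> bool) \<Rightarrow> nat \<Rightarrow> nat \<Rightarrow> nat \<Rightarrow> nat option" where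
  "locate \<alpha> h i j = do {
     a \<leftarrow> prj1 \<alpha> h; c \<leftarrow> prj2 \<alpha> a; c \<leftarrow> prj2 \<alpha> c; c \<leftarrow> prj2 \<alpha> c; c \<leftarrow> prj2 \<alpha> c; c \<leftarrow> prj2 \<alpha> c;
     l \<leftarrow> prj2 \<alpha> c; l \<leftarrow> do { e \<leftarrow> phi \<alpha> l 0; phi \<alpha> e i }; l \<leftarrow> do { e \<leftarrow> phi \<alpha> l 0; phi \<alpha> e j };
     phi \<alpha> l 0 }"

lemma pcomp_locate [comp_intros]:
  assumes "tcomp A f" "tcomp A g" "tcomp A h"
  shows "pcomp A (\<lambda>\<alpha> x. locate \<alpha> (f \<alpha> x) (g \<alpha> x) (h \<alpha> x))"
  unfolding locate_def
  by (intro comp_intros tcomp_subst[OF assms(1)] tcomp_subst[OF assms(2)] tcomp_subst[OF assms(3)] assms)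

lemma locate:
  assumes "h \<in> UI z z'" "\<alpha> \<in> A" "q i < q j"
  shows "\<exists>c\<in>tv_or T (fst z (q i)) (snd z (q j)). locate \<alpha> h i j = Some c"
proof -
  obtain p c b where h: "h = pair T (pair T p c) b" "c \<in> is_cut T Q z"
    using assms(1) unfolding UI_eq by (blast elim!: tv_andE)
  obtain c1 c2 c3 c4 c5 l where
    c: "c = pair T c1 (pair T c2 (pair T c3 (pair T c4 (pair T c5 l))))"
    and l: "l \<in> forall_in T Q (\<lambda>r. forall_in T Q (\<lambda>s. tv_imp T (tv_of T (r < s)) (tv_or T (fst z r) (snd z s))))"
    using h(2) unfolding is_cut_def case_prod_unfold by (blast elim!: tv_andE)
  obtain e l' where l': "phi \<alpha> l 0 = Some e" "phi \<alpha> e i = Some l'"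
    "l' \<in> forall_in T Q (\<lambda>s. tv_imp T (tv_of T (q i < s)) (tv_or T (fst z (q i)) (snd z s)))"
    using forall_inD[OF l _ assms(2), of i "q i"] by (auto simp: mem_Q bind_eq_Some_conv)
  obtain e' l'' where l'': "phi \<alpha> l' 0 = Some e'" "phi \<alpha> e' j = Some l''"
    "l'' \<in> tv_imp T (tv_of T (q i < q j)) (tv_or T (fst z (q i)) (snd z (q j)))"
    using forall_inD[OF l'(3) _ assms(2), of j "q j"] by (auto simp: mem_Q bind_eq_Some_conv)
  obtain d where "d \<in> tv_or T (fst z (q i)) (snd z (q j))" "phi \<alpha> l'' 0 = Some d"
    using tv_impD[OF l''(3) _ assms(2), of 0] assms(3) by (auto simp: tv_of_iff)
  then show ?thesis unfolding locate_def h(1) c by (simp add: assms(2) l'(1,2) l''(1,2))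
qed

lemma locate_low:
  assumes "h \<in> UI z z'" "\<alpha> \<in> A" "q i < q j" "snd z (q j) = {}"
  shows "\<exists>c\<in>fst z (q i). locate \<alpha> h i j = Some (pair T (bool_true T) c)"
  using locate[OF assms(1-3)] assms(4) unfolding tv_or_def by auto

lemma locate_up:
  assumes "h \<in> UI z z'" "\<alpha> \<in> A" "q i < q j" "fst z (q i) = {}"
  shows "\<exists>c\<in>snd z (q j). locate \<alpha> h i j = Some (pair T (bool_false T) c)"
  using locate[OF assms(1-3)] assms(4) unfolding tv_or_def by auto

text \<open>
  A realizer of \<open>r < x\<close> for an arbitrary cut of \<open>x = \<mu> m\<close>: an oracle search yields \<open>s\<close> with \<open>r < s < x\<close>,
  and locatedness at \<open>r < s\<close> cannot answer \<open>x < s\<close>.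
\<close>

definition conv_low :: "nat \<Rightarrow> nat \<Rightarrow> nat \<Rightarrow> nat" where
  "conv_low st m h = const_rz (pair T
     (clos A (\<lambda>\<alpha> st v. do { s \<leftarrow> phi \<alpha> st 0; phi \<alpha> s v }) st)
     (clos A (\<lambda>\<alpha> w n. do { s \<leftarrow> search_low \<alpha> (pfst w) n; c \<leftarrow> locate \<alpha> (psnd w) n s; prj2 \<alpha> c }) (pp m h)))"

definition conv_up :: "nat \<Rightarrow> nat \<Rightarrow> nat \<Rightarrow> nat" where
  "conv_up st m h = const_rz (pair T
     (clos A (\<lambda>\<alpha> st v. do { s \<leftarrow> phi \<alpha> st 0; phi \<alpha> s v }) st)
     (clos A (\<lambda>\<alpha> w n. do { s \<leftarrow> search_up \<alpha> (pfst w) n; c \<leftarrow> locate \<alpha> (psnd w) s n; prj2 \<alpha> c }) (pp m h)))"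

text \<open>A realizer of membership in an arbitrary cut need not name the rational. Strictness
  recovers an index of it, and \<open>mu_cut\<close> asks for nothing more.\<close>

lemma strict_conv:
  assumes "st \<in> tv_all T (\<lambda>r. tv_imp T (L r) (Q r r))" "L r \<noteq> {} \<Longrightarrow> {n. q n = r} \<subseteq> L' r"
  shows "clos A (\<lambda>\<alpha> st v. do { s \<leftarrow> phi \<alpha> st 0; phi \<alpha> s v }) st \<in> tv_imp T (L r) (L' r)"
proof (rule tv_impI, (intro comp_intros)[1])
  fix \<alpha> b assume "\<alpha> \<in> A" and b: "b \<in> L r"
  from all_impD[OF assms(1) this(2,1)] obtain n where
    n: "n \<in> Q r r" "(phi \<alpha> st 0 \<bind> (\<lambda>s. phi \<alpha> s b)) = Some n" by blast
  have "{n. q n = r} \<subseteq> L' r" using assms(2) b by blast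
  then show "\<exists>c\<in>L' r. (phi \<alpha> st 0 \<bind> (\<lambda>s. phi \<alpha> s b)) = Some c"
    using n by (auto simp: mem_Q)
qed

lemma conv_low:
  assumes h: "h \<in> UI z z'" and z: "is_real z (\<mu> m)"
    and st: "st \<in> tv_all T (\<lambda>r. tv_imp T (fst z r) (Q r r))"
  shows "conv_low st m h \<in> tv_all T (\<lambda>r. tv_and T (tv_imp T (fst z r) (fst (mu_cut m) r))
    (tv_imp T (fst (mu_cut m) r) (fst z r)))"
  unfolding conv_low_def
proof (intro tv_allI tv_andI)
  fix r
  show "clos A (\<lambda>\<alpha> st v. do { s \<leftarrow> phi \<alpha> st 0; phi \<alpha> s v }) st \<in> tv_imp T (fst z r) (fst (mu_cut m) r)"
    by (rule strict_conv[OF st]) (use z in \<open>auto simp: is_real_def mu_cut_def\<close>)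
  show "clos A (\<lambda>\<alpha> w n. do { s \<leftarrow> search_low \<alpha> (pfst w) n; c \<leftarrow> locate \<alpha> (psnd w) n s; prj2 \<alpha> c }) (pp m h)
    \<in> tv_imp T (fst (mu_cut m) r) (fst z r)"
  proof (rule tv_impI, (intro comp_intros)[1])
    fix \<alpha> n assume \<alpha>: "\<alpha> \<in> A" and "n \<in> fst (mu_cut m) r"
    then have n: "q n = r" "of_rat (q n) < \<mu> m" by (auto simp: mu_cut_def)
    obtain s where s: "search_low \<alpha> m n = Some s" "q n < q s" "of_rat (q s) < \<mu> m"
      using search_low[OF \<alpha> n(2)] by blast
    have "snd z (q s) = {}" using z s(3) unfolding is_real_def by (metis less_asym)
    from locate_low[OF h \<alpha> s(2) this] obtain c where
      "c \<in> fst z r" "locate \<alpha> h n s = Some (pair T (bool_true T) c)" using n by blast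
    then show "\<exists>c\<in>fst z r. (do { s \<leftarrow> search_low \<alpha> (pfst (pp m h)) n; c \<leftarrow> locate \<alpha> (psnd (pp m h)) n s; prj2 \<alpha> c }) = Some c"
      using s(1) \<alpha> by simp
  qed
qed

lemma conv_up:
  assumes h: "h \<in> UI z z'" and z: "is_real z (\<mu> m)"
    and st: "st \<in> tv_all T (\<lambda>r. tv_imp T (snd z r) (Q r r))"
  shows "conv_up st m h \<in> tv_all T (\<lambda>r. tv_and T (tv_imp T (snd z r) (snd (mu_cut m) r))
    (tv_imp T (snd (mu_cut m) r) (snd z r)))"
  unfolding conv_up_def
proof (intro tv_allI tv_andI)
  fix r
  show "clos A (\<lambda>\<alpha> st v. do { s \<leftarrow> phi \<alpha> st 0; phi \<alpha> s v }) st \<in> tv_imp T (snd z r) (snd (mu_cut m) r)"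
    by (rule strict_conv[OF st]) (use z in \<open>auto simp: is_real_def mu_cut_def\<close>)
  show "clos A (\<lambda>\<alpha> w n. do { s \<leftarrow> search_up \<alpha> (pfst w) n; c \<leftarrow> locate \<alpha> (psnd w) s n; prj2 \<alpha> c }) (pp m h)
    \<in> tv_imp T (snd (mu_cut m) r) (snd z r)"
  proof (rule tv_impI, (intro comp_intros)[1])
    fix \<alpha> n assume \<alpha>: "\<alpha> \<in> A" and "n \<in> snd (mu_cut m) r"
    then have n: "q n = r" "\<mu> m < of_rat (q n)" by (auto simp: mu_cut_def)
    obtain s where s: "search_up \<alpha> m n = Some s" "q s < q n" "\<mu> m < of_rat (q s)"
      using search_up[OF \<alpha> n(2)] by blast
    have "fst z (q s) = {}" using z s(3) unfolding is_real_def by (metis less_asym)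
    from locate_up[OF h \<alpha> s(2) this] obtain c where
      "c \<in> snd z r" "locate \<alpha> h s n = Some (pair T (bool_false T) c)" using n by blast
    then show "\<exists>c\<in>snd z r. (do { s \<leftarrow> search_up \<alpha> (pfst (pp m h)) n; c \<leftarrow> locate \<alpha> (psnd (pp m h)) s n; prj2 \<alpha> c }) = Some c"
      using s(1) \<alpha> by simp
  qed
qed

text \<open>Replacing \<open>z'\<close> by \<open>mu_cut m\<close> affects only the two conjuncts
  that compare cuts; strictness, extensionality, the cut conditions and the bounds concern
  \<open>z\<close> alone and are copied from \<open>h\<close>.\<close>

definition conv :: "(nat \<Rightarrow> bool) \<Rightarrow> nat \<Rightarrow> nat \<Rightarrow> nat option" where
  "conv \<alpha> m h = do {
     a \<leftarrow> prj1 \<alpha> h; b \<leftarrow> prj2 \<alpha> h; p \<leftarrow> prj1 \<alpha> a; c \<leftarrow> prj2 \<alpha> a; l \<leftarrow> prj1 \<alpha> p; u \<leftarrow> prj2 \<alpha> p;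
     l1 \<leftarrow> prj1 \<alpha> l; l2 \<leftarrow> prj2 \<alpha> l; l2 \<leftarrow> prj1 \<alpha> l2; u1 \<leftarrow> prj1 \<alpha> u; u2 \<leftarrow> prj2 \<alpha> u; u2 \<leftarrow> prj1 \<alpha> u2;
     Some (pair T (pair T (pair T (pair T l1 (pair T l2 (conv_low l1 m h)))
       (pair T u1 (pair T u2 (conv_up u1 m h)))) c) b) }"

lemma pcomp_conv [comp_intros]:
  assumes "tcomp A f" "tcomp A g" shows "pcomp A (\<lambda>\<alpha> x. conv \<alpha> (f \<alpha> x) (g \<alpha> x))"
  unfolding conv_def conv_low_def conv_up_def
  by (intro comp_intros tcomp_subst[OF assms(1)] tcomp_subst[OF assms(2)] assms)

lemma conv:
  assumes h: "h \<in> UI z z'" and z: "is_real z (\<mu> m)" and \<alpha>: "\<alpha> \<in> A"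
  shows "\<exists>c\<in>UI z (mu_cut m). conv \<alpha> m h = Some c"
proof -
  obtain l u c b where h': "h = pair T (pair T (pair T l u) c) b"
    and l: "l \<in> pow_obj T Q (fst z) (fst z')" and u: "u \<in> pow_obj T Q (snd z) (snd z')"
    and c: "c \<in> is_cut T Q z"
    and b: "b \<in> tv_and T (real_le T Q (rational_real T Q 0) z) (real_le T Q z (rational_real T Q 1))"
    using h unfolding UI_eq by (elim tv_andE[of _ "tv_and T P Q" for P Q] tv_andE[of _ "pow_obj T Q L M" for L M]) blast
  obtain l1 l2 l3 where l': "l = pair T l1 (pair T l2 l3)"
    and l1: "l1 \<in> tv_all T (\<lambda>r. tv_imp T (fst z r) (Q r r))"
    and l2: "l2 \<in> tv_all T (\<lambda>x. tv_all T (\<lambda>x'. tv_imp T (tv_and T (fst z x) (Q x x')) (fst z x')))"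
    using l unfolding pow_obj_def by (blast elim!: tv_andE)
  obtain u1 u2 u3 where u': "u = pair T u1 (pair T u2 u3)"
    and u1: "u1 \<in> tv_all T (\<lambda>r. tv_imp T (snd z r) (Q r r))"
    and u2: "u2 \<in> tv_all T (\<lambda>x. tv_all T (\<lambda>x'. tv_imp T (tv_and T (snd z x) (Q x x')) (snd z x')))"
    using u unfolding pow_obj_def by (blast elim!: tv_andE)
  have "pair T (pair T (pair T (pair T l1 (pair T l2 (conv_low l1 m h)))
       (pair T u1 (pair T u2 (conv_up u1 m h)))) c) b \<in> UI z (mu_cut m)"
    unfolding UI_eq pow_obj_def
    by (intro tv_andI[OF tv_andI[OF tv_andI[OF tv_andI[OF l1 tv_andI[OF l2 conv_low[OF h z l1]]]
      tv_andI[OF u1 tv_andI[OF u2 conv_up[OF h z u1]]]] c] b])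
  then show ?thesis using \<alpha> unfolding conv_def h' l' u' by simp
qed

text \<open>
  The search finds the first \<open>j\<close> for which locatedness decides \<open>x < (j + 1) / 2^k\<close> rather than
  \<open>j / 2^k < x\<close>; it ends at \<open>j = 2^k\<close> at the latest, because \<open>x \<le> 1\<close>.
\<close>

definition grid :: "(nat \<Rightarrow> bool) \<Rightarrow> nat \<Rightarrow> nat \<Rightarrow> nat option" where
  "grid \<alpha> h k = do {
     j \<leftarrow> mu_opt (\<lambda>j. do {
       c \<leftarrow> locate \<alpha> h (idx (of_nat j / 2 ^ k)) (idx (of_nat (Suc j) / 2 ^ k));
       t \<leftarrow> prj1 \<alpha> c;
       Some (of_bool (t \<noteq> bool_false T)) });
     Some (idx (of_nat j / 2 ^ k)) }"

lemma tcomp_idx: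
  assumes "tcomp B f" "tcomp B g" shows "tcomp B (\<lambda>\<alpha> x. idx (of_nat (f \<alpha> x) / 2 ^ g \<alpha> x))"
  unfolding idx_def
  by (rule tcomp_Least) (intro comp_intros tcomp_subst[OF assms(1)] tcomp_subst[OF assms(2)] assms, rule surj_q)

lemma pcomp_grid [comp_intros]:
  assumes "tcomp A f" "tcomp A g" shows "pcomp A (\<lambda>\<alpha> x. grid \<alpha> (f \<alpha> x) (g \<alpha> x))"
  unfolding grid_def
  by (intro comp_intros tcomp_idx tcomp_subst[OF assms(1)] tcomp_subst[OF assms(2)] assms)

text \<open>If the search ends at \<open>j\<close>, locatedness has given
  \<open>x < (j + 1) / 2^k\<close>, and its answer at \<open>j - 1\<close> was
  \<open>(j - 1) / 2^k < x\<close>. So \<open>j / 2^k\<close> is off by less than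
  \<open>2^-k\<close>.\<close>

lemma grid:
  assumes h: "h \<in> UI z z'" and z: "is_real z x" and \<alpha>: "\<alpha> \<in> A"
  shows "\<exists>g. grid \<alpha> h k = Some g \<and> \<bar>x - of_rat (q g)\<bar> < (1 / 2) ^ k"
proof -
  let ?r = "\<lambda>j. of_nat j / 2 ^ k :: rat"
  define F where "F = (\<lambda>j. locate \<alpha> h (idx (?r j)) (idx (?r (Suc j))))"
  have r: "?r j < ?r (Suc j)" for j by (simp add: divide_strict_right_mono)
  have F: "\<exists>c\<in>tv_or T (fst z (?r j)) (snd z (?r (Suc j))). F j = Some c" for j
    unfolding F_def using locate[OF h \<alpha>, of "idx (?r j)" "idx (?r (Suc j))"] r[of j] by simp
  define P where "P j \<longleftrightarrow> (\<exists>b. F j = Some (pair T (bool_false T) b) \<and> b \<in> snd z (?r (Suc j)))" for j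
  have G: "\<exists>v. (do { c \<leftarrow> F j; t \<leftarrow> prj1 \<alpha> c; Some (of_bool (t \<noteq> bool_false T)) }) = Some v \<and>
      ((v::nat) = 0 \<longleftrightarrow> P j)" for j
  proof -
    obtain c where c: "c \<in> tv_or T (fst z (?r j)) (snd z (?r (Suc j)))" "F j = Some c" using F by blast
    show ?thesis
    proof (cases "\<exists>b\<in>snd z (?r (Suc j)). c = pair T (bool_false T) b")
      case True
      then show ?thesis using c \<alpha> unfolding P_def by auto
    next
      case False
      then obtain a where a: "c = pair T (bool_true T) a" using c(1) unfolding tv_or_def by blast
      have "\<not> P j" using False c(2) unfolding P_def by auto
      then show ?thesis using c(2) a \<alpha> bool_true_neq_false[OF \<alpha>] by simp
    qed
  qed
  have nP: "of_rat (?r j) < x" if nP: "\<not> P j" for j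
  proof -
    obtain c where c: "c \<in> tv_or T (fst z (?r j)) (snd z (?r (Suc j)))" "F j = Some c" using F by blast
    then have "fst z (?r j) \<noteq> {}" using nP unfolding P_def tv_or_def by auto
    then show ?thesis using z unfolding is_real_def by blast
  qed
  have "P (2 ^ k)"
  proof (rule ccontr)
    assume "\<not> P (2 ^ k)"
    from nP[OF this] have "1 < x" by simp
    then show False using z unfolding is_real_def by simp
  qed
  then have mu: "mu_opt (\<lambda>j. do { c \<leftarrow> F j; t \<leftarrow> prj1 \<alpha> c; Some (of_bool (t \<noteq> bool_false T)) })
      = Some (LEAST j. P j)" (is "_ = Some ?j")
    by (rule mu_opt_eq_LeastI) (rule G)
  have "P ?j" using \<open>P (2 ^ k)\<close> by (rule LeastI)
  then have "x < of_rat (?r (Suc ?j))" using z unfolding P_def is_real_def by blast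
  then have up: "x < real ?j / 2 ^ k + (1 / 2) ^ k"
    by (simp add: of_rat_divide of_rat_power of_rat_add field_simps)
  \<comment> \<open>At \<open>j = 0\<close> there is no earlier answer; the bound
    \<open>0 \<le> x\<close> takes its place.\<close>
  have low: "real ?j / 2 ^ k - (1 / 2) ^ k < x"
  proof (cases ?j)
    case 0
    have "0 \<le> x" using z unfolding is_real_def by simp
    moreover have "(0::real) < (1 / 2) ^ k" by simp
    ultimately have "- ((1 / 2) ^ k) < x" by linarith
    then show ?thesis unfolding 0 by simp
  next
    case (Suc i)
    then have "\<not> P i" using not_less_Least[of i P] by simp
    from nP[OF this] have "real i / 2 ^ k < x" by (simp add: of_rat_divide of_rat_power)
    then show ?thesis unfolding Suc by (simp add: field_simps)
  qed
  have "grid \<alpha> h k = Some (idx (?r ?j))" using mu unfolding grid_def F_def by simp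
  moreover have "\<bar>x - of_rat (q (idx (?r ?j)))\<bar> < (1 / 2) ^ k"
    using up low by (simp add: of_rat_divide of_rat_power abs_less_iff)
  ultimately show ?thesis by blast
qed

end

section \<open>Functional relations and powers\<close>

context oracle_pca
begin

text \<open>Totality and strictness of a functional relation \<open>F\<close>, realized by \<open>e\<close>, turn a realizer of
  \<open>x\<close> into a realizer of \<open>F x y\<close> and one of \<open>y\<close>, for some \<open>y\<close>.\<close>

definition val :: "(nat \<Rightarrow> bool) \<Rightarrow> nat \<Rightarrow> nat \<Rightarrow> nat option" where
  "val \<alpha> e r = do {
     e1 \<leftarrow> prj1 \<alpha> e; t \<leftarrow> prj2 \<alpha> e; t \<leftarrow> prj2 \<alpha> t; t \<leftarrow> prj2 \<alpha> t; e4 \<leftarrow> prj1 \<alpha> t;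
     s \<leftarrow> phi \<alpha> e4 0; g \<leftarrow> phi \<alpha> s r;
     s \<leftarrow> phi \<alpha> e1 0; s \<leftarrow> phi \<alpha> s 0; w \<leftarrow> phi \<alpha> s g; h \<leftarrow> prj2 \<alpha> w;
     Some (pp g h) }"

lemma pcomp_val [comp_intros]:
  assumes "tcomp A f" "tcomp A g" shows "pcomp A (\<lambda>\<alpha> x. val \<alpha> (f \<alpha> x) (g \<alpha> x))"
  unfolding val_def
  by (intro comp_intros tcomp_subst[OF assms(1)] tcomp_subst[OF assms(2)] assms)

lemma val:
  assumes e: "e \<in> exp_obj T X Y F G" and r: "r \<in> X x x" and \<alpha>: "\<alpha> \<in> A"
  shows "\<exists>y g h. val \<alpha> e r = Some (pp g h) \<and> g \<in> F x y \<and> h \<in> Y y y"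
proof -
  obtain e1 e2 e3 e4 e5 where e': "e = pair T e1 (pair T e2 (pair T e3 (pair T e4 e5)))"
    and e1: "e1 \<in> tv_all T (\<lambda>x. tv_all T (\<lambda>y. tv_imp T (F x y) (tv_and T (X x x) (Y y y))))"
    and e4: "e4 \<in> tv_all T (\<lambda>x. tv_imp T (X x x) (tv_ex T (\<lambda>y. F x y)))"
    using e unfolding exp_obj_def by (blast elim!: tv_andE)
  obtain s y g where g: "phi \<alpha> e4 0 = Some s" "phi \<alpha> s r = Some g" "g \<in> F x y"
    using all_impD[OF e4 r \<alpha>] by (auto simp: tv_ex_iff bind_eq_Some_conv)
  obtain s1 s2 w where w: "phi \<alpha> e1 0 = Some s1" "phi \<alpha> s1 0 = Some s2" "phi \<alpha> s2 g = Some w"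
    "w \<in> tv_and T (X x x) (Y y y)"
    using all2_impD[OF e1 g(3) \<alpha>] by (auto simp: bind_eq_Some_conv)
  obtain a h where "w = pair T a h" "h \<in> Y y y" using w(4) by (blast elim: tv_andE)
  then have "val \<alpha> e r = Some (pp g h)"
    unfolding val_def e' by (simp add: \<alpha> g w)
  then show ?thesis using g(3) \<open>h \<in> Y y y\<close> by blast
qed

text \<open>The \<open>y\<close> that \<open>val\<close> finds may vary with the oracle and with the
  realizer of \<open>x\<close>; this is what identifies the different outcomes.\<close>

lemma exp_single_valued:
  assumes "exp_obj T X Y F G \<noteq> {}" "F x y \<noteq> {}" "F x y' \<noteq> {}" "A \<noteq> {}"
  shows "Y y y' \<noteq> {}"
proof -
  have "tv_all T (\<lambda>x. tv_all T (\<lambda>y. tv_all T (\<lambda>y'. tv_imp T (tv_and T (F x y) (F x y')) (Y y y')))) \<noteq> {}"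
    using assms(1) unfolding exp_obj_def tv_and_nonempty by simp
  from tv_all_nonempty[OF assms(4) tv_all_nonempty[OF assms(4) tv_all_nonempty[OF assms(4) this]]]
  have "tv_imp T (tv_and T (F x y) (F x y')) (Y y y') \<noteq> {}" .
  from tv_imp_nonempty[OF assms(4) this] show ?thesis using assms(2,3) unfolding tv_and_nonempty by simp
qed

lemma mem_value_sat: "c \<in> value_sat T F x \<psi> \<longleftrightarrow> (\<exists>y a b. c = pair T a b \<and> a \<in> F x y \<and> b \<in> \<psi> y)"
  unfolding value_sat_def tv_ex_iff tv_and_def by blast

text \<open>Since \<open>\<not>\<not>P\<close> is realized by every number as soon as \<open>P\<close> is inhabited, a realizer of the
  stability of \<open>P\<close> computes a realizer of \<open>P\<close> from nothing.\<close>

definition stable_rz :: "(nat \<Rightarrow> bool) \<Rightarrow> nat \<Rightarrow> nat \<Rightarrow> nat option" where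
  "stable_rz \<alpha> d r = do {
     w \<leftarrow> val \<alpha> d r; s \<leftarrow> prj2 \<alpha> (psnd w); v \<leftarrow> phi \<alpha> s 0; Some (pair T (pfst w) v) }"

lemma pcomp_stable_rz [comp_intros]:
  assumes "tcomp A f" "tcomp A g" shows "pcomp A (\<lambda>\<alpha> x. stable_rz \<alpha> (f \<alpha> x) (g \<alpha> x))"
  unfolding stable_rz_def by (intro comp_intros assms)

lemma stable_rz:
  assumes d: "d \<in> exp_obj T X (Omega_nn T) \<phi> \<phi>'" and r: "r \<in> X x x" and \<alpha>: "\<alpha> \<in> A"
    and ne: "value_sat T \<phi> x (\<lambda>P. P) \<noteq> {}"
  shows "\<exists>c\<in>value_sat T \<phi> x (\<lambda>P. P). stable_rz \<alpha> d r = Some c"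
proof -
  have A: "A \<noteq> {}" using \<alpha> by blast
  obtain P g h where P: "val \<alpha> d r = Some (pp g h)" "g \<in> \<phi> x P" "h \<in> Omega_nn T P P"
    using val[OF d r \<alpha>] by blast
  obtain c where "c \<in> value_sat T \<phi> x (\<lambda>P. P)" using ne by blast
  then obtain P' a b where "a \<in> \<phi> x P'" "b \<in> P'" unfolding mem_value_sat by blast
  then have P': "\<phi> x P' \<noteq> {}" "P' \<noteq> {}" by auto
  \<comment> \<open>The truth value \<open>P\<close> found by \<open>val\<close> need not be the
    inhabited \<open>P'\<close>. Single-valuedness makes the two equivalent, so \<open>P\<close> is
    inhabited as well.\<close>
  have "Omega_nn T P P' \<noteq> {}"
    by (rule exp_single_valued[where F = \<phi> and x = x and X = X and G = \<phi>']) (use d P(2) P'(1) A in auto)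
  then have "tv_and T (tv_imp T P P') (tv_imp T P' P) \<noteq> {}"
    unfolding Omega_nn_def subobj_def Omega_def tv_and_nonempty by simp
  then have "P \<noteq> {}" using tv_iff_nonempty[OF A, of P P'] P'(2) by simp
  then have empty: "tv_imp T P (tv_bot T) = {}" using tv_imp_nonempty[OF A, of P "tv_bot T"]
    unfolding tv_bot_def by (cases "tv_imp T P {} = {}") simp_all
  have 0: "0 \<in> tv_imp T (tv_imp T P (tv_bot T)) (tv_bot T)" unfolding empty by (simp add: tv_imp_def)
  obtain a s where s: "h = pair T a s" "s \<in> tv_imp T (tv_imp T (tv_imp T P (tv_bot T)) (tv_bot T)) P"
    using P(3) unfolding Omega_nn_def subobj_def by (blast elim: tv_andE)
  obtain v where v: "v \<in> P" "phi \<alpha> s 0 = Some v" using tv_impD[OF s(2) 0 \<alpha>] by blast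
  have "stable_rz \<alpha> d r = Some (pair T g v)" unfolding stable_rz_def by (simp add: P(1) s(1) v \<alpha>)
  moreover have "pair T g v \<in> value_sat T \<phi> x (\<lambda>P. P)" unfolding mem_value_sat using P(2) v(1) by blast
  ultimately show ?thesis by blast
qed

section \<open>Coordinates of points of a power\<close>

definition coord :: "(nat \<Rightarrow> bool) \<Rightarrow> nat \<Rightarrow> nat \<Rightarrow> nat option" where
  "coord \<alpha> i h = rec_nat (Some h) (\<lambda>_ v. Option.bind v (\<lambda>b. prj2 \<alpha> b)) i \<bind> prj1 \<alpha>"

lemma pcomp_coord [comp_intros]:
  assumes "tcomp A f" "tcomp A g" shows "pcomp A (\<lambda>\<alpha> x. coord \<alpha> (f \<alpha> x) (g \<alpha> x))"
  unfolding coord_def by (intro comp_intros assms)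

text \<open>\<open>rec_nat\<close> adds projections at the outer end, whereas
  \<open>power_obj\<close> is taken apart from the head; all projections being equal, one can be
  moved to the front.\<close>

lemma coord_Suc: "coord \<alpha> (Suc i) h = prj2 \<alpha> h \<bind> coord \<alpha> i"
proof -
  have "rec_nat (Some h) (\<lambda>_ v. Option.bind v (\<lambda>b. prj2 \<alpha> b)) (Suc i) =
    prj2 \<alpha> h \<bind> (\<lambda>h. rec_nat (Some h) (\<lambda>_ v. Option.bind v (\<lambda>b. prj2 \<alpha> b)) i)"
    by (induction i) auto
  then show ?thesis unfolding coord_def by simp
qed

lemma power_obj_length: "h \<in> power_obj T X n xs ys \<Longrightarrow> length xs = n \<and> length ys = n"
proof (induction n arbitrary: h xs ys)
  case 0
  then show ?case by (cases xs; cases ys) (auto simp: tv_bot_def)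
next
  case (Suc n)
  then show ?case by (cases xs; cases ys) (auto simp: tv_bot_def elim!: tv_andE)
qed

lemma coord:
  assumes "h \<in> power_obj T X n xs ys" "i < n" "\<alpha> \<in> A"
  shows "\<exists>c\<in>X (xs ! i) (ys ! i). coord \<alpha> i h = Some c"
  using assms(1,2)
proof (induction n arbitrary: i h xs ys)
  case (Suc n)
  obtain x xs' y ys' where xy: "xs = x # xs'" "ys = y # ys'"
    using power_obj_length[OF Suc.prems(1)] by (cases xs; cases ys) auto
  obtain a b where h: "h = pair T a b" "a \<in> X x y" "b \<in> power_obj T X n xs' ys'"
    using Suc.prems(1) unfolding xy by (auto elim: tv_andE)
  show ?case
  proof (cases i)
    case 0
    then show ?thesis using h assms(3) by (simp add: coord_def xy)
  next
    case (Suc i')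
    then show ?thesis using Suc.IH[OF h(3), of i'] Suc.prems(2) assms(3) h(1)
      by (simp add: coord_Suc xy)
  qed
qed simp

end

context miller
begin

abbreviation In :: "nat \<Rightarrow> (nat, ((rat \<Rightarrow> nat set) \<times> (rat \<Rightarrow> nat set)) list) obj" where
  "In \<equiv> power_obj T UI"

primrec pow_rz :: "nat list \<Rightarrow> nat" where
  "pow_rz [] = 0"
| "pow_rz (m # ms) = pair T (unit_rz m) (pow_rz ms)"

lemma pow_rz: "pow_rz ms \<in> In (length ms) (map mu_cut ms) (map mu_cut ms)"
  by (induction ms) (auto simp: tv_top_def intro: tv_andI unit_rz)

primrec convs :: "(nat \<Rightarrow> bool) \<Rightarrow> nat list \<Rightarrow> nat \<Rightarrow> nat option" where
  "convs \<alpha> [] h = Some h"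
| "convs \<alpha> (m # ms) h = do {
     a \<leftarrow> prj1 \<alpha> h; b \<leftarrow> prj2 \<alpha> h; c \<leftarrow> conv \<alpha> m a; d \<leftarrow> convs \<alpha> ms b; Some (pair T c d) }"

lemma convs:
  assumes "h \<in> In (length ms) zs zs'" "\<And>i. i < length ms \<Longrightarrow> is_real (zs ! i) (\<mu> (ms ! i))" "\<alpha> \<in> A"
  shows "\<exists>c\<in>In (length ms) zs (map mu_cut ms). convs \<alpha> ms h = Some c"
  using assms(1,2)
proof (induction ms arbitrary: h zs zs')
  case Nil
  then show ?case using power_obj_length[OF Nil.prems(1)] by (simp add: tv_top_def)
next
  case (Cons m ms)
  obtain x xs y ys where xy: "zs = x # xs" "zs' = y # ys"
    using power_obj_length[OF Cons.prems(1)] by (cases zs; cases zs') auto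
  obtain a b where h: "h = pair T a b" "a \<in> UI x y" "b \<in> In (length ms) xs ys"
    using Cons.prems(1) unfolding xy by (auto elim: tv_andE)
  have "is_real x (\<mu> m)" using Cons.prems(2)[of 0] xy by simp
  from conv[OF h(2) this assms(3)] obtain c where c: "c \<in> UI x (mu_cut m)" "conv \<alpha> m a = Some c" by blast
  have "is_real (xs ! i) (\<mu> (ms ! i))" if "i < length ms" for i
    using Cons.prems(2)[of "Suc i"] that xy by simp
  from Cons.IH[OF h(3) this] obtain d where
    d: "d \<in> In (length ms) xs (map mu_cut ms)" "convs \<alpha> ms b = Some d" by blast
  show ?case using tv_andI[OF c(1) d(1)] c(2) d(2) assms(3) by (simp add: xy h(1))
qed

text \<open>Its values serve both as programs and as positions in the sequence \<mu>: these are the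
  indices of the coordinates of the fixed point.\<close>

definition curry_rz :: "nat \<Rightarrow> nat \<Rightarrow> nat" where
  "curry_rz e x = clos A (\<lambda>\<alpha> w k. phi \<alpha> (pfst w) (pp (psnd w) k)) (pp e x)"

lemma phi_curry_rz: "\<alpha> \<in> A \<Longrightarrow> phi \<alpha> (curry_rz e x) k = phi \<alpha> e (pp x k)"
  unfolding curry_rz_def by (subst phi_clos) (intro comp_intros, assumption, simp)

definition indices :: "nat list \<Rightarrow> nat \<Rightarrow> nat \<Rightarrow> nat list" where
  "indices js e x = map (\<lambda>j. curry_rz e (pp x j)) js"

text \<open>The length of the list is fixed outside the programs. Induction on \<open>js\<close>
  builds one program for each length, and no list has to be coded as a number.\<close>

lemma tcomp_pow_rz [comp_intros]:
  assumes "tcomp A f" "tcomp A g" shows "tcomp A (\<lambda>\<alpha> x. pow_rz (indices js (f \<alpha> x) (g \<alpha> x)))"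
  unfolding indices_def curry_rz_def
proof (induction js)
  case (Cons j js)
  show ?case unfolding list.map pow_rz.simps by (intro comp_intros Cons.IH assms)
qed (simp add: comp_intros)

lemma pcomp_convs [comp_intros]:
  assumes "tcomp A f" "tcomp A g" "tcomp A h"
  shows "pcomp A (\<lambda>\<alpha> x. convs \<alpha> (indices js (f \<alpha> x) (g \<alpha> x)) (h \<alpha> x))"
  unfolding indices_def curry_rz_def
  using assms
proof (induction js arbitrary: f g h)
  case Nil
  then show ?case by (simp add: comp_intros)
next
  case (Cons j js)
  note [comp_intros] = Cons.IH
  show ?case unfolding list.map convs.simps
    by (intro comp_intros tcomp_subst[OF Cons.prems(1)] tcomp_subst[OF Cons.prems(2)]
        tcomp_subst[OF Cons.prems(3)] Cons.prems)
qed

section \<open>Consequences of the Miller property\<close>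

lemma represents_unique:
  assumes "represents q g x" "represents q g y" shows "x = y"
proof (rule ccontr)
  assume "x \<noteq> y"
  then obtain k where k: "(1 / 2) ^ k < \<bar>x - y\<bar> / 2" using half_power_small[of "\<bar>x - y\<bar> / 2"] by auto
  define p :: real where "p = (1 / 2) ^ k"
  have "\<bar>x - of_rat (q (g k))\<bar> < p" "\<bar>y - of_rat (q (g k))\<bar> < p"
    using assms unfolding represents_def p_def by auto
  then have "\<bar>x - y\<bar> < 2 * p" by (simp add: abs_less_iff)
  then show False using k[folded p_def] by simp
qed

text \<open>At any one oracle the program \<open>m\<close> computes a single function, which
  represents both \<open>x\<close> and, by the Miller property, \<open>\<mu> m\<close>.\<close>

lemma index_eq_mu:
  assumes "index_of pr q \<mu> m x" shows "x = \<mu> m"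
proof -
  have "index_of pr q \<mu> m (\<mu> m)" using assms miller unfolding miller_sequence_def by blast
  moreover obtain \<alpha> where "\<alpha> \<in> oracles pr \<mu>" using A_nonempty A_eq by blast
  ultimately obtain g g' where "\<forall>k. phi \<alpha> m k = Some (g k)" "represents q g x"
    "\<forall>k. phi \<alpha> m k = Some (g' k)" "represents q g' (\<mu> m)"
    using assms unfolding index_of_def by meson
  moreover from this have "g = g'" by (simp add: fun_eq_iff)
  ultimately show ?thesis using represents_unique by blast
qed

section \<open>The fixed point\<close>

abbreviation domain_obj ::
    "nat \<Rightarrow> (((rat \<Rightarrow> nat set) \<times> (rat \<Rightarrow> nat set)) list \<Rightarrow> nat set \<Rightarrow> nat set) \<Rightarrow>
     (nat, ((rat \<Rightarrow> nat set) \<times> (rat \<Rightarrow> nat set)) list) obj" where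
  "domain_obj n \<phi> \<equiv> subobj T (In n) (\<lambda>x. value_sat T \<phi> x (\<lambda>P. P))"

text \<open>With \<open>x\<close> coding realizers of \<open>\<phi>\<close> and \<open>f\<close>, and \<open>E\<close> an index of the program itself, this
  approximates the \<open>i\<close>-th coordinate of \<open>f y\<close> for the point \<open>y\<close> with coordinates
  \<open>\<mu> (curry_rz E (pp x j))\<close>.\<close>

definition coord_approx ::
    "nat \<Rightarrow> (nat \<Rightarrow> bool) \<Rightarrow> nat \<Rightarrow> nat \<Rightarrow> nat \<Rightarrow> nat \<Rightarrow> nat option" where
  "coord_approx n \<alpha> E x i k = do {
     v \<leftarrow> stable_rz \<alpha> (pfst x) (pow_rz (indices [0..<n] E x));
     w \<leftarrow> val \<alpha> (psnd x) (pair T (pow_rz (indices [0..<n] E x)) v);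
     c \<leftarrow> coord \<alpha> i (psnd w);
     grid \<alpha> c k }"

text \<open>The realizers and the coordinate are arguments of \<open>E\<close>, so for given
  \<open>n\<close> one self-referential program serves all \<phi>, all \<open>f\<close> and all
  coordinates.\<close>

lemma self_index_exists:
  "\<exists>E. \<forall>\<alpha>\<in>A. \<forall>x i k. phi \<alpha> E (pp (pp x i) k) = coord_approx n \<alpha> E x i k"
proof -
  have "pcomp A (\<lambda>\<alpha> z. coord_approx n \<alpha> (pfst z) (pfst (pfst (psnd z))) (psnd (pfst (psnd z))) (psnd (psnd z)))"
    unfolding coord_approx_def by (intro comp_intros)
  then obtain E where
    "\<And>\<alpha> x. \<alpha> \<in> A \<Longrightarrow> phi \<alpha> E x = coord_approx n \<alpha> E (pfst (pfst x)) (psnd (pfst x)) (psnd x)"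
    using recursion_theorem[of "\<lambda>\<alpha> e x. coord_approx n \<alpha> e (pfst (pfst x)) (psnd (pfst x)) (psnd x)"] by blast
  then show ?thesis by (intro exI[of _ E]) simp
qed

lemma fixed_point_coordinates:
  assumes E: "\<And>\<alpha> x i k. \<alpha> \<in> A \<Longrightarrow> phi \<alpha> E (pp (pp x i) k) = coord_approx n \<alpha> E x i k"
    and d: "d \<in> exp_obj T (In n) (Omega_nn T) \<phi> \<phi>"
    and e: "e \<in> exp_obj T (domain_obj n \<phi>) (In n) f f"
    and ms: "ms = indices [0..<n] E (pp d e)" and y: "y = map mu_cut ms"
    and ne: "value_sat T \<phi> y (\<lambda>P. P) \<noteq> {}"
    and z: "f y z \<noteq> {}" "In n z z \<noteq> {}" and i: "i < n"
  shows "is_real (z ! i) (\<mu> (ms ! i))"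
proof -
  have len: "length ms = n" unfolding ms indices_def by simp
  have r: "pow_rz ms \<in> In n y y" using pow_rz[of ms] len y by simp
  have mi: "ms ! i = curry_rz E (pp (pp d e) i)" unfolding ms indices_def using i by simp
  have UI_coord: "UI (u ! i) (w ! i) \<noteq> {}" if "In n u w \<noteq> {}" for u w
  proof -
    obtain \<alpha> h where "\<alpha> \<in> A" "h \<in> In n u w" using A_nonempty \<open>In n u w \<noteq> {}\<close> by blast
    then show ?thesis using coord[of h UI n u w i \<alpha>] i by blast
  qed
  obtain x where x: "is_real (z ! i) x" using UI_is_real[OF UI_coord[OF z(2)]] by blast
  have "\<exists>g. (\<forall>k. phi \<alpha> (ms ! i) k = Some (g k)) \<and> represents q g x" if \<alpha>: "\<alpha> \<in> A" for \<alpha>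
  proof -
    obtain v where v: "v \<in> value_sat T \<phi> y (\<lambda>P. P)" "stable_rz \<alpha> d (pow_rz ms) = Some v"
      using stable_rz[OF d r \<alpha> ne] by blast
    have "pair T (pow_rz ms) v \<in> domain_obj n \<phi> y y"
      unfolding subobj_def using r v(1) by (rule tv_andI)
    from val[OF e this \<alpha>] obtain z' g h where
      w: "val \<alpha> e (pair T (pow_rz ms) v) = Some (pp g h)" "g \<in> f y z'" "h \<in> In n z' z'" by blast
    obtain c where c: "c \<in> UI (z' ! i) (z' ! i)" "coord \<alpha> i h = Some c"
      using coord[OF w(3) i \<alpha>] by blast
    obtain x' where x': "is_real (z' ! i) x'" using UI_is_real[of "z' ! i" "z' ! i"] c(1) by blast
    \<comment> \<open>The value \<open>z'\<close> belongs to this oracle's run, whereas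
      \<open>z\<close> and its real \<open>x\<close> were fixed beforehand; the two values have the
      same coordinates as reals.\<close>
    have "In n z z' \<noteq> {}"
      by (rule exp_single_valued[where F = f and x = y and X = "domain_obj n \<phi>" and G = f])
        (use e z(1) w(2) A_nonempty in auto)
    then have "x' = x" using UI_real_unique[OF UI_coord x x'] by simp
    then have "\<exists>b. grid \<alpha> c k = Some b \<and> \<bar>x - of_rat (q b)\<bar> < (1 / 2) ^ k" for k
      using grid[OF c(1) x' \<alpha>] by simp
    then obtain b where b: "\<And>k. grid \<alpha> c k = Some (b k)" "\<And>k. \<bar>x - of_rat (q (b k))\<bar> < (1 / 2) ^ k"
      by metis
    \<comment> \<open>By the equation for \<open>E\<close>, the program \<open>ms ! i\<close> works
      with the very point whose \<open>i\<close>-th coordinate it names.\<close>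
    have "phi \<alpha> (ms ! i) k = Some (b k)" for k
      unfolding mi phi_curry_rz[OF \<alpha>] E[OF \<alpha>] coord_approx_def
      by (simp flip: ms add: v(2) w(1) c(2) b(1))
    then show ?thesis using b(2) unfolding represents_def by blast
  qed
  then have "index_of pr q \<mu> (ms ! i) x" using x unfolding index_of_def A_eq is_real_def by blast
  then show ?thesis using index_eq_mu x by blast
qed

theorem fixed_point_property:
  "validates T
    (forall_in T (exp_obj T (In n) (Omega_nn T)) (\<lambda>\<phi>.
      forall_in T (exp_obj T (domain_obj n \<phi>) (In n)) (\<lambda>f.
        exists_in T (In n) (\<lambda>y.
          tv_imp T (value_sat T \<phi> y (\<lambda>P. P)) (value_sat T f y (\<lambda>z. In n z y))))))"
proof -
  obtain E where E: "\<And>\<alpha> x i k. \<alpha> \<in> A \<Longrightarrow> phi \<alpha> E (pp (pp x i) k) = coord_approx n \<alpha> E x i k"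
    using self_index_exists by blast
  \<comment> \<open>This program receives a realizer \<open>v\<close> of \<open>\<phi> y\<close> and
    evaluates \<open>f\<close> with it. The value may differ from the one seen inside the indices,
    but \<open>fixed_point_coordinates\<close> covers every value related to
    \<open>y\<close>.\<close>
  define F where "F = (\<lambda>\<alpha> x v. do {
    w \<leftarrow> val \<alpha> (psnd x) (pair T (pow_rz (indices [0..<n] E x)) v);
    c \<leftarrow> convs \<alpha> (indices [0..<n] E x) (psnd w); Some (pair T (pfst w) c) })"
  have cF: "pcomp A (\<lambda>\<alpha> z. F \<alpha> (pfst z) (psnd z))" unfolding F_def by (intro comp_intros)
  \<comment> \<open>The realizer of \<open>y\<close> is assembled from \<open>d\<close> and
    \<open>e\<close> alone; only \<open>F\<close> may use that \<open>\<phi> y\<close>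
    holds.\<close>
  define R where "R = const_rz (clos A (\<lambda>\<alpha> _ d. Some (const_rz (clos A (\<lambda>\<alpha> d e.
    Some (pair T (pow_rz (indices [0..<n] E (pp d e))) (clos A F (pp d e)))) d))) 0)"
  have "R \<in> forall_in T (exp_obj T (In n) (Omega_nn T)) (\<lambda>\<phi>.
      forall_in T (exp_obj T (domain_obj n \<phi>) (In n)) (\<lambda>f.
        exists_in T (In n) (\<lambda>y.
          tv_imp T (value_sat T \<phi> y (\<lambda>P. P)) (value_sat T f y (\<lambda>z. In n z y)))))"
    unfolding R_def
  proof (rule forall_inI, (intro comp_intros)[1], rule Some_bexI,
      rule forall_inI, (intro comp_intros)[1], rule Some_bexI)
    fix \<phi> d f e
    assume d: "d \<in> exp_obj T (In n) (Omega_nn T) \<phi> \<phi>"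
      and e: "e \<in> exp_obj T (domain_obj n \<phi>) (In n) f f"
    define ms where "ms = indices [0..<n] E (pp d e)"
    define y where "y = map mu_cut ms"
    have len: "length ms = n" unfolding ms_def indices_def by simp
    have r: "pow_rz ms \<in> In n y y" using pow_rz[of ms] len y_def by simp
    have "clos A F (pp d e) \<in> tv_imp T (value_sat T \<phi> y (\<lambda>P. P)) (value_sat T f y (\<lambda>z. In n z y))"
    proof (rule tv_impI[OF cF])
      fix \<alpha> v assume \<alpha>: "\<alpha> \<in> A" and v: "v \<in> value_sat T \<phi> y (\<lambda>P. P)"
      have "pair T (pow_rz ms) v \<in> domain_obj n \<phi> y y"
        unfolding subobj_def using r v by (rule tv_andI)
      from val[OF e this \<alpha>] obtain z g h where
        w: "val \<alpha> e (pair T (pow_rz ms) v) = Some (pp g h)" "g \<in> f y z" "h \<in> In n z z" by blast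
      have "is_real (z ! i) (\<mu> (ms ! i))" if "i < length ms" for i
        by (rule fixed_point_coordinates[OF E d e ms_def y_def]) (use v w that len in auto)
      from convs[OF w(3)[folded len] this \<alpha>] obtain c where
        c: "c \<in> In n z y" "convs \<alpha> ms h = Some c" unfolding len y_def by blast
      have "pair T g c \<in> value_sat T f y (\<lambda>z. In n z y)" unfolding mem_value_sat using w(2) c(1) by blast
      moreover have "F \<alpha> (pp d e) v = Some (pair T g c)"
        unfolding F_def by (simp flip: ms_def add: w(1) c(2))
      ultimately show "\<exists>c\<in>value_sat T f y (\<lambda>z. In n z y). F \<alpha> (pp d e) v = Some c" by blast
    qed
    then show "pair T (pow_rz (indices [0..<n] E (pp d e))) (clos A F (pp d e)) \<in>
      exists_in T (In n) (\<lambda>y.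
          tv_imp T (value_sat T \<phi> y (\<lambda>P. P)) (value_sat T f y (\<lambda>z. In n z y)))"
      using r unfolding ms_def[symmetric] by (rule exists_inI[rotated])
  qed
  then show ?thesis
    unfolding validates_def tripos_le_def app_in_def
    by (intro exI[of _ "const_rz R"]) (simp add: phi_const_rz)
qed

end

theorem theorem7p2:
  fixes pr :: "nat \<Rightarrow> nat \<Rightarrow> nat" and q :: "nat \<Rightarrow> rat" and \<mu> :: "nat \<Rightarrow> real" and n :: nat
  assumes "computable_pairing pr"
    and "computable_rat_enum q"
    and "miller_sequence pr q \<mu>"
  shows "let T = miller_topos pr \<mu>;
             In = power_obj T (unit_interval T (rat_obj q)) n
         in validates T
              (forall_in T (exp_obj T In (Omega_nn T)) (\<lambda>\<phi>.
                 forall_in T (exp_obj T (subobj T In (\<lambda>x. value_sat T \<phi> x (\<lambda>P. P))) In) (\<lambda>f.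
                   exists_in T In (\<lambda>y.
                     tv_imp T (value_sat T \<phi> y (\<lambda>P. P))
                              (value_sat T f y (\<lambda>z. In z y))))))"
proof (cases "oracles pr \<mu> = {}")
  \<comment> \<open>Without oracles, being a realizer is a vacuous condition.\<close>
  case True
  then show ?thesis
    unfolding Let_def validates_def tripos_le_def miller_topos_def by simp
next
  case False
  interpret miller "oracles pr \<mu>" pr q \<mu>
    using False assms by unfold_locales auto
  have "miller_topos pr \<mu> = T" unfolding miller_topos_def T_def ..
  then show ?thesis unfolding Let_def using fixed_point_property[of n] by simp
qed

end
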